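(* Let $(A, X_1, X_2, X_3)$ be an $\mathbb{H}$-contraction acting on a complex Hilbert space $\mathcal{H}$. Then there exists an orthogonal decomposition $\mathcal{H}=\mathcal{H}^{(u)}\oplus\mathcal{H}^{(c)}$ into joint reducing subspaces $\mathcal{H}^{(u)}, \mathcal{H}^{(c)}$ for $A, X_1, X_2, X_3$ such that (1) $(A|_{\mathcal{H}^{(u)}}, X_1|_{\mathcal{H}^{(u)}}, X_2|_{\mathcal{H}^{(u)}}, X_3|_{\mathcal{H}^{(u)}})$ is an $\mathbb{H}$-unitary and (2) $(A|_{\mathcal{H}^{(c)}}, X_1|_{\mathcal{H}^{(c)}}, X_2|_{\mathcal{H}^{(c)}}, X_3|_{\mathcal{H}^{(c)}})$ is a completely non-unitary $\mathbb{H}$-contraction. Moreover, $\mathcal{H}^{(u)}$ is the maximal closed joint reducing subspace for $A, X_1, X_2, X_3$ restricted to which $(A, X_1, X_2, X_3)$ is an $\mathbb{H}$-unitary.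
   Context: All operators are bounded linear maps on complex Hilbert spaces; $\mathbb{D}$ is the open unit disc in $\mathbb{C}$. The tetrablock is $\mathbb{E}=\{(x_1,x_2,x_3)\in\mathbb{C}^3 : 1-x_1z_1-x_2z_2+x_3z_1z_2\neq 0 \text{ whenever } |z_1|\le 1, |z_2|\le 1\}$. The hexablock is $\mathbb{H}=\{(a,x_1,x_2,x_3)\in\mathbb{C}\times\mathbb{E} : \sup_{z_1,z_2\in\mathbb{D}}\left|\frac{a\sqrt{(1-|z_1|^2)(1-|z_2|^2)}}{1-x_1z_1-x_2z_2+x_3z_1z_2}\right|<1\}$; its closure is polynomially convex. A commuting quadruple $\underline{T}$ is an $\mathbb{H}$-contraction if $\|p(\underline{T})\|\le\sup_{\overline{\mathbb{H}}}|p|$ for every polynomial $p$ in four variables. The distinguished boundary $b\mathbb{H}$ is the smallest closed subset of $\overline{\mathbb{H}}$ on which every function continuous on $\overline{\mathbb{H}}$ and analytic in $\mathbb{H}$ attains its maximum modulus. An $\mathbb{H}$-unitary is a commuting quadruple of normal operators whose Taylor joint spectrum is contained in $b\mathbb{H}$. An $\mathbb{H}$-contraction is completely non-unitary if it has no nonzero closed joint reducing subspace on which it acts as an $\mathbb{H}$-unitary. Summands in the decomposition are allowed to be $\{0\}$. *)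

theory Defs
  imports "HOL-Analysis.Analysis" "HOL-Library.Poly_Mapping" "HOL-Library.Numeral_Type"
begin

section \<open>Complex Hilbert spaces\<close>

text \<open>The inner product is linear in its first argument. The axiom \<open>cinner_self\<close> says at once
  that it is positive definite and that it induces the norm.\<close>

class complex_inner = real_normed_vector +
  fixes scaleC :: "complex \<Rightarrow> 'a \<Rightarrow> 'a" (infixr "*\<^sub>C" 75)
    and cinner :: "'a \<Rightarrow> 'a \<Rightarrow> complex"
  assumes scaleC_add_right: "c *\<^sub>C (x + y) = c *\<^sub>C x + c *\<^sub>C y"
    and scaleC_add_left: "(c + d) *\<^sub>C x = c *\<^sub>C x + d *\<^sub>C x"
    and scaleC_scaleC: "c *\<^sub>C d *\<^sub>C x = (c * d) *\<^sub>C x"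
    and scaleC_of_real: "complex_of_real r *\<^sub>C x = r *\<^sub>R x"
    and cinner_add_left: "cinner (x + y) z = cinner x z + cinner y z"
    and cinner_scaleC_left: "cinner (c *\<^sub>C x) y = c * cinner x y"
    and cinner_commute: "cinner x y = cnj (cinner y x)"
    and cinner_self: "cinner x x = complex_of_real ((norm x)\<^sup>2)"

class chilbert_space = complex_inner + complete_space

definition csubspace :: "'a::complex_inner set \<Rightarrow> bool" where
  "csubspace M \<longleftrightarrow>
     0 \<in> M \<and> (\<forall>x\<in>M. \<forall>y\<in>M. x + y \<in> M) \<and> (\<forall>c. \<forall>x\<in>M. c *\<^sub>C x \<in> M)"

definition orthogonal_in :: "'a::complex_inner set \<Rightarrow> 'a set \<Rightarrow> 'a set" where
  "orthogonal_in M L = {x \<in> M. \<forall>y\<in>L. cinner x y = 0}"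

section \<open>Operators on a closed subspace\<close>

text \<open>A Hilbert space is given as a closed subspace \<open>M\<close> of the ambient type, so that the
  restriction of an operator to \<open>M\<close> is the same function considered relative to \<open>M\<close>.
  Values outside \<open>M\<close> are irrelevant; the whole space is \<open>M = UNIV\<close>.\<close>

definition bounded_op_on :: "'a::complex_inner set \<Rightarrow> ('a \<Rightarrow> 'a) \<Rightarrow> bool" where
  "bounded_op_on M S \<longleftrightarrow>
     S ` M \<subseteq> M \<and>
     (\<forall>x\<in>M. \<forall>y\<in>M. S (x + y) = S x + S y) \<and>
     (\<forall>c. \<forall>x\<in>M. S (c *\<^sub>C x) = c *\<^sub>C S x) \<and>
     (\<exists>K. \<forall>x\<in>M. norm (S x) \<le> K * norm x)"

text \<open>For \<open>M = UNIV\<close> this is \<^const>\<open>onorm\<close>.\<close>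
definition onorm_on :: "'a::complex_inner set \<Rightarrow> ('a \<Rightarrow> 'a) \<Rightarrow> real" where
  "onorm_on M S = (SUP x\<in>M. norm (S x) / norm x)"

definition is_adjoint_on :: "'a::complex_inner set \<Rightarrow> ('a \<Rightarrow> 'a) \<Rightarrow> ('a \<Rightarrow> 'a) \<Rightarrow> bool" where
  "is_adjoint_on M S R \<longleftrightarrow>
     bounded_op_on M R \<and> (\<forall>x\<in>M. \<forall>y\<in>M. cinner (S x) y = cinner x (R y))"

definition normal_on :: "'a::complex_inner set \<Rightarrow> ('a \<Rightarrow> 'a) \<Rightarrow> bool" where
  "normal_on M S \<longleftrightarrow> (\<exists>R. is_adjoint_on M S R \<and> (\<forall>x\<in>M. S (R x) = R (S x)))"

definition commuting_tuple_on :: "'a::complex_inner set \<Rightarrow> ('n \<Rightarrow> 'a \<Rightarrow> 'a) \<Rightarrow> bool" where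
  "commuting_tuple_on M T \<longleftrightarrow>
     csubspace M \<and> closed M \<and>
     (\<forall>i. bounded_op_on M (T i)) \<and>
     (\<forall>i j. \<forall>x\<in>M. T i (T j x) = T j (T i x))"

definition joint_reducing :: "'a::complex_inner set \<Rightarrow> 'a set \<Rightarrow> ('n \<Rightarrow> 'a \<Rightarrow> 'a) \<Rightarrow> bool" where
  "joint_reducing M L T \<longleftrightarrow>
     csubspace L \<and> closed L \<and> L \<subseteq> M \<and>
     (\<forall>i. T i ` L \<subseteq> L \<and> T i ` orthogonal_in M L \<subseteq> orthogonal_in M L)"

section \<open>Taylor joint spectrum\<close>

text \<open>An element of \<open>M \<otimes> \<Lambda>\<^sup>p(\<complex>\<^sup>n)\<close> is represented by its coefficients \<open>\<xi> J\<close> with respect to the basis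
  \<open>e\<^sub>J = e\<^sub>j\<^sub>1 \<and> \<dots> \<and> e\<^sub>j\<^sub>p\<close>, \<open>J = {j\<^sub>1 < \<dots> < j\<^sub>p}\<close>. The differential is
  \<open>x \<otimes> e\<^sub>J \<mapsto> \<Sum>i. S\<^sub>i x \<otimes> (e\<^sub>i \<and> e\<^sub>J)\<close>, where \<open>e\<^sub>i \<and> e\<^sub>J\<close> is sorted by moving \<open>e\<^sub>i\<close> past the \<open>e\<^sub>j\<close> with \<open>j < i\<close>.\<close>

definition koszul_space :: "'a::complex_inner set \<Rightarrow> nat \<Rightarrow> ('n::{finite,linorder} set \<Rightarrow> 'a) set" where
  "koszul_space M p = {\<xi>. \<forall>J. \<xi> J \<in> M \<and> (card J \<noteq> p \<longrightarrow> \<xi> J = 0)}"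

definition koszul_d ::
    "('n::{finite,linorder} \<Rightarrow> 'a \<Rightarrow> 'a::complex_inner) \<Rightarrow> ('n set \<Rightarrow> 'a) \<Rightarrow> 'n set \<Rightarrow> 'a" where
  "koszul_d S \<xi> = (\<lambda>J. \<Sum>i\<in>J. (-1) ^ card {j \<in> J. j < i} *\<^sub>R S i (\<xi> (J - {i})))"

definition koszul_exact ::
    "'a::complex_inner set \<Rightarrow> ('n::{finite,linorder} \<Rightarrow> 'a \<Rightarrow> 'a) \<Rightarrow> bool" where
  "koszul_exact M S \<longleftrightarrow>
     {\<xi> \<in> koszul_space M 0. koszul_d S \<xi> = (\<lambda>_. 0)} = {\<lambda>_. 0} \<and>
     (\<forall>p. {\<xi> \<in> koszul_space M (Suc p). koszul_d S \<xi> = (\<lambda>_. 0)} = koszul_d S ` koszul_space M p)"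

definition taylor_spectrum_on ::
    "'a::complex_inner set \<Rightarrow> ('n::{finite,linorder} \<Rightarrow> 'a \<Rightarrow> 'a) \<Rightarrow> (complex ^ 'n::{finite,linorder}) set" where
  "taylor_spectrum_on M T = {l. \<not> koszul_exact M (\<lambda>i x. T i x - (l $ i) *\<^sub>C x)}"

section \<open>The tetrablock, the hexablock and its distinguished boundary\<close>

definition tetrablock :: "(complex \<times> complex \<times> complex) set" where
  "tetrablock = {(x1, x2, x3). \<forall>z1 z2. cmod z1 \<le> 1 \<longrightarrow> cmod z2 \<le> 1 \<longrightarrow>
     1 - x1 * z1 - x2 * z2 + x3 * z1 * z2 \<noteq> 0}"

text \<open>The index type \<open>4\<close> consists of \<open>0 < 1 < 2 < 3\<close>; a point \<open>(a, x\<^sub>1, x\<^sub>2, x\<^sub>3)\<close> is the vector \<open>w\<close> with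
  \<open>w $ 0 = a\<close> and \<open>w $ i = x\<^sub>i\<close> for \<open>i = 1, 2, 3\<close>. The supremum is taken over a bounded set: for
  points of the tetrablock the denominator is bounded away from \<open>0\<close> on the closed bidisc.\<close>

definition hexablock :: "(complex ^ 4) set" where
  "hexablock = {w. (w $ 1, w $ 2, w $ 3) \<in> tetrablock \<and>
     (SUP (z1, z2) \<in> ball 0 1 \<times> ball 0 1.
        cmod (w $ 0 * complex_of_real (sqrt ((1 - (cmod z1)\<^sup>2) * (1 - (cmod z2)\<^sup>2))) /
              (1 - w $ 1 * z1 - w $ 2 * z2 + w $ 3 * z1 * z2))) < 1}"

text \<open>Analyticity in several variables on an open set: the (Frechet) derivative exists at every
  point and is complex linear.\<close>

definition analytic_several :: "(complex ^ 'n::finite \<Rightarrow> complex) \<Rightarrow> (complex ^ 'n::finite) set \<Rightarrow> bool" where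
  "analytic_several f U \<longleftrightarrow>
     (\<forall>w\<in>U. \<exists>D. (f has_derivative D) (at w) \<and> (\<forall>c v. D (c *s v) = c * D v))"

definition max_modulus_set :: "(complex ^ 'n::finite) set \<Rightarrow> (complex ^ 'n::finite) set \<Rightarrow> bool" where
  "max_modulus_set U B \<longleftrightarrow>
     closed B \<and> B \<subseteq> closure U \<and>
     (\<forall>f. continuous_on (closure U) f \<and> analytic_several f U \<longrightarrow>
        (\<exists>z\<in>B. \<forall>w\<in>closure U. cmod (f w) \<le> cmod (f z)))"

definition distinguished_boundary :: "(complex ^ 'n::finite) set \<Rightarrow> (complex ^ 'n::finite) set" where
  "distinguished_boundary U = (LEAST B. max_modulus_set U B)"

section \<open>Polynomials in four variables and their functional calculus\<close>

text \<open>A polynomial maps each exponent vector to its coefficient.\<close>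
type_synonym poly4 = "(4 \<Rightarrow>\<^sub>0 nat) \<Rightarrow>\<^sub>0 complex"

definition eval_poly4 :: "poly4 \<Rightarrow> complex ^ 4 \<Rightarrow> complex" where
  "eval_poly4 p w =
     (\<Sum>\<alpha>\<in>Poly_Mapping.keys p. Poly_Mapping.lookup p \<alpha> * (\<Prod>i\<in>UNIV. (w $ i) ^ Poly_Mapping.lookup \<alpha> i))"

text \<open>Only used for commuting tuples, so the order of the factors does not matter.\<close>
definition op_poly4 :: "poly4 \<Rightarrow> (4 \<Rightarrow> 'a \<Rightarrow> 'a::complex_inner) \<Rightarrow> 'a \<Rightarrow> 'a" where
  "op_poly4 p T x =
     (\<Sum>\<alpha>\<in>Poly_Mapping.keys p. Poly_Mapping.lookup p \<alpha> *\<^sub>C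
        (T 0 ^^ Poly_Mapping.lookup \<alpha> 0) ((T 1 ^^ Poly_Mapping.lookup \<alpha> 1)
        ((T 2 ^^ Poly_Mapping.lookup \<alpha> 2) ((T 3 ^^ Poly_Mapping.lookup \<alpha> 3) x))))"

definition quadruple :: "'b \<Rightarrow> 'b \<Rightarrow> 'b \<Rightarrow> 'b \<Rightarrow> 4 \<Rightarrow> 'b" where
  "quadruple a x1 x2 x3 i = (if i = 0 then a else if i = 1 then x1 else if i = 2 then x2 else x3)"

section \<open>Operators associated with the hexablock\<close>

definition hexa_contraction_on :: "'a::complex_inner set \<Rightarrow> (4 \<Rightarrow> 'a \<Rightarrow> 'a) \<Rightarrow> bool" where
  "hexa_contraction_on M T \<longleftrightarrow>
     commuting_tuple_on M T \<and>
     (\<forall>p. onorm_on M (op_poly4 p T) \<le> (SUP w\<in>closure hexablock. cmod (eval_poly4 p w)))"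

definition hexa_unitary_on :: "'a::complex_inner set \<Rightarrow> (4 \<Rightarrow> 'a \<Rightarrow> 'a) \<Rightarrow> bool" where
  "hexa_unitary_on M T \<longleftrightarrow>
     commuting_tuple_on M T \<and> (\<forall>i. normal_on M (T i)) \<and>
     taylor_spectrum_on M T \<subseteq> distinguished_boundary hexablock"

definition hexa_cnu_on :: "'a::complex_inner set \<Rightarrow> (4 \<Rightarrow> 'a \<Rightarrow> 'a) \<Rightarrow> bool" where
  "hexa_cnu_on M T \<longleftrightarrow>
     hexa_contraction_on M T \<and>
     \<not> (\<exists>L. L \<noteq> {0} \<and> joint_reducing M L T \<and> hexa_unitary_on L T)"

end

theory Submission
  imports Defs "HOL-Complex_Analysis.Cauchy_Integral_Formula"
begin

text \<open>
  The unitary part \<open>Hu\<close> is the closed linear span of all joint reducing subspaces \<open>L\<close> on which the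
  quadruple \<open>T\<close> is a hexablock unitary. It reduces \<open>T\<close> and contains every such \<open>L\<close>. Polynomial norm
  estimates pass to invariant subspaces, and a reducing subspace of the orthogonal complement \<open>Hc\<close> reduces \<open>T\<close> on the
  whole space; so a hexablock unitary piece of \<open>Hc\<close> lies in \<open>Hu\<close> too and is zero. What has to be proved is that \<open>T\<close>
  restricted to \<open>Hu\<close> is a hexablock unitary. This holds for the distinguished boundary because it is a closed set,
  as follows.

  \<^bold>\<open>Closedness.\<close> The intersection of all closed boundaries of a nonempty bounded set is a boundary
  (the Shilov boundary, \<open>max_modulus_set_Inter\<close>), so the least one exists and is closed.

  \<^bold>\<open>Normality.\<close> On each \<open>L\<close> the commuting normal operators \<open>T\<^sub>i\<close> commute with each other's adjoints
  (\<open>fuglede\<close>). These are identities between bounded operators, so they extend to the closed span.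

  \<^bold>\<open>Spectrum.\<close> Let \<open>l\<close> have distance at least \<open>d > 0\<close> from the closed set \<open>K\<close> that contains the spectra on
  all the \<open>L\<close>, and let \<open>G = \<Sum>\<^sub>i (T\<^sub>i - l\<^sub>i)\<^sup>* (T\<^sub>i - l\<^sub>i)\<close>. On each \<open>L\<close> there is a lower bound \<open>G \<ge> c\<close> where
  \<open>c > 0\<close> depends only on \<open>d\<close> and the number of operators (\<open>gram_bounded_below\<close>): otherwise a power iteration
  yields joint approximate eigenvectors of the \<open>T\<^sub>i\<close> and their adjoints whose eigenvalue is within
  distance \<open>d\<close> of \<open>l\<close>, whereas exactness of the Koszul complex rules out such vectors by a gliding hump.
  The lower bound passes to the closed span although the \<open>L\<close> need not be orthogonal: it says that
  \<open>norm ((r - G)\<^sup>n x)\<close> grows at most like \<open>q\<^sup>n\<close> for suitable \<open>q < r\<close>, and for a self-adjoint operator the vectors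
  with this growth form a closed subspace (\<open>power_bounded_subspace\<close>). Hence \<open>G\<close> is invertible on \<open>Hu\<close>, and
  then \<open>G\<^sup>-\<^sup>1\<close> times the adjoint of the Koszul differential is a contracting homotopy
  (\<open>koszul_homotopy\<close>), so \<open>l\<close> is not in the spectrum on \<open>Hu\<close>.
\<close>

section \<open>The Shilov boundary\<close>

lemma analytic_several_const: "analytic_several (\<lambda>_. c) U"
  unfolding analytic_several_def by (auto intro!: exI[of _ "\<lambda>_. 0"])

lemma analytic_several_nth_diff:
  fixes U :: "(complex ^ 'n::finite) set"
  shows "analytic_several (\<lambda>w. w $ i - c) U"
  unfolding analytic_several_def
proof
  fix w :: "complex ^ 'n"
  have "((\<lambda>w. w $ i - c) has_derivative (\<lambda>v. v $ i)) (at w)"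
    by (auto intro!: derivative_eq_intros bounded_linear_imp_has_derivative bounded_linear_vec_nth)
  then show "\<exists>D. ((\<lambda>w. w $ i - c) has_derivative D) (at w) \<and> (\<forall>c v. D (c *s v) = c * D v)"
    by auto
qed

lemma analytic_several_mult:
  assumes "analytic_several f U" "analytic_several g U"
  shows "analytic_several (\<lambda>w. f w * g w) U"
  unfolding analytic_several_def
proof
  fix w assume "w \<in> U"
  then obtain D E where D: "(f has_derivative D) (at w)" "\<And>c v. D (c *s v) = c * D v"
    and E: "(g has_derivative E) (at w)" "\<And>c v. E (c *s v) = c * E v"
    using assms unfolding analytic_several_def by metis
  have "((\<lambda>w. f w * g w) has_derivative (\<lambda>h. f w * E h + D h * g w)) (at w)"
    by (rule has_derivative_mult[OF D(1) E(1)])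
  then show "\<exists>D. ((\<lambda>w. f w * g w) has_derivative D) (at w) \<and> (\<forall>c v. D (c *s v) = c * D v)"
    by (intro exI conjI) (auto simp: D(2) E(2) algebra_simps)
qed

lemma analytic_several_power:
  "analytic_several f U \<Longrightarrow> analytic_several (\<lambda>w. f w ^ n) U"
  by (induction n) (auto intro: analytic_several_const analytic_several_mult)

lemma max_modulus_setI:
  assumes "closed B" "B \<subseteq> closure U"
    and "\<And>f. \<lbrakk>continuous_on (closure U) f; analytic_several f U\<rbrakk>
           \<Longrightarrow> \<exists>z\<in>B. \<forall>w\<in>closure U. cmod (f w) \<le> cmod (f z)"
  shows "max_modulus_set U B"
  using assms unfolding max_modulus_set_def by blast

lemma max_modulus_setE:
  assumes "max_modulus_set U B" "continuous_on (closure U) f" "analytic_several f U"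
  obtains z where "z \<in> B" "z \<in> closure U" "\<And>w. w \<in> closure U \<Longrightarrow> cmod (f w) \<le> cmod (f z)"
  using assms unfolding max_modulus_set_def by (meson subsetD)

lemma max_modulus_set_closure:
  assumes "compact (closure U)" "U \<noteq> {}"
  shows "max_modulus_set U (closure U)"
  unfolding max_modulus_set_def
proof (intro conjI allI impI)
  fix f assume "continuous_on (closure U) f \<and> analytic_several f U"
  then have "continuous_on (closure U) (\<lambda>w. cmod (f w))"
    by (auto intro: continuous_intros)
  then show "\<exists>z\<in>closure U. \<forall>w\<in>closure U. cmod (f w) \<le> cmod (f z)"
    using continuous_attains_sup[OF assms(1), of "\<lambda>w. cmod (f w)"] assms(2)
    by (auto simp: closure_eq_empty)
qed auto

lemma open_polydisc: "open {w :: complex ^ 'n::finite. \<forall>i. cmod (w $ i - x $ i) < e}"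
proof -
  have "{w :: complex ^ 'n. \<forall>i. cmod (w $ i - x $ i) < e} =
      (\<Inter>i\<in>UNIV. {w. cmod (w $ i - x $ i) < e})" by auto
  also have "open \<dots>"
    by (intro open_INT ballI open_Collect_less continuous_intros finite)
  finally show ?thesis .
qed

text \<open>If removing the polydisc \<open>V e\<close> around \<open>x\<close> destroys the boundary \<open>E\<close>, some \<open>f\<close> peaks only inside it: on
the rest of \<open>E\<close> its modulus stays below the maximum. Then the functions \<open>f\<^sup>N (w\<^sub>i - x\<^sub>i)\<close> with large \<open>N\<close> force
all maximum points of \<open>f\<close> in the closure of \<open>U\<close> into \<open>V e\<close>, so every boundary meets \<open>V e\<close>.\<close>

lemma max_modulus_set_Diff_polydisc:
  fixes U :: "(complex ^ 'n::finite) set" and x :: "complex ^ 'n"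
  defines "V e \<equiv> {w. \<forall>i. cmod (w $ i - x $ i) < e}"
  assumes comp: "compact (closure U)"
    and E: "max_modulus_set U E" and E0: "max_modulus_set U E0" and disj: "V e \<inter> E0 = {}"
    and e: "e > 0"
  shows "max_modulus_set U (E - V e)"
  unfolding max_modulus_set_def
proof (intro conjI allI impI)
  have opV: "open (V e)" unfolding V_def by (rule open_polydisc)
  have clE: "closed E" and subE: "E \<subseteq> closure U" using E by (auto simp: max_modulus_set_def)
  show "closed (E - V e)" using clE opV by (rule closed_Diff)
  show "E - V e \<subseteq> closure U" using subE by auto
  fix f assume "continuous_on (closure U) f \<and> analytic_several f U"
  then have f: "continuous_on (closure U) f" "analytic_several f U" by auto
  show "\<exists>z\<in>E - V e. \<forall>w\<in>closure U. cmod (f w) \<le> cmod (f z)"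
  proof (rule ccontr)
    assume neg: "\<not> ?thesis"
    obtain z0 where z0: "z0 \<in> E" "\<And>w. w \<in> closure U \<Longrightarrow> cmod (f w) \<le> cmod (f z0)"
      using max_modulus_setE[OF E f] by metis
    obtain z1 where z1: "z1 \<in> E0" "\<And>w. w \<in> closure U \<Longrightarrow> cmod (f w) \<le> cmod (f z1)"
      using max_modulus_setE[OF E0 f] by metis
    have z1U: "z1 \<in> closure U" using z1(1) E0 by (auto simp: max_modulus_set_def)
    define m where "m = cmod (f z0)"
    have m1: "cmod (f z1) = m"
      using z0(2)[OF z1U] z1(2)[of z0] z0(1) subE by (auto simp: m_def)
    have less: "cmod (f w) < m" if "w \<in> E - V e" for w
      using neg that z0(2) unfolding m_def by (meson le_less_trans not_le)
    obtain q where q: "0 \<le> q" "q < m" "\<And>w. w \<in> E - V e \<Longrightarrow> cmod (f w) \<le> q"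
    proof (cases "E - V e = {}")
      case True
      have "0 < m"
      proof (rule ccontr)
        assume "\<not> 0 < m"
        then have "m = 0" unfolding m_def by simp
        have "z0 \<in> V e" using True z0(1) by auto
        \<comment> \<open>Some coordinate of \<open>w - x\<close> has modulus at least \<open>e\<close> at \<open>z1\<close>, hence also at a
          point of \<open>E\<close> where it is maximal, and this point is outside the polydisc.\<close>
        obtain i where i: "cmod (z1 $ i - x $ i) \<ge> e"
          using disj z1(1) unfolding V_def by (fastforce simp: not_less)
        have "continuous_on (closure U) (\<lambda>w. w $ i - x $ i)" by (intro continuous_intros)
        then obtain z2 where "z2 \<in> E" "\<And>w. w \<in> closure U \<Longrightarrow> cmod (w $ i - x $ i) \<le> cmod (z2 $ i - x $ i)"
          using max_modulus_setE[OF E _ analytic_several_nth_diff] by metis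
        then have "z2 \<in> E - V e" using i z1U unfolding V_def by (auto simp: not_less intro: order_trans)
        then show False using True by auto
      qed
      then show ?thesis using True that[of 0] by auto
    next
      case False
      have "compact (E - V e)"
        using comp clE opV subE by (metis Diff_eq closed_Compl closed_Int compact_Int_closed inf.absorb_iff2)
      moreover have "continuous_on (E - V e) (\<lambda>w. cmod (f w))"
        using f(1) subE by (auto intro!: continuous_intros elim: continuous_on_subset)
      ultimately obtain y where "y \<in> E - V e" "\<And>w. w \<in> E - V e \<Longrightarrow> cmod (f w) \<le> cmod (f y)"
        using continuous_attains_sup[OF _ False] by blast
      then show ?thesis using that[of "cmod (f y)"] less by auto
    qed
    have m: "m > 0" using q by linarith
    obtain Bd where Bd: "Bd > 0" "\<And>w. w \<in> closure U \<Longrightarrow> norm (w - x) \<le> Bd"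
    proof -
      have "bounded ((\<lambda>w. w - x) ` closure U)"
        using comp by (intro compact_imp_bounded compact_continuous_image continuous_intros)
      then show ?thesis using that unfolding bounded_pos by auto
    qed
    \<comment> \<open>A high power of \<open>f\<close> makes the coordinates negligible on \<open>E\<close> outside the polydisc.\<close>
    obtain N where N: "(q / m) ^ N < e / Bd"
      using real_arch_pow_inv[of "e / Bd" "q / m"] q m e Bd(1) by auto
    \<comment> \<open>This bound holds on \<open>E\<close>, hence everywhere since \<open>E\<close> is a boundary.\<close>
    have small: "cmod (f w ^ N * (w $ i - x $ i)) < m ^ N * e" if w: "w \<in> closure U" for w i
    proof -
      have "continuous_on (closure U) (\<lambda>w. f w ^ N * (w $ i - x $ i))"
        using f(1) by (intro continuous_intros)
      moreover have "analytic_several (\<lambda>w. f w ^ N * (w $ i - x $ i)) U"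
        by (intro analytic_several_mult analytic_several_power f(2) analytic_several_nth_diff)
      ultimately obtain z where z: "z \<in> E"
          "\<forall>w\<in>closure U. cmod (f w ^ N * (w $ i - x $ i)) \<le> cmod (f z ^ N * (z $ i - x $ i))"
        using E unfolding max_modulus_set_def by blast
      have "cmod (f z) ^ N * cmod (z $ i - x $ i) < m ^ N * e"
      proof (cases "z \<in> V e")
        case True
        then have "cmod (z $ i - x $ i) < e" by (auto simp: V_def)
        moreover have "cmod (f z) ^ N \<le> m ^ N"
          using z0(2) z(1) subE unfolding m_def by (intro power_mono) auto
        ultimately have "cmod (f z) ^ N * cmod (z $ i - x $ i) \<le> m ^ N * cmod (z $ i - x $ i)"
          by (intro mult_right_mono) auto
        also have "\<dots> < m ^ N * e" using m \<open>cmod (z $ i - x $ i) < e\<close> by simp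
        finally show ?thesis .
      next
        case False
        have "cmod (z $ i - x $ i) \<le> Bd"
          using Bd(2)[of z] z(1) subE Finite_Cartesian_Product.norm_nth_le[of "z - x" i] by force
        moreover have "cmod (f z) ^ N \<le> q ^ N"
          using q(3) z(1) False by (intro power_mono) auto
        ultimately have "cmod (f z) ^ N * cmod (z $ i - x $ i) \<le> q ^ N * Bd"
          using q(1) by (intro mult_mono) auto
        also have "\<dots> < m ^ N * e" using N m Bd(1) by (simp add: power_divide field_simps)
        finally show ?thesis .
      qed
      then show ?thesis using z(2) w by (auto simp: norm_mult norm_power intro: le_less_trans)
    qed
    have "cmod (z1 $ i - x $ i) < e" for i
      using small[OF z1U, of i] m by (simp add: norm_mult norm_power m1)
    then show False using disj z1(1) by (auto simp: V_def)
  qed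
qed

lemma norm_vec_le_sum: "norm (w :: complex ^ 'n::finite) \<le> (\<Sum>i\<in>UNIV. cmod (w $ i))"
  unfolding norm_vec_def by (rule L2_set_le_sum) auto

text \<open>If \<open>f\<close> had no maximum point in the intersection, then each of its maximum points would have a polydisc
around it that misses some boundary. Finitely many of these cover all maximum points, and removing them
from the closure of \<open>U\<close> leaves a boundary without a maximum point of \<open>f\<close>.\<close>

theorem max_modulus_set_Inter:
  fixes U :: "(complex ^ 'n::finite) set"
  assumes comp: "compact (closure U)" and "U \<noteq> {}"
  shows "max_modulus_set U (\<Inter>{B. max_modulus_set U B})" (is "max_modulus_set U ?S")
proof (rule max_modulus_setI)
  have mU: "max_modulus_set U (closure U)" using assms by (rule max_modulus_set_closure)
  show "closed ?S" by (auto simp: max_modulus_set_def)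
  show "?S \<subseteq> closure U" using mU by blast
  fix f assume f: "continuous_on (closure U) f" "analytic_several f U"
  show "\<exists>z\<in>?S. \<forall>w\<in>closure U. cmod (f w) \<le> cmod (f z)"
  proof (rule ccontr)
    assume neg: "\<not> ?thesis"
    obtain z0 where z0: "z0 \<in> closure U" "\<And>w. w \<in> closure U \<Longrightarrow> cmod (f w) \<le> cmod (f z0)"
      using max_modulus_setE[OF mU] f by metis
    define m where "m = cmod (f z0)"
    define K where "K = {w \<in> closure U. cmod (f w) = m}"
    have "closed K" unfolding K_def using f 
      by (auto intro!: continuous_closed_preimage_constant continuous_intros)
    moreover have "K \<subseteq> closure U" by (auto simp: K_def)
    ultimately have Kcomp: "compact K" using comp by (metis compact_Int_closed inf.absorb_iff2)
    define V where "V x e = {w :: complex ^ 'n. \<forall>i. cmod (w $ i - x $ i) < e}" for x e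
    have "\<exists>e E0. e > 0 \<and> max_modulus_set U E0 \<and> V x e \<inter> E0 = {}" if x: "x \<in> K" for x
    proof -
      have "x \<notin> ?S"
      proof
        assume "x \<in> ?S"
        moreover have "\<forall>w\<in>closure U. cmod (f w) \<le> cmod (f x)"
          using x z0(2) by (auto simp: K_def m_def)
        ultimately show False using neg by blast
      qed
      then obtain E0 where E0: "max_modulus_set U E0" "x \<notin> E0" by auto
      then have "open (- E0)" by (auto simp: max_modulus_set_def)
      then obtain r where r: "r > 0" "ball x r \<subseteq> - E0" using E0(2) openE by blast
      define e where "e = r / CARD('n)"
      have "V x e \<subseteq> ball x r"
      proof
        fix w assume "w \<in> V x e"
        then have "(\<Sum>i\<in>UNIV. cmod ((w - x) $ i)) < (\<Sum>i\<in>(UNIV :: 'n set). e)"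
          by (intro sum_strict_mono) (auto simp: V_def)
        then show "w \<in> ball x r"
          using norm_vec_le_sum[of "w - x"] by (auto simp: e_def dist_norm norm_minus_commute)
      qed
      then show ?thesis using r E0(1) by (intro exI[of _ e] exI[of _ E0]) (auto simp: e_def)
    qed
    then obtain e E0 where eE: "\<And>x. x \<in> K \<Longrightarrow> e x > 0 \<and> max_modulus_set U (E0 x) \<and> V x (e x) \<inter> E0 x = {}"
      by metis
    have "K \<subseteq> (\<Union>x\<in>K. V x (e x))" using eE by (auto simp: V_def)
    moreover have "open (V x (e x))" for x unfolding V_def by (rule open_polydisc)
    ultimately obtain F where F: "F \<subseteq> K" "finite F" "K \<subseteq> (\<Union>x\<in>F. V x (e x))"
      using compactE_image[OF Kcomp, of K "\<lambda>x. V x (e x)"] by metis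
    have "max_modulus_set U (closure U - (\<Union>x\<in>F. V x (e x)))" using F(2,1)
    proof (induction F)
      case empty
      then show ?case using mU by simp
    next
      case (insert x F)
      have "max_modulus_set U (closure U - (\<Union>x\<in>F. V x (e x)) - V x (e x))"
        unfolding V_def using insert eE[of x]
        by (intro max_modulus_set_Diff_polydisc[OF comp, where ?E0.0 = "E0 x"]) (auto simp: V_def)
      then show ?case by (simp add: Diff_eq Int_ac)
    qed
    then obtain z where z: "z \<in> closure U - (\<Union>x\<in>F. V x (e x))" "\<And>w. w \<in> closure U \<Longrightarrow> cmod (f w) \<le> cmod (f z)"
      using max_modulus_setE f by metis
    then have "z \<in> K" using z0 by (auto simp: K_def m_def intro: antisym)
    then show False using z(1) F(3) by auto
  qed
qed

corollary closed_distinguished_boundary: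
  assumes "compact (closure U)" "U \<noteq> {}"
  shows "closed (distinguished_boundary U)"
proof -
  have "distinguished_boundary U = \<Inter>{B. max_modulus_set U B}"
    unfolding distinguished_boundary_def
    by (rule Least_equality) (use max_modulus_set_Inter[OF assms] in auto)
  then show ?thesis by (auto simp: max_modulus_set_def)
qed

section \<open>The hexablock is bounded\<close>

lemma tetrablock_bounds:
  assumes "(x1, x2, x3) \<in> tetrablock"
  shows "cmod x1 \<le> 1" "cmod x2 \<le> 1" "cmod x3 \<le> 1"
proof -
  have nz: "1 - x1 * z1 - x2 * z2 + x3 * z1 * z2 \<noteq> 0" if "cmod z1 \<le> 1" "cmod z2 \<le> 1" for z1 z2
    using assms that by (auto simp: tetrablock_def)
  show "cmod x1 \<le> 1"
  proof (rule ccontr)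
    assume "\<not> cmod x1 \<le> 1"
    then show False using nz[of "1 / x1" 0] by (cases "x1 = 0") (auto simp: norm_divide divide_le_eq)
  qed
  show "cmod x2 \<le> 1"
  proof (rule ccontr)
    assume "\<not> cmod x2 \<le> 1"
    then show False using nz[of 0 "1 / x2"] by (cases "x2 = 0") (auto simp: norm_divide divide_le_eq)
  qed
  show "cmod x3 \<le> 1"
  proof (rule ccontr)
    assume big: "\<not> cmod x3 \<le> 1"
    \<comment> \<open>On the diagonal \<open>z1 = z2\<close> the denominator is quadratic, and the product of its roots
      \<open>u\<close> and \<open>v\<close> is \<open>1 / x3\<close>: one of them is in the closed disc if \<open>x3\<close> is not.\<close>
    define r where "r = csqrt ((x1 + x2)\<^sup>2 - 4 * x3)"
    have r2: "r * r = (x1 + x2)\<^sup>2 - 4 * x3" using power2_csqrt unfolding r_def power2_eq_square by metis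
    define u where "u = (x1 + x2 + r) / (2 * x3)"
    define v where "v = (x1 + x2 - r) / (2 * x3)"
    have x3: "x3 \<noteq> 0" using big by auto
    have "u * v = ((x1 + x2)\<^sup>2 - r * r) / (4 * x3 * x3)"
      unfolding u_def v_def by (simp add: power2_eq_square algebra_simps)
    also have "\<dots> = 1 / x3" unfolding r2 using x3 by simp
    finally have uv: "u * v = 1 / x3" .
    have uv': "u + v = (x1 + x2) / x3" unfolding u_def v_def using x3 by (simp add: field_simps)
    have root: "1 - x1 * z - x2 * z + x3 * z * z = x3 * ((z - u) * (z - v))" for z
    proof -
      have "x3 * ((z - u) * (z - v)) = x3 * (z * z) - x3 * (u + v) * z + x3 * (u * v)"
        by (simp add: algebra_simps)
      also have "\<dots> = 1 - x1 * z - x2 * z + x3 * z * z"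
        unfolding uv uv' using x3 by (simp add: field_simps)
      finally show ?thesis ..
    qed
    have "cmod u > 1" "cmod v > 1" using nz[of u u] nz[of v v] root by force+
    then have "cmod (u * v) > 1" by (simp add: norm_mult less_1_mult)
    then show False using big x3 by (simp add: uv norm_divide less_divide_eq)
  qed
qed

text \<open>At \<open>z\<^sub>1 = z\<^sub>2 = 0\<close> the function in the definition has the value \<open>|a|\<close>. This is bounded by the supremum
since the denominator does not vanish on the compact closed bidisc.\<close>

lemma hexablock_first_bound:
  assumes "w \<in> hexablock"
  shows "cmod (w $ 0) \<le> 1"
proof -
  define den where "den z = 1 - w $ 1 * fst z - w $ 2 * snd z + w $ 3 * fst z * snd z" for z
  define g where "g z = cmod (w $ 0 * complex_of_real (sqrt ((1 - (cmod (fst z))\<^sup>2) * (1 - (cmod (snd z))\<^sup>2))) / den z)"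
    for z
  let ?C = "cball (0 :: complex) 1 \<times> cball (0 :: complex) 1"
  let ?B = "ball (0 :: complex) 1 \<times> ball (0 :: complex) 1"
  have tet: "(w $ 1, w $ 2, w $ 3) \<in> tetrablock" and sup: "(SUP z\<in>?B. g z) < 1"
    using assms by (auto simp: hexablock_def g_def den_def case_prod_unfold)
  have "den z \<noteq> 0" if "z \<in> ?C" for z
    using tet that by (auto simp: tetrablock_def den_def)
  then have "continuous_on ?C g"
    unfolding g_def den_def by (intro continuous_intros) auto
  moreover have "compact ?C" by (intro compact_Times compact_cball)
  ultimately have "bdd_above (g ` ?C)"
    by (intro bounded_imp_bdd_above compact_imp_bounded compact_continuous_image)
  moreover have "?B \<subseteq> ?C" by auto
  ultimately have "bdd_above (g ` ?B)" by (meson bdd_above_mono image_mono)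
  then have "g (0, 0) \<le> (SUP z\<in>?B. g z)" by (intro cSUP_upper) auto
  then show ?thesis using sup by (simp add: g_def den_def)
qed

lemma zero_in_hexablock: "0 \<in> hexablock"
  by (auto simp: hexablock_def tetrablock_def case_prod_unfold)

lemma compact_closure_hexablock: "compact (closure hexablock)"
proof -
  have four: "(4 :: 4) = 0" by simp
  have "norm w \<le> 4" if "w \<in> hexablock" for w
  proof -
    have "cmod (w $ i) \<le> 1" for i
      using that tetrablock_bounds[of "w $ 1" "w $ 2" "w $ 3"] hexablock_first_bound[OF that]
        exhaust_4[of i, unfolded four]
      by (auto simp: hexablock_def)
    then have "(\<Sum>i\<in>UNIV. cmod (w $ i)) \<le> (\<Sum>i\<in>(UNIV :: 4 set). 1)" by (intro sum_mono) auto
    then show ?thesis using norm_vec_le_sum[of w] by simp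
  qed
  then show ?thesis unfolding compact_closure bounded_iff by blast
qed

lemma closed_distinguished_boundary_hexablock: "closed (distinguished_boundary hexablock)"
  using closed_distinguished_boundary compact_closure_hexablock zero_in_hexablock by blast

section \<open>Geometry of complex Hilbert spaces\<close>

lemma scaleC_zero_left [simp]: "0 *\<^sub>C (x :: 'a::complex_inner) = 0"
  using scaleC_of_real[of 0 x] by simp

lemma scaleC_one [simp]: "1 *\<^sub>C (x :: 'a::complex_inner) = x"
  using scaleC_of_real[of 1 x] by simp

lemma scaleC_zero_right [simp]: "c *\<^sub>C (0 :: 'a::complex_inner) = 0"
  using scaleC_add_right[of c 0 "0 :: 'a"] by simp

lemma scaleC_minus_one: "(- 1) *\<^sub>C (x :: 'a::complex_inner) = - x"
  using scaleC_of_real[of "-1" x] by simp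

lemma scaleC_minus_left: "(- c) *\<^sub>C (x :: 'a::complex_inner) = - (c *\<^sub>C x)"
  using scaleC_add_left[of c "- c" x] by (simp add: minus_unique)

lemma scaleC_minus_right: "c *\<^sub>C (- x) = - (c *\<^sub>C (x :: 'a::complex_inner))"
  using scaleC_add_right[of c x "- x"] by (simp add: minus_unique)

lemma scaleC_diff_right: "c *\<^sub>C (x - y) = c *\<^sub>C x - c *\<^sub>C (y :: 'a::complex_inner)"
  using scaleC_add_right[of c x "- y"] by (simp add: scaleC_minus_right)

lemma scaleC_diff_left: "(c - d) *\<^sub>C x = c *\<^sub>C x - d *\<^sub>C (x :: 'a::complex_inner)"
  using scaleC_add_left[of c "- d" x] by (simp add: scaleC_minus_left)

lemma cinner_add_right: "cinner x (y + z) = cinner x y + cinner x (z :: 'a::complex_inner)"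
  by (metis cinner_add_left cinner_commute complex_cnj_add)

lemma cinner_scaleC_right: "cinner x (c *\<^sub>C y) = cnj c * cinner x (y :: 'a::complex_inner)"
  by (metis cinner_scaleC_left cinner_commute complex_cnj_mult)

lemma cinner_zero_left [simp]: "cinner 0 (x :: 'a::complex_inner) = 0"
  using cinner_scaleC_left[of 0 x x] by simp

lemma cinner_zero_right [simp]: "cinner (x :: 'a::complex_inner) 0 = 0"
  using cinner_scaleC_right[of x 0 x] by simp

lemma cinner_minus_left: "cinner (- x) y = - cinner x (y :: 'a::complex_inner)"
  using cinner_scaleC_left[of "-1" x y] by (simp add: scaleC_minus_one)

lemma cinner_minus_right: "cinner x (- y) = - cinner x (y :: 'a::complex_inner)"
  using cinner_scaleC_right[of x "-1" y] by (simp add: scaleC_minus_one)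

lemma cinner_diff_left: "cinner (x - y) z = cinner x z - cinner y (z :: 'a::complex_inner)"
  using cinner_add_left[of x "- y" z] by (simp add: cinner_minus_left)

lemma cinner_diff_right: "cinner x (y - z) = cinner x y - cinner x (z :: 'a::complex_inner)"
  using cinner_add_right[of x y "- z"] by (simp add: cinner_minus_right)

lemma cinner_sum_left: "cinner (sum f A) (y :: 'a::complex_inner) = (\<Sum>i\<in>A. cinner (f i) y)"
  by (induction A rule: infinite_finite_induct) (auto simp: cinner_add_left)

lemma cinner_sum_right: "cinner (y :: 'a::complex_inner) (sum f A) = (\<Sum>i\<in>A. cinner y (f i))"
  by (induction A rule: infinite_finite_induct) (auto simp: cinner_add_right)

lemmas cinner_simps = cinner_add_left cinner_add_right cinner_diff_left cinner_diff_right
  cinner_scaleC_left cinner_scaleC_right cinner_minus_left cinner_minus_right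

lemma norm_sq_eq_Re_cinner: "(norm (x :: 'a::complex_inner))\<^sup>2 = Re (cinner x x)"
  by (simp add: cinner_self)

lemma cinner_self_eq_zero: "cinner x x = 0 \<longleftrightarrow> (x :: 'a::complex_inner) = 0"
  by (simp add: cinner_self)

lemma Re_cinner_commute: "Re (cinner x y) = Re (cinner y (x :: 'a::complex_inner))"
  by (metis cinner_commute complex_cnj_cancel_iff cnj.simps(1))

lemma norm_add_sq:
  "(norm (x + y))\<^sup>2 = (norm x)\<^sup>2 + 2 * Re (cinner x y) + (norm (y :: 'a::complex_inner))\<^sup>2"
  by (simp add: norm_sq_eq_Re_cinner cinner_simps Re_cinner_commute[of y x])

lemma norm_diff_sq:
  "(norm (x - y))\<^sup>2 = (norm x)\<^sup>2 - 2 * Re (cinner x y) + (norm (y :: 'a::complex_inner))\<^sup>2"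
  by (simp add: norm_sq_eq_Re_cinner cinner_simps Re_cinner_commute[of y x])

lemma norm_scaleC: "norm (c *\<^sub>C x) = cmod c * norm (x :: 'a::complex_inner)"
proof -
  have "complex_of_real ((norm (c *\<^sub>C x))\<^sup>2) = c * cnj c * complex_of_real ((norm x)\<^sup>2)"
    by (simp only: cinner_self[symmetric] cinner_simps) (simp only: mult_ac)
  also have "\<dots> = complex_of_real ((cmod c * norm x)\<^sup>2)"
    by (simp add: complex_norm_square[symmetric] power_mult_distrib)
  finally have "(norm (c *\<^sub>C x))\<^sup>2 = (cmod c * norm x)\<^sup>2" by (simp only: of_real_eq_iff)
  then show ?thesis by (simp add: power2_eq_iff_nonneg)
qed

lemma norm_cinner_le: "cmod (cinner x y) \<le> norm x * norm (y :: 'a::complex_inner)"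
proof (cases "y = 0")
  case False
  define c where "c = cinner x y / complex_of_real ((norm y)\<^sup>2)"
  have y: "(norm y)\<^sup>2 > 0" using False by simp
  have "0 \<le> (norm (x - c *\<^sub>C y))\<^sup>2" by simp
  also have "\<dots> = (norm x)\<^sup>2 - 2 * Re (cnj c * cinner x y) + (cmod c)\<^sup>2 * (norm y)\<^sup>2"
    by (simp only: norm_diff_sq cinner_simps norm_scaleC power_mult_distrib)
  also have "cnj c * cinner x y = complex_of_real ((cmod (cinner x y))\<^sup>2 / (norm y)\<^sup>2)"
    unfolding c_def of_real_divide complex_norm_square by simp
  also have "(cmod c)\<^sup>2 * (norm y)\<^sup>2 = (cmod (cinner x y))\<^sup>2 / (norm y)\<^sup>2"
    using y by (simp add: c_def norm_divide norm_mult power2_eq_square)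
  finally have "(cmod (cinner x y))\<^sup>2 / (norm y)\<^sup>2 \<le> (norm x)\<^sup>2" by simp
  then have "(cmod (cinner x y))\<^sup>2 \<le> (norm x * norm y)\<^sup>2"
    using y by (simp add: field_simps power_mult_distrib)
  then show ?thesis by (rule power2_le_imp_le) simp
qed simp

lemma bounded_linear_cinner_left: "bounded_linear (\<lambda>x. cinner x (y :: 'a::complex_inner))"
  by (rule bounded_linear_intro[where K = "norm y"])
    (simp_all add: cinner_add_left cinner_scaleC_left norm_cinner_le scaleR_conv_of_real
      flip: scaleC_of_real)

lemma bounded_linear_scaleC_right: "bounded_linear (\<lambda>x :: 'a::complex_inner. c *\<^sub>C x)"
  by (rule bounded_linear_intro[where K = "cmod c"])
    (simp_all add: scaleC_add_right scaleC_scaleC norm_scaleC mult.commute flip: scaleC_of_real)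

lemma csubspaceD:
  assumes "csubspace M"
  shows "0 \<in> M" "\<And>x y. x \<in> M \<Longrightarrow> y \<in> M \<Longrightarrow> x + y \<in> M" "\<And>c x. x \<in> M \<Longrightarrow> c *\<^sub>C x \<in> M"
    "\<And>x. x \<in> M \<Longrightarrow> - x \<in> M" "\<And>x y. x \<in> M \<Longrightarrow> y \<in> M \<Longrightarrow> x - y \<in> M"
    "\<And>r x. x \<in> M \<Longrightarrow> r *\<^sub>R x \<in> M"
proof -
  show a: "0 \<in> M" "\<And>x y. x \<in> M \<Longrightarrow> y \<in> M \<Longrightarrow> x + y \<in> M" "\<And>c x. x \<in> M \<Longrightarrow> c *\<^sub>C x \<in> M"
    using assms by (auto simp: csubspace_def)
  show b: "- x \<in> M" if "x \<in> M" for x using a(3)[OF that, of "-1"] by (simp add: scaleC_minus_one)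
  show "x - y \<in> M" if "x \<in> M" "y \<in> M" for x y using a(2)[OF that(1) b[OF that(2)]] by simp
  show "r *\<^sub>R x \<in> M" if "x \<in> M" for r x using a(3)[OF that, of "of_real r"] by (simp add: scaleC_of_real)
qed

lemma csubspace_sum: "csubspace M \<Longrightarrow> (\<And>i. i \<in> I \<Longrightarrow> f i \<in> M) \<Longrightarrow> sum f I \<in> M"
  by (induction I rule: infinite_finite_induct) (auto simp: csubspaceD)

lemma csubspace_Inter: "(\<And>M. M \<in> F \<Longrightarrow> csubspace M) \<Longrightarrow> csubspace (\<Inter>F)"
  by (auto simp: csubspace_def)

lemma csubspace_orthogonal: "csubspace M \<Longrightarrow> csubspace (orthogonal_in M L)"
  by (auto simp: csubspace_def orthogonal_in_def cinner_simps)

lemma closed_orthogonal: "closed M \<Longrightarrow> closed (orthogonal_in M L)"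
proof -
  assume M: "closed M"
  have "orthogonal_in M L = M \<inter> (\<Inter>y\<in>L. {x. cinner x y = 0})" by (auto simp: orthogonal_in_def)
  moreover have "closed {x :: 'a. cinner x y = 0}" for y
    by (intro closed_Collect_eq bounded_linear.continuous_on[OF bounded_linear_cinner_left] continuous_intros)
  ultimately show ?thesis using M by (simp add: closed_Int closed_INT)
qed

text \<open>A minimizing sequence for the distance from \<open>x\<close> to \<open>M\<close> is Cauchy by the parallelogram law, and the
  minimality of the distance makes the difference orthogonal to \<open>M\<close>.\<close>

theorem orthogonal_projection_exists:
  fixes M :: "'a::chilbert_space set"
  assumes M: "csubspace M" "closed M"
  obtains m where "m \<in> M" "x - m \<in> orthogonal_in UNIV M"
proof -
  define d where "d = (INF y\<in>M. norm (x - y))"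
  have bdd: "bdd_below ((\<lambda>y. norm (x - y)) ` M)" by (rule bdd_belowI[of _ 0]) auto
  have ne: "M \<noteq> {}" using csubspaceD(1)[OF M(1)] by auto
  have dle: "d \<le> norm (x - y)" if "y \<in> M" for y
    unfolding d_def by (rule cINF_lower[OF bdd that])
  have d0: "d \<ge> 0" unfolding d_def by (rule cINF_greatest[OF ne]) simp
  have "\<exists>y\<in>M. norm (x - y) < d + inverse (real (Suc n))" for n
    using cINF_less_iff[OF ne bdd, of "d + inverse (real (Suc n))"] by (simp add: d_def)
  then obtain y where y: "\<And>n. y n \<in> M" "\<And>n. norm (x - y n) < d + inverse (real (Suc n))" by metis
  have dist: "(\<lambda>n. norm (x - y n)) \<longlonglongrightarrow> d"
  proof (rule tendsto_sandwich[of "\<lambda>_. d" _ _ "\<lambda>n. d + inverse (real (Suc n))"])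
    show "(\<lambda>n. d + inverse (real (Suc n))) \<longlonglongrightarrow> d"
      using tendsto_add[OF tendsto_const LIMSEQ_inverse_real_of_nat] by simp
  qed (use dle y less_imp_le in \<open>blast intro: always_eventually\<close>)+
  have par: "(norm (y m - y n))\<^sup>2 \<le> 2 * (norm (x - y m))\<^sup>2 + 2 * (norm (x - y n))\<^sup>2 - 4 * d\<^sup>2" for m n
  proof -
    have "(1 / 2) *\<^sub>R (y m + y n) \<in> M" using M y by (auto intro!: csubspaceD)
    then have "2 * d \<le> 2 * norm (x - (1 / 2) *\<^sub>R (y m + y n))" using dle by simp
    also have "\<dots> = norm (2 *\<^sub>R (x - (1 / 2) *\<^sub>R (y m + y n)))" by simp
    also have "2 *\<^sub>R (x - (1 / 2) *\<^sub>R (y m + y n)) = (x - y m) + (x - y n)"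
      by (simp add: scaleR_right_diff_distrib scaleR_2 algebra_simps)
    finally have "(2 * d)\<^sup>2 \<le> (norm ((x - y m) + (x - y n)))\<^sup>2" using d0 by (intro power_mono) auto
    moreover have "norm (y m - y n) = norm ((x - y m) - (x - y n))" by (simp add: norm_minus_commute)
    ultimately show ?thesis
      using norm_add_sq[of "x - y m" "x - y n"] norm_diff_sq[of "x - y m" "x - y n"]
      by (simp add: power_mult_distrib)
  qed
  have "Cauchy y"
  proof (rule metric_CauchyI)
    fix e :: real assume e: "e > 0"
    have "(\<lambda>n. (norm (x - y n))\<^sup>2) \<longlonglongrightarrow> d\<^sup>2" using dist by (intro tendsto_power)
    then have "\<forall>\<^sub>F n in sequentially. (norm (x - y n))\<^sup>2 < d\<^sup>2 + e\<^sup>2 / 4"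
      using e by (intro order_tendstoD) auto
    then obtain N where N: "\<And>n. n \<ge> N \<Longrightarrow> (norm (x - y n))\<^sup>2 < d\<^sup>2 + e\<^sup>2 / 4"
      unfolding eventually_sequentially by auto
    have "dist (y m) (y n) < e" if "m \<ge> N" "n \<ge> N" for m n
    proof -
      have "(norm (y m - y n))\<^sup>2 < e\<^sup>2" using par[of m n] N[OF that(1)] N[OF that(2)] by simp
      then show ?thesis using e by (simp add: dist_norm power_less_imp_less_base)
    qed
    then show "\<exists>N. \<forall>m\<ge>N. \<forall>n\<ge>N. dist (y m) (y n) < e" by blast
  qed
  then obtain m where m: "y \<longlonglongrightarrow> m" using Cauchy_convergent convergent_def by blast
  have mM: "m \<in> M" using M(2) y(1) m by (rule closed_sequentially)
  have "(\<lambda>n. norm (x - y n)) \<longlonglongrightarrow> norm (x - m)" using m by (intro tendsto_intros)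
  then have nd: "norm (x - m) = d" using dist LIMSEQ_unique by blast
  have "cinner (x - m) z = 0" if z: "z \<in> M" for z
  proof (rule ccontr)
    assume nz: "cinner (x - m) z \<noteq> 0"
    then have "z \<noteq> 0" by auto
    then have z2: "(norm z)\<^sup>2 > 0" by simp
    define c where "c = cinner (x - m) z / complex_of_real ((norm z)\<^sup>2)"
    have "m + c *\<^sub>C z \<in> M" using mM z M(1) by (intro csubspaceD)
    then have "d \<le> norm ((x - m) - c *\<^sub>C z)" using dle by (simp add: algebra_simps)
    then have "d\<^sup>2 \<le> (norm ((x - m) - c *\<^sub>C z))\<^sup>2" using d0 by (intro power_mono) auto
    also have "\<dots> = d\<^sup>2 - 2 * Re (cnj c * cinner (x - m) z) + (cmod c)\<^sup>2 * (norm z)\<^sup>2"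
      by (simp only: norm_diff_sq cinner_simps norm_scaleC power_mult_distrib nd)
    also have "cnj c * cinner (x - m) z = complex_of_real ((cmod (cinner (x - m) z))\<^sup>2 / (norm z)\<^sup>2)"
      unfolding c_def of_real_divide complex_norm_square by simp
    also have "(cmod c)\<^sup>2 * (norm z)\<^sup>2 = (cmod (cinner (x - m) z))\<^sup>2 / (norm z)\<^sup>2"
      using z2 by (simp add: c_def norm_divide norm_mult power2_eq_square)
    finally have "(cmod (cinner (x - m) z))\<^sup>2 / (norm z)\<^sup>2 \<le> 0" by simp
    moreover have "(cmod (cinner (x - m) z))\<^sup>2 / (norm z)\<^sup>2 > 0" using nz z2 by simp
    ultimately show False by linarith
  qed
  then show ?thesis using that mM by (auto simp: orthogonal_in_def)
qed

lemma orthogonal_orthogonal: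
  fixes L :: "'a::chilbert_space set"
  assumes "csubspace L" "closed L" and x: "\<And>y. y \<in> orthogonal_in UNIV L \<Longrightarrow> cinner x y = 0"
  shows "x \<in> L"
proof -
  obtain m where m: "m \<in> L" "x - m \<in> orthogonal_in UNIV L"
    using orthogonal_projection_exists assms(1,2) by blast
  have "cinner m (x - m) = 0"
    using m cinner_commute[of m "x - m"] by (auto simp: orthogonal_in_def)
  then have "cinner (x - m) (x - m) = 0" using x[OF m(2)] \<open>cinner m (x - m) = 0\<close> using cinner_diff_left[of x m "x - m"] by simp
  then show ?thesis using m(1) by (simp add: cinner_self_eq_zero)
qed

section \<open>Bounded operators and adjoints\<close>

abbreviation bop :: "('a::complex_inner \<Rightarrow> 'a) \<Rightarrow> bool" where "bop \<equiv> bounded_op_on UNIV"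

lemma bopD:
  assumes "bop S"
  shows "S (x + y) = S x + S y" "S (c *\<^sub>C x) = c *\<^sub>C S x" "S 0 = 0" "S (- x) = - S x"
    "S (x - y) = S x - S y" "S (r *\<^sub>R x) = r *\<^sub>R S x" "S (sum f I) = (\<Sum>i\<in>I. S (f i))"
    "bounded_linear S" "continuous_on A S"
proof -
  show a: "S (x + y) = S x + S y" for x y using assms by (auto simp: bounded_op_on_def)
  show b: "S (c *\<^sub>C x) = c *\<^sub>C S x" for x c using assms by (auto simp: bounded_op_on_def)
  show c: "S 0 = 0" using b[of 0 0] by simp
  show d: "S (- x) = - S x" for x using b[of "-1" x] by (simp add: scaleC_minus_one)
  show "S (x - y) = S x - S y" using a[of x "-y"] d by simp
  show e: "S (r *\<^sub>R x) = r *\<^sub>R S x" for r x using b[of "of_real r" x] by (simp add: scaleC_of_real)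
  show "S (sum f I) = (\<Sum>i\<in>I. S (f i))"
    by (induction I rule: infinite_finite_induct) (auto simp: a c)
  obtain K where "\<And>x. norm (S x) \<le> norm x * K"
    using assms by (auto simp: bounded_op_on_def mult.commute)
  then show f: "bounded_linear S" using a e by (intro bounded_linear_intro)
  then show "continuous_on A S" by (rule linear_continuous_on)
qed

lemma bop_bound: 
  assumes "bop S" obtains K where "K > 0" "\<And>x. norm (S x) \<le> K * norm x"
  using bounded_linear.pos_bounded[OF bopD(8)[OF assms]] by (auto simp: mult.commute)

lemma bopI:
  assumes "\<And>x y. S (x + y) = S x + S y" "\<And>c x. S (c *\<^sub>C x) = c *\<^sub>C S x" "\<And>x. norm (S x) \<le> K * norm x"
  shows "bop S"
  using assms by (auto simp: bounded_op_on_def)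

lemma bop_iff: "bop S \<longleftrightarrow> bounded_linear S \<and> (\<forall>c x. S (c *\<^sub>C x) = c *\<^sub>C S x)"
proof
  assume S: "bounded_linear S \<and> (\<forall>c x. S (c *\<^sub>C x) = c *\<^sub>C S x)"
  then obtain K where "\<And>x. norm (S x) \<le> norm x * K" using bounded_linear.bounded by blast
  then show "bop S" using S 
    by (intro bopI[where K = K]) (auto simp: linear_add bounded_linear.linear mult.commute)
qed (auto simp: bopD)

lemma bop_id [intro]: "bop (\<lambda>x. x)"
  by (simp add: bop_iff)

lemma bop_zero [intro]: "bop (\<lambda>x. 0)"
  by (simp add: bop_iff bounded_linear_zero)

lemma bop_compose [intro]: "bop S \<Longrightarrow> bop T \<Longrightarrow> bop (\<lambda>x. S (T x))"
  by (simp add: bop_iff bounded_linear_compose)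

lemma bop_add [intro]: "bop S \<Longrightarrow> bop T \<Longrightarrow> bop (\<lambda>x. S x + T x)"
  by (simp add: bop_iff bounded_linear_add scaleC_add_right)

lemma bop_scaleC [intro]: "bop S \<Longrightarrow> bop (\<lambda>x. c *\<^sub>C S x)"
  by (simp add: bop_iff bounded_linear_compose[OF bounded_linear_scaleC_right] scaleC_scaleC mult.commute)

lemma bop_diff [intro]: "bop S \<Longrightarrow> bop T \<Longrightarrow> bop (\<lambda>x. S x - T x)"
  by (simp add: bop_iff bounded_linear_sub scaleC_diff_right)

lemma bop_sum [intro]: "(\<And>i. i \<in> I \<Longrightarrow> bop (S i)) \<Longrightarrow> bop (\<lambda>x. \<Sum>i\<in>I. S i x)"
  by (induction I rule: infinite_finite_induct) auto

lemma bop_power [intro]: "bop S \<Longrightarrow> bop (S ^^ n)"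
proof (induction n)
  case 0
  have "(S ^^ 0) = (\<lambda>x. x)" by auto
  then show ?case by (simp only: bop_id)
next
  case (Suc n)
  have "(S ^^ Suc n) = (\<lambda>x. S ((S ^^ n) x))" by auto
  then show ?case using Suc by (simp only: bop_compose)
qed

abbreviation adjoint_pair :: "('a::complex_inner \<Rightarrow> 'a) \<Rightarrow> ('a \<Rightarrow> 'a) \<Rightarrow> bool" where
  "adjoint_pair S R \<equiv> is_adjoint_on UNIV S R"

lemma adjoint_pairD:
  assumes "adjoint_pair S R"
  shows "bop R" "cinner (S x) y = cinner x (R y)" "cinner (R x) y = cinner x (S y)"
proof -
  show a: "bop R" "cinner (S x) y = cinner x (R y)" for x y using assms by (auto simp: is_adjoint_on_def)
  show "cinner (R x) y = cinner x (S y)"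
    by (metis a(2) cinner_commute)
qed

text \<open>The Riesz representation of \<open>x \<mapsto> \<langle>S x, y\<rangle>\<close>: a vector orthogonal to the kernel of this functional
  represents it, up to a scalar.\<close>

theorem adjoint_exists:
  fixes S :: "'a::chilbert_space \<Rightarrow> 'a"
  assumes S: "bop S"
  obtains R where "adjoint_pair S R"
proof -
  have "\<exists>q. \<forall>x. cinner (S x) y = cinner x q" for y
  proof (cases "\<forall>u. cinner (S u) y = 0")
    case False
    then obtain u where u: "cinner (S u) y \<noteq> 0" by blast
    define M where "M = {x. cinner (S x) y = 0}"
    have "csubspace M" by (auto simp: csubspace_def M_def bopD[OF S] cinner_simps)
    moreover have "closed M" unfolding M_def
      by (intro closed_Collect_eq continuous_intros
          linear_continuous_on[OF bounded_linear_compose[OF bounded_linear_cinner_left bopD(8)[OF S]]])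
    ultimately obtain m where m: "m \<in> M" "u - m \<in> orthogonal_in UNIV M"
      using orthogonal_projection_exists by blast
    define v where "v = u - m"
    have fv: "cinner (S v) y = cinner (S u) y"
      using m(1) by (simp add: v_def M_def bopD[OF S] cinner_simps)
    have v0: "v \<noteq> 0" using fv u by (auto simp: bopD[OF S])
    define q where "q = (cnj (cinner (S v) y) / complex_of_real ((norm v)\<^sup>2)) *\<^sub>C v"
    have "cinner (S x) y = cinner x q" for x
    proof -
      define c where "c = cinner (S x) y / cinner (S v) y"
      have "x - c *\<^sub>C v \<in> M" using u fv by (simp add: M_def c_def bopD[OF S] cinner_simps)
      then have "cinner v (x - c *\<^sub>C v) = 0" using m(2) by (auto simp: v_def orthogonal_in_def)
      then have "cinner (x - c *\<^sub>C v) v = 0" by (metis cinner_commute complex_cnj_zero)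
      then have "cinner x v = c * complex_of_real ((norm v)\<^sup>2)" by (simp add: cinner_simps cinner_self)
      then show ?thesis using v0 u fv by (simp add: q_def cinner_simps c_def)
    qed
    then show ?thesis by blast
  qed (auto intro: exI[of _ 0])
  then obtain R where R: "\<And>x y. cinner (S x) y = cinner x (R y)" by metis
  have eqI: "a = b" if "\<And>x. cinner x a = cinner x b" for a b :: 'a
    using that[of "a - b"] cinner_self_eq_zero[of "a - b"] by (simp only: cinner_diff_right[of _ a b]) simp
  obtain K where K: "K > 0" "\<And>x. norm (S x) \<le> K * norm x" using bop_bound[OF S] by blast
  have "bop R"
  proof (rule bopI)
    show "R (x + y) = R x + R y" for x y by (rule eqI) (simp add: cinner_simps flip: R)
    show "R (c *\<^sub>C x) = c *\<^sub>C R x" for c x by (rule eqI) (simp add: cinner_simps flip: R)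
    show "norm (R y) \<le> K * norm y" for y
    proof (cases "R y = 0")
      case False
      have "norm (R y) * norm (R y) = cmod (cinner (S (R y)) y)"
        by (simp add: R cinner_self norm_power power2_eq_square norm_mult)
      also have "\<dots> \<le> norm (S (R y)) * norm y" by (rule norm_cinner_le)
      also have "\<dots> \<le> (K * norm (R y)) * norm y" by (intro mult_right_mono K) simp
      finally have "norm (R y) * norm (R y) \<le> norm (R y) * (K * norm y)" by (simp add: mult_ac)
      then show ?thesis using False by simp
    qed (use K in simp)
  qed
  then show ?thesis using that R by (auto simp: is_adjoint_on_def)
qed

section \<open>Fuglede's theorem\<close>

text \<open>The operator \<open>(1 + cnj s N) (1 - s N\<^sup>*)\<close> differs from 1 by a skew-adjoint operator of size \<open>|s|\<close> and a term
of order \<open>|s|\<^sup>2\<close>. A skew-adjoint perturbation changes the norm only to second order, so the \<open>n\<close>th power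
stays bounded as \<open>n\<close> grows when \<open>|s|\<^sup>2 = 1 / n\<close>.\<close>

lemma norm_adjoint_pencil_power_le:
  fixes N A :: "'a::complex_inner \<Rightarrow> 'a" and s :: complex
  assumes bN: "bop N" and adj: "\<And>x y. cinner (N x) y = cinner x (A y)"
    and K: "\<And>x. norm (N x) \<le> K * norm x" "\<And>x. norm (A x) \<le> K * norm x" "K > 0"
  defines "W \<equiv> \<lambda>x. (x - s *\<^sub>C A x) + cnj s *\<^sub>C N (x - s *\<^sub>C A x)"
  shows "norm ((W ^^ n) x) \<le> (1 + 3 * (cmod s)\<^sup>2 * K\<^sup>2) ^ n * norm x"
proof -
  have W1: "norm (W y) \<le> (1 + 3 * (cmod s)\<^sup>2 * K\<^sup>2) * norm y" for y
  proof -
    define k where "k = cnj s *\<^sub>C N y - s *\<^sub>C A y"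
    \<comment> \<open>\<open>k\<close> is the value of a skew-adjoint operator, hence orthogonal to \<open>y\<close> in the real sense\<close>
    have "cinner y (s *\<^sub>C A y) = cinner (cnj s *\<^sub>C N y) y" by (simp add: cinner_simps adj)
    then have "Re (cinner y k) = 0"
      by (simp add: k_def cinner_diff_right Re_cinner_commute[of y "cnj s *\<^sub>C N y"])
    then have "(norm (y + k))\<^sup>2 = (norm y)\<^sup>2 + (norm k)\<^sup>2" by (simp add: norm_add_sq)
    also have "norm k \<le> 2 * cmod s * K * norm y"
    proof -
      have "norm k \<le> norm (cnj s *\<^sub>C N y) + norm (s *\<^sub>C A y)"
        unfolding k_def by (rule norm_triangle_ineq4)
      also have "\<dots> \<le> cmod s * (K * norm y) + cmod s * (K * norm y)"
        unfolding norm_scaleC complex_mod_cnj by (intro add_mono mult_left_mono K) auto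
      finally show ?thesis by (simp add: algebra_simps)
    qed
    then have "(norm k)\<^sup>2 \<le> (2 * cmod s * K * norm y)\<^sup>2" by (intro power_mono) auto
    then have "(norm y)\<^sup>2 + (norm k)\<^sup>2 \<le> (norm y)\<^sup>2 + (2 * cmod s * K * norm y)\<^sup>2" by simp
    also have "\<dots> \<le> ((1 + 2 * (cmod s)\<^sup>2 * K\<^sup>2) * norm y)\<^sup>2"
    proof -
      have "((1 + 2 * (cmod s)\<^sup>2 * K\<^sup>2) * norm y)\<^sup>2 = (norm y)\<^sup>2 + (2 * cmod s * K * norm y)\<^sup>2 + (2 * (cmod s)\<^sup>2 * K\<^sup>2 * norm y)\<^sup>2"
        by (simp add: power2_eq_square algebra_simps)
      then show ?thesis by simp
    qed
    finally have yk: "norm (y + k) \<le> (1 + 2 * (cmod s)\<^sup>2 * K\<^sup>2) * norm y"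
      by (rule power2_le_imp_le) simp
    have "W y = (y + k) - (cnj s * s) *\<^sub>C N (A y)"
      by (simp add: W_def k_def bopD[OF bN] scaleC_diff_right scaleC_scaleC)
    then have "norm (W y) \<le> norm (y + k) + norm ((cnj s * s) *\<^sub>C N (A y))"
      by (metis norm_triangle_ineq4)
    also have "norm ((cnj s * s) *\<^sub>C N (A y)) \<le> (cmod s)\<^sup>2 * (K * (K * norm y))"
    proof -
      have "norm (N (A y)) \<le> K * (K * norm y)"
        using K(1)[of "A y"] mult_left_mono[OF K(2)[of y], of K] K(3) by linarith
      then show ?thesis by (simp add: norm_scaleC norm_mult power2_eq_square mult_left_mono)
    qed
    finally show ?thesis using yk by (simp add: power2_eq_square algebra_simps)
  qed
  show ?thesis
  proof (induction n)
    case (Suc n)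
    have "norm ((W ^^ Suc n) x) \<le> (1 + 3 * (cmod s)\<^sup>2 * K\<^sup>2) * norm ((W ^^ n) x)" using W1 by simp
    also have "\<dots> \<le> (1 + 3 * (cmod s)\<^sup>2 * K\<^sup>2) * ((1 + 3 * (cmod s)\<^sup>2 * K\<^sup>2) ^ n * norm x)"
      by (intro mult_left_mono Suc) simp
    finally show ?case by (simp add: mult.assoc)
  qed simp
qed

lemma pencil_power_has_derivative:
  fixes A :: "'a::complex_inner \<Rightarrow> 'a"
  assumes A: "bop A" and F: "(F has_derivative (\<lambda>h. h *\<^sub>C D)) (at s)"
  shows "\<exists>D'. ((\<lambda>s. ((\<lambda>x. x + (c * s) *\<^sub>C A x) ^^ n) (F s)) has_derivative (\<lambda>h. h *\<^sub>C D')) (at s) \<and>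
    (s = 0 \<longrightarrow> D' = D + (of_nat n * c) *\<^sub>C A (F 0))"
proof (induction n)
  case 0
  then show ?case using F by auto
next
  case (Suc n)
  let ?G = "\<lambda>s. ((\<lambda>x. x + (c * s) *\<^sub>C A x) ^^ n) (F s)"
  obtain D' where D': "(?G has_derivative (\<lambda>h. h *\<^sub>C D')) (at s)"
    "s = 0 \<Longrightarrow> D' = D + (of_nat n * c) *\<^sub>C A (F 0)" using Suc by blast
  have bb: "bounded_bilinear (\<lambda>c x :: 'a. c *\<^sub>C x)"
    by (rule bounded_bilinear.intro)
      (auto simp: scaleC_add_left scaleC_add_right scaleC_scaleC norm_scaleC scaleR_conv_of_real mult.commute
        intro!: exI[of _ 1] simp flip: scaleC_of_real)
  have AG: "((\<lambda>s. A (?G s)) has_derivative (\<lambda>h. A (h *\<^sub>C D'))) (at s)"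
    by (rule bounded_linear.has_derivative[OF bopD(8)[OF A] D'(1)])
  have cs: "((\<lambda>s. c * s) has_derivative (\<lambda>h. c * h)) (at s)"
    by (auto intro!: derivative_eq_intros)
  have "((\<lambda>s. ?G s + (c * s) *\<^sub>C A (?G s)) has_derivative
      (\<lambda>h. h *\<^sub>C D' + ((c * s) *\<^sub>C A (h *\<^sub>C D') + (c * h) *\<^sub>C A (?G s)))) (at s)"
    by (rule has_derivative_add[OF D'(1) bounded_bilinear.FDERIV[OF bb cs AG]])
  also have "(\<lambda>h. h *\<^sub>C D' + ((c * s) *\<^sub>C A (h *\<^sub>C D') + (c * h) *\<^sub>C A (?G s))) =
      (\<lambda>h. h *\<^sub>C (D' + (c * s) *\<^sub>C A D' + c *\<^sub>C A (?G s)))"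
    by (simp add: bopD[OF A] scaleC_add_right scaleC_scaleC mult_ac add.assoc)
  finally have *: "((\<lambda>s. ((\<lambda>x. x + (c * s) *\<^sub>C A x) ^^ Suc n) (F s)) has_derivative
      (\<lambda>h. h *\<^sub>C (D' + (c * s) *\<^sub>C A D' + c *\<^sub>C A (?G s)))) (at s)" by simp
  have "((\<lambda>x :: 'a. x) ^^ n) y = y" for y by (induction n) auto
  then have "D' + (c * s) *\<^sub>C A D' + c *\<^sub>C A (?G s) = D + (of_nat (Suc n) * c) *\<^sub>C A (F 0)" if "s = 0"
    using that D'(2) by (simp add: scaleC_add_left algebra_simps)
  with * show ?case by blast
qed

text \<open>The entire function \<open>\<phi> s = \<langle>(1 + s A)\<^sup>n B (1 - s A)\<^sup>n x, X\<rangle>\<close> with \<open>A = N\<^sup>*\<close> has the derivative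
\<open>n \<langle>(A B - B A) x, X\<rangle>\<close> at 0. By normality \<open>(1 + s A)\<^sup>n\<close> may be replaced by \<open>(1 + cnj s N)\<^sup>n\<close> under the norm,
and the latter can be moved past \<open>B\<close>; so \<open>\<phi>\<close> is bounded on the circle of radius \<open>1 / sqrt n\<close> independently
of \<open>n\<close>. Cauchy's inequality gives a derivative of order \<open>sqrt n\<close>, hence \<open>A B x = B A x\<close>. Compared
with the usual argument by Liouville's theorem, the exponential \<open>exp (z A)\<close> is replaced by a polynomial.\<close>

theorem fuglede:
  fixes N A B :: "'a::complex_inner \<Rightarrow> 'a"
  assumes bA: "bop A" and bN: "bop N" and bB: "bop B"
    and M: "csubspace M" "\<And>x. x \<in> M \<Longrightarrow> N x \<in> M" "\<And>x. x \<in> M \<Longrightarrow> A x \<in> M" "\<And>x. x \<in> M \<Longrightarrow> B x \<in> M"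
    and adj: "\<And>x y. cinner (N x) y = cinner x (A y)"
    and normal: "\<And>x. x \<in> M \<Longrightarrow> N (A x) = A (N x)"
    and comm: "\<And>x. x \<in> M \<Longrightarrow> N (B x) = B (N x)"
    and x: "x \<in> M"
  shows "A (B x) = B (A x)"
proof -
  have adj': "cinner (A u) v = cinner u (N v)" for u v by (metis adj cinner_commute)
  obtain KB where KB: "KB > 0" "\<And>x. norm (B x) \<le> KB * norm x" using bop_bound[OF bB] by blast
  obtain K1 where K1: "K1 > 0" "\<And>x. norm (N x) \<le> K1 * norm x" using bop_bound[OF bN] by blast
  obtain K2 where K2: "K2 > 0" "\<And>x. norm (A x) \<le> K2 * norm x" using bop_bound[OF bA] by blast
  define K where "K = max K1 K2"
  have K: "\<And>x. norm (N x) \<le> K * norm x" "\<And>x. norm (A x) \<le> K * norm x" "K > 0"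
    using K1 K2 unfolding K_def
    by (meson order_trans mult_right_mono max.cobounded1 max.cobounded2 norm_ge_zero less_le_trans)+
  define a where "a s = (\<lambda>x. x + s *\<^sub>C A x)" for s
  define b where "b s = (\<lambda>x. x + cnj s *\<^sub>C N x)" for s
  define a' where "a' s = (\<lambda>x. x + (- s) *\<^sub>C A x)" for s
  have ba: "bop (a s)" and bb: "bop (b s)" and ba': "bop (a' s)" for s
    unfolding a_def b_def a'_def by (intro bop_add bop_id bop_scaleC bA bN)+
  have inM: "a s y \<in> M" "b s y \<in> M" "a' s y \<in> M" if "y \<in> M" for s y
    using that M by (auto simp: a_def b_def a'_def intro!: csubspaceD)
  have powM: "(a s ^^ n) y \<in> M" "(b s ^^ n) y \<in> M" "(a' s ^^ n) y \<in> M" if "y \<in> M" for s y n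
    by (induction n) (auto simp: that inM)
  have ab: "a s (b s y) = b s (a s y)" "a' s (b s y) = b s (a' s y)" if "y \<in> M" for s y
    using that normal[OF that]
    by (simp_all add: a_def b_def a'_def bopD[OF bA] bopD[OF bN] scaleC_add_right scaleC_scaleC algebra_simps)
  have bB': "b s (B y) = B (b s y)" if "y \<in> M" for s y
    using comm[OF that] by (simp add: b_def bopD[OF bB])
  \<comment> \<open>\<open>b s\<close> is the adjoint of \<open>a s\<close>, and they commute on \<open>M\<close>.\<close>
  have ab_norm: "norm ((a s ^^ n) y) = norm ((b s ^^ n) y)" if "y \<in> M" for s n y
  proof -
    have step: "cinner (a s u) v = cinner u (b s v)" "cinner (b s u) v = cinner u (a s v)" for u v
      by (simp_all add: a_def b_def cinner_simps adj adj')
    have "cinner ((a s ^^ n) u) v = cinner u ((b s ^^ n) v)" for u v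
      by (induction n arbitrary: u) (simp_all add: step funpow_swap1)
    moreover have "cinner ((b s ^^ n) u) v = cinner u ((a s ^^ n) v)" for u v
      by (induction n arbitrary: u) (simp_all add: step funpow_swap1)
    moreover have "(b s ^^ n) ((a s ^^ m) y) = (a s ^^ m) ((b s ^^ n) y)" for m
    proof -
      have *: "b s ((a s ^^ m) u) = (a s ^^ m) (b s u)" if "u \<in> M" for u
        by (induction m) (simp_all add: powM inM that flip: ab(1))
      show ?thesis by (induction n) (simp_all add: * powM that)
    qed
    ultimately have "cinner ((a s ^^ n) y) ((a s ^^ n) y) = cinner ((b s ^^ n) y) ((b s ^^ n) y)"
      by metis
    then show ?thesis by (simp add: cinner_self power2_eq_iff_nonneg flip: of_real_power)
  qed
  \<comment> \<open>Replacing \<open>a s\<close> by \<open>b s\<close>, which commutes with \<open>B\<close>, brings the two powers together.\<close>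
  have bound: "norm ((a s ^^ n) (B ((a' s ^^ n) x))) \<le> KB * ((1 + 3 * (cmod s)\<^sup>2 * K\<^sup>2) ^ n * norm x)" for s n
  proof -
    have bnB: "(b s ^^ n) (B y) = B ((b s ^^ n) y)" if "y \<in> M" for y n
      by (induction n) (simp_all add: bB' powM that)
    define W where "W = (\<lambda>x. (x - s *\<^sub>C A x) + cnj s *\<^sub>C N (x - s *\<^sub>C A x))"
    have W: "W y = b s (a' s y)" for y by (simp add: W_def b_def a'_def scaleC_minus_left)
    have sw: "(a' s ^^ m) (b s y) = b s ((a' s ^^ m) y)" if "y \<in> M" for m y
      by (induction m) (simp_all add: ab powM that)
    have Wn: "(b s ^^ n) ((a' s ^^ n) x) = (W ^^ n) x"
    proof (induction n)
      case (Suc n)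
      have 1: "(b s ^^ n) (a' s y) = a' s ((b s ^^ n) y)" if "y \<in> M" for y
        by (induction n) (simp_all add: ab powM that)
      have "(b s ^^ Suc n) ((a' s ^^ Suc n) x) = b s ((b s ^^ n) (a' s ((a' s ^^ n) x)))" by simp
      also have "\<dots> = W ((b s ^^ n) ((a' s ^^ n) x))" by (simp add: 1 powM x W)
      finally show ?case using Suc by simp
    qed simp
    have "norm ((a s ^^ n) (B ((a' s ^^ n) x))) = norm (B ((b s ^^ n) ((a' s ^^ n) x)))"
      using ab_norm bnB M(4) powM(3) x by metis
    also have "\<dots> \<le> KB * norm ((W ^^ n) x)" unfolding Wn by (rule KB)
    also have "\<dots> \<le> KB * ((1 + 3 * (cmod s)\<^sup>2 * K\<^sup>2) ^ n * norm x)"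
      unfolding W_def using KB(1)
      by (intro mult_left_mono norm_adjoint_pencil_power_le[OF bN adj K]) auto
    finally show ?thesis .
  qed
  define X where "X = A (B x) - B (A x)"
  define C where "C = KB * (exp (3 * K\<^sup>2) * norm x) * norm X"
  have est: "(norm X)\<^sup>2 \<le> C / sqrt (real n)" if n: "n > 0" for n
  proof -
    define \<phi> where "\<phi> s = cinner ((a s ^^ n) (B ((a' s ^^ n) x))) X" for s
    have deriv: "\<exists>d. (\<phi> has_field_derivative d) (at s) \<and> (s = 0 \<longrightarrow> d = of_nat n * cinner X X)" for s
    proof -
      have "((\<lambda>_. x) has_derivative (\<lambda>h. h *\<^sub>C 0)) (at s)" by simp
      from pencil_power_has_derivative[OF bA this, where c = "-1" and n = n]
      obtain D1 where D1: "((\<lambda>s. (a' s ^^ n) x) has_derivative (\<lambda>h. h *\<^sub>C D1)) (at s)"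
        "s = 0 \<Longrightarrow> D1 = - of_nat n *\<^sub>C A x" by (auto simp: a'_def)
      have "((\<lambda>s. B ((a' s ^^ n) x)) has_derivative (\<lambda>h. B (h *\<^sub>C D1))) (at s)"
        by (rule bounded_linear.has_derivative[OF bopD(8)[OF bB] D1(1)])
      then have "((\<lambda>s. B ((a' s ^^ n) x)) has_derivative (\<lambda>h. h *\<^sub>C B D1)) (at s)" by (simp add: bopD[OF bB])
      from pencil_power_has_derivative[OF bA this, where c = 1 and n = n]
      obtain D2 where D2: "((\<lambda>s. (a s ^^ n) (B ((a' s ^^ n) x))) has_derivative (\<lambda>h. h *\<^sub>C D2)) (at s)"
        "s = 0 \<Longrightarrow> D2 = B D1 + of_nat n *\<^sub>C A (B ((a' 0 ^^ n) x))" by (auto simp: a_def)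
      have "(\<phi> has_derivative (\<lambda>h. cinner (h *\<^sub>C D2) X)) (at s)" unfolding \<phi>_def
        by (rule bounded_linear.has_derivative[OF bounded_linear_cinner_left D2(1)])
      then have "(\<phi> has_field_derivative cinner D2 X) (at s)"
        by (simp add: has_field_derivative_def cinner_scaleC_left mult_commute_abs)
      moreover have "(a' 0 ^^ n) x = x" by (induction n) (auto simp: a'_def)
      then have "D2 = of_nat n *\<^sub>C X" if "s = 0"
        using D2(2) D1(2) that
        by (simp add: bopD[OF bB] X_def scaleC_diff_right scaleC_minus_left)
      then have "s = 0 \<Longrightarrow> cinner D2 X = of_nat n * cinner X X" by (simp only: cinner_scaleC_left)
      ultimately show ?thesis by blast
    qed
    have hol: "\<phi> holomorphic_on S" for S
      unfolding holomorphic_on_def field_differentiable_def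
      using deriv has_field_derivative_at_within by blast
    \<comment> \<open>This radius keeps the bound on \<open>\<phi>\<close> independent of \<open>n\<close>, while \<open>r * n\<close> tends to infinity.\<close>
    define r where "r = 1 / sqrt (real n)"
    have r: "r > 0" "r\<^sup>2 = 1 / real n" using n by (auto simp: r_def power_divide)
    have "norm ((deriv ^^ 1) \<phi> 0) \<le> fact 1 * C / r ^ 1"
    proof (rule Cauchy_inequality)
      show "\<phi> holomorphic_on ball 0 r" by (rule hol)
      show "continuous_on (cball 0 r) \<phi>" by (rule holomorphic_on_imp_continuous_on[OF hol])
      show "r > 0" by fact
      fix s :: complex assume "norm (0 - s) = r"
      then have "(cmod s)\<^sup>2 = 1 / real n" using r by simp
      then have "(1 + 3 * (cmod s)\<^sup>2 * K\<^sup>2) ^ n = (1 + (3 * K\<^sup>2) / real n) ^ n" by simp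
      also have "\<dots> \<le> exp (3 * K\<^sup>2)"
        by (rule exp_ge_one_plus_x_over_n_power_n) (use n in \<open>auto intro: order_trans[of _ 0]\<close>)
      finally have "(1 + 3 * (cmod s)\<^sup>2 * K\<^sup>2) ^ n * norm x \<le> exp (3 * K\<^sup>2) * norm x" by (rule mult_right_mono) simp
      then have "norm ((a s ^^ n) (B ((a' s ^^ n) x))) \<le> KB * (exp (3 * K\<^sup>2) * norm x)"
        using bound[where s=s and n=n] KB(1) by (meson mult_left_mono less_imp_le order_trans)
      then have "norm ((a s ^^ n) (B ((a' s ^^ n) x))) * norm X \<le> C"
        unfolding C_def by (rule mult_right_mono) simp
      then show "norm (\<phi> s) \<le> C" unfolding \<phi>_def using norm_cinner_le order_trans by blast
    qed
    moreover have "deriv \<phi> 0 = of_nat n * cinner X X" using deriv[of 0] DERIV_imp_deriv by blast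
    ultimately have "real n * (norm X)\<^sup>2 \<le> C * sqrt (real n)"
      by (simp add: cinner_self norm_mult norm_power r_def)
    then have "sqrt (real n) * (sqrt (real n) * (norm X)\<^sup>2) \<le> sqrt (real n) * C"
      by (simp add: mult_ac flip: mult.assoc)
    then show ?thesis using n by (simp add: field_simps)
  qed
  have "(\<lambda>n. C / sqrt (real n)) \<longlonglongrightarrow> 0"
    by (rule real_tendsto_divide_at_top[OF tendsto_const
          filterlim_compose[OF sqrt_at_top filterlim_real_sequentially]])
  moreover have "\<forall>\<^sub>F n in sequentially. (norm X)\<^sup>2 \<le> C / sqrt (real n)"
    using eventually_gt_at_top[of 0] by eventually_elim (rule est)
  ultimately have "(norm X)\<^sup>2 \<le> 0" by (rule tendsto_lowerbound) simp
  then show ?thesis by (simp add: X_def)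
qed

section \<open>Joint approximate eigenvectors\<close>

text \<open>One vector has to serve all operators in \<open>SS\<close> at once. In place of a joint spectral measure of commuting
normal operators, joint approximate eigenvectors are built by enlarging \<open>SS\<close> one operator at a time.\<close>

definition joint_approx_kernel :: "'a::complex_inner set \<Rightarrow> ('a \<Rightarrow> 'a) set \<Rightarrow> bool" where
  "joint_approx_kernel M SS \<longleftrightarrow> (\<forall>d>0. \<exists>y\<in>M. y \<noteq> 0 \<and> (\<forall>S\<in>SS. norm (S y) \<le> d * norm y))"

definition self_adjoint_on :: "'a::complex_inner set \<Rightarrow> ('a \<Rightarrow> 'a) \<Rightarrow> bool" where
  "self_adjoint_on M C \<longleftrightarrow> C ` M \<subseteq> M \<and> (\<forall>x\<in>M. \<forall>y\<in>M. cinner (C x) y = cinner x (C y))"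

text \<open>Power iteration with an a priori bound \<open>K\<close> on the number of steps that is the same for all starting
vectors. The eigenvalue is at least the initial ratio \<open>norm (D y) / norm y\<close>, since the ratios increase.\<close>

lemma power_method:
  fixes D :: "'a::complex_inner \<Rightarrow> 'a"
  assumes M: "csubspace M" and D: "bop D" "self_adjoint_on M D"
    and low: "\<And>x. x \<in> M \<Longrightarrow> (norm x)\<^sup>2 \<le> Re (cinner (D x) x)"
    and R: "\<And>x. norm (D x) \<le> R * norm x" and e: "e > 0"
  obtains K where "\<And>y. \<lbrakk>y \<in> M; y \<noteq> 0\<rbrakk> \<Longrightarrow> \<exists>k\<le>K. \<exists>\<rho>. (D ^^ k) y \<in> M \<and> (D ^^ k) y \<noteq> 0 \<and>
    norm (D y) / norm y \<le> \<rho> \<and> \<rho> \<le> R \<and> norm (D ((D ^^ k) y) - \<rho> *\<^sub>R (D ^^ k) y) \<le> e * norm ((D ^^ k) y)"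
proof -
  have DM: "D x \<in> M" if "x \<in> M" for x using D(2) that by (auto simp: self_adjoint_on_def)
  have sa: "cinner (D x) y = cinner x (D y)" if "x \<in> M" "y \<in> M" for x y
    using D(2) that by (auto simp: self_adjoint_on_def)
  have expand: "norm x \<le> norm (D x)" if "x \<in> M" for x
  proof (cases "x = 0")
    case False
    have "norm x * norm x \<le> norm (D x) * norm x"
      using low[OF that] complex_Re_le_cmod[of "cinner (D x) x"] norm_cinner_le[of "D x" x]
      by (simp add: power2_eq_square)
    then show ?thesis using False by simp
  qed simp
  \<comment> \<open>The ratios \<open>r k\<close> of consecutive norms below increase and stay between 1 and \<open>R\<close>, so their
    squares cannot grow by the factor \<open>1 + \<epsilon>\<close> in each of the first \<open>K\<close> steps.\<close>
  define \<epsilon> where "\<epsilon> = e\<^sup>2 / ((\<bar>R\<bar> + 1) ^ 4)"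
  have \<epsilon>: "\<epsilon> > 0" using e by (simp add: \<epsilon>_def)
  obtain K where K: "(1 + \<epsilon>) ^ K > (\<bar>R\<bar> + 1)\<^sup>2" using real_arch_pow[of "1 + \<epsilon>"] \<epsilon> by auto
  show ?thesis
  proof (rule that[of K])
    fix y assume y: "y \<in> M" "y \<noteq> 0"
    define z where "z k = (D ^^ k) y" for k
    have zM: "z k \<in> M" for k by (induction k) (auto simp: z_def y DM)
    have zS: "z (Suc k) = D (z k)" for k by (simp add: z_def)
    have z0: "norm (z k) > 0" for k
    proof (induction k)
      case (Suc k)
      then show ?case using expand[OF zM[of k]] zS by (simp only:)
    qed (use y in \<open>simp add: z_def\<close>)
    define r where "r k = norm (z (Suc k)) / norm (z k)" for k
    have rpos: "r k \<ge> 1" for k using expand[OF zM[of k]] z0[of k] by (simp add: r_def zS)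
    have rR: "r k \<le> R" for k using R[of "z k"] z0[of k] by (simp add: r_def zS divide_le_eq)
    \<comment> \<open>\<open>k \<mapsto> norm (D\<^sup>k y)\<close> is logarithmically convex\<close>
    have rmono: "r k \<le> r (Suc k)" for k
    proof -
      have "(norm (z (Suc k)))\<^sup>2 = Re (cinner (z k) (z (Suc (Suc k))))"
        using sa[OF zM[of k] zM[of "Suc k"]] by (simp add: norm_sq_eq_Re_cinner zS)
      also have "\<dots> \<le> norm (z k) * norm (z (Suc (Suc k)))"
        using complex_Re_le_cmod norm_cinner_le order_trans by blast
      finally show ?thesis using z0[of k] z0[of "Suc k"]
        by (simp add: r_def field_simps power2_eq_square)
    qed
    have "\<exists>k<K. (r (Suc k))\<^sup>2 \<le> (1 + \<epsilon>) * (r k)\<^sup>2"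
    proof (rule ccontr)
      assume neg: "\<not> ?thesis"
      have "(1 + \<epsilon>) ^ k \<le> (r k)\<^sup>2" if "k \<le> K" for k using that
      proof (induction k)
        case 0
        then show ?case using rpos[of 0] by (simp add: one_le_power)
      next
        case (Suc k)
        then have "(1 + \<epsilon>) * (1 + \<epsilon>) ^ k \<le> (1 + \<epsilon>) * (r k)\<^sup>2" using \<epsilon> by (intro mult_left_mono) auto
        also have "\<dots> \<le> (r (Suc k))\<^sup>2" using neg Suc.prems by (simp add: not_le less_imp_le)
        finally show ?case by simp
      qed
      then have "(1 + \<epsilon>) ^ K \<le> (r K)\<^sup>2" by simp
      also have "\<dots> \<le> (\<bar>R\<bar> + 1)\<^sup>2" using rR[of K] rpos[of K] by (intro power_mono) auto
      finally show False using K by simp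
    qed
    then obtain k where k: "k < K" "(r (Suc k))\<^sup>2 \<le> (1 + \<epsilon>) * (r k)\<^sup>2" by blast
    define w where "w = D (z k) - r k *\<^sub>R z k"
    have wM: "w \<in> M" unfolding w_def by (intro csubspaceD[OF M] DM zM)
    have n1: "norm (z (Suc k)) = r k * norm (z k)" using z0[of k] by (simp add: r_def)
    have n2: "norm (z (Suc (Suc k))) = r (Suc k) * (r k * norm (z k))"
      using z0[of "Suc k"] unfolding n1[symmetric] by (simp add: r_def[of "Suc k"])
    \<comment> \<open>\<open>D\<^sup>2 - r\<^sup>2 = (D + r) (D - r)\<close>, and \<open>D + r \<ge> 1\<close>\<close>
    have fac: "D w + r k *\<^sub>R w = z (Suc (Suc k)) - (r k)\<^sup>2 *\<^sub>R z k"
      by (simp add: w_def zS bopD[OF D(1)] scaleR_right_diff_distrib power2_eq_square)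
    have "norm w \<le> norm (D w + r k *\<^sub>R w)"
    proof (cases "w = 0")
      case False
      have "norm w * norm w \<le> Re (cinner (D w) w) + r k * (norm w)\<^sup>2"
        using low[OF wM] rpos[of k] by (simp add: power2_eq_square add_increasing2)
      also have "\<dots> = Re (cinner (D w + r k *\<^sub>R w) w)"
        by (simp add: cinner_add_left cinner_scaleC_left cinner_self flip: scaleC_of_real)
      also have "\<dots> \<le> norm (D w + r k *\<^sub>R w) * norm w"
        using complex_Re_le_cmod norm_cinner_le order_trans by blast
      finally show ?thesis using False by simp
    qed simp
    then have "(norm w)\<^sup>2 \<le> (norm (z (Suc (Suc k)) - (r k)\<^sup>2 *\<^sub>R z k))\<^sup>2"
      unfolding fac by (intro power_mono) auto
    also have "\<dots> = (norm (z (Suc (Suc k))))\<^sup>2 - 2 * ((r k)\<^sup>2 * (norm (z (Suc k)))\<^sup>2) + ((r k)\<^sup>2)\<^sup>2 * (norm (z k))\<^sup>2"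
    proof -
      have "Re (cinner (z (Suc (Suc k))) ((r k)\<^sup>2 *\<^sub>R z k)) = (r k)\<^sup>2 * Re (cinner (z (Suc (Suc k))) (z k))"
        by (simp add: cinner_scaleC_right flip: scaleC_of_real)
      also have "cinner (z (Suc (Suc k))) (z k) = cinner (z (Suc k)) (z (Suc k))"
        using sa[OF zM[of "Suc k"] zM[of k]] by (simp add: zS)
      finally show ?thesis
        by (simp add: norm_diff_sq norm_sq_eq_Re_cinner[of "z (Suc k)"] power_mult_distrib)
    qed
    also have "\<dots> = ((r (Suc k))\<^sup>2 - (r k)\<^sup>2) * (r k)\<^sup>2 * (norm (z k))\<^sup>2"
      unfolding n1 n2 by (simp add: power_mult_distrib algebra_simps power2_eq_square)
    also have "\<dots> \<le> (\<epsilon> * (r k)\<^sup>2) * (r k)\<^sup>2 * (norm (z k))\<^sup>2"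
      using k(2) by (intro mult_right_mono) (auto simp: algebra_simps)
    also have "\<dots> = \<epsilon> * (r k) ^ 4 * (norm (z k))\<^sup>2" by (simp add: power2_eq_square power4_eq_xxxx)
    also have "\<dots> \<le> \<epsilon> * (\<bar>R\<bar> + 1) ^ 4 * (norm (z k))\<^sup>2"
      using \<epsilon> rR[of k] rpos[of k] by (intro mult_right_mono mult_left_mono power_mono) auto
    also have "\<dots> = (e * norm (z k))\<^sup>2" by (simp add: \<epsilon>_def power_mult_distrib add_pos_nonneg)
    finally have "norm w \<le> e * norm (z k)" by (rule power2_le_imp_le) (use e in simp)
    moreover have "r 0 \<le> r k" using rmono by (rule lift_Suc_mono_le) simp
    ultimately show "\<exists>k\<le>K. \<exists>\<rho>. (D ^^ k) y \<in> M \<and> (D ^^ k) y \<noteq> 0 \<and>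
        norm (D y) / norm y \<le> \<rho> \<and> \<rho> \<le> R \<and> norm (D ((D ^^ k) y) - \<rho> *\<^sub>R (D ^^ k) y) \<le> e * norm ((D ^^ k) y)"
      using k(1) zM[of k] z0[of k] rR[of k]
      by (intro exI[of _ k] conjI exI[of _ "r k"]) (auto simp: w_def z_def r_def)
  qed
qed

text \<open>Approximate eigenvalues \<open>\<beta>\<close> that depend on the precision \<open>d\<close> have a limit point, which serves for all \<open>d\<close>.\<close>

lemma joint_approx_kernel_insertI:
  fixes C :: "'a::complex_inner \<Rightarrow> 'a"
  assumes approx: "\<And>d. d > 0 \<Longrightarrow> \<exists>\<beta>\<in>{l..u}. \<exists>y\<in>M. y \<noteq> 0 \<and> (\<forall>S\<in>SS. norm (S y) \<le> d * norm y) \<and>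
     norm (C y - \<beta> *\<^sub>R y) \<le> d * norm y"
  shows "\<exists>\<beta>\<in>{l..u}. joint_approx_kernel M (insert (\<lambda>x. C x - \<beta> *\<^sub>R x) SS)"
proof -
  have "\<exists>\<beta>\<in>{l..u}. \<exists>y\<in>M. y \<noteq> 0 \<and> (\<forall>S\<in>SS. norm (S y) \<le> inverse (real (Suc n)) * norm y) \<and>
     norm (C y - \<beta> *\<^sub>R y) \<le> inverse (real (Suc n)) * norm y" for n
    by (rule approx) simp
  then obtain \<beta> y where yb: "\<And>n. \<beta> n \<in> {l..u}" "\<And>n. y n \<in> M" "\<And>n. y n \<noteq> 0"
    "\<And>n S. S \<in> SS \<Longrightarrow> norm (S (y n)) \<le> inverse (real (Suc n)) * norm (y n)"
    "\<And>n. norm (C (y n) - \<beta> n *\<^sub>R y n) \<le> inverse (real (Suc n)) * norm (y n)" by metis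
  obtain b f where bf: "b \<in> {l..u}" "strict_mono (f :: nat \<Rightarrow> nat)" "(\<beta> \<circ> f) \<longlonglongrightarrow> b"
    using compact_Icc[of l u] yb(1) unfolding compact_def by blast
  have "joint_approx_kernel M (insert (\<lambda>x. C x - b *\<^sub>R x) SS)"
    unfolding joint_approx_kernel_def
  proof (intro allI impI)
    fix d :: real assume d: "d > 0"
    have "(\<lambda>n. inverse (real (Suc (f n)))) \<longlonglongrightarrow> 0"
      using LIMSEQ_subseq_LIMSEQ[OF LIMSEQ_inverse_real_of_nat bf(2)] by (simp add: o_def)
    then have "\<forall>\<^sub>F n in sequentially. inverse (real (Suc (f n))) < d / 2"
      using d by (intro order_tendstoD) auto
    moreover have "\<forall>\<^sub>F n in sequentially. dist ((\<beta> \<circ> f) n) b < d / 2"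
      by (rule tendstoD[OF bf(3)]) (use d in simp)
    ultimately have "\<forall>\<^sub>F n in sequentially. inverse (real (Suc (f n))) < d / 2 \<and> dist ((\<beta> \<circ> f) n) b < d / 2"
      by eventually_elim auto
    then obtain n where n: "inverse (real (Suc (f n))) < d / 2" "\<bar>\<beta> (f n) - b\<bar> < d / 2"
      using eventually_happens'[OF sequentially_bot] by (auto simp: dist_real_def)
    let ?y = "y (f n)"
    have "norm (S ?y) \<le> d * norm ?y" if "S \<in> SS" for S
    proof -
      have "norm (S ?y) \<le> inverse (real (Suc (f n))) * norm ?y" by (rule yb(4)[OF that])
      also have "\<dots> \<le> d * norm ?y" using n(1) d by (intro mult_right_mono) auto
      finally show ?thesis .
    qed
    moreover have "norm (C ?y - b *\<^sub>R ?y) \<le> d * norm ?y"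
    proof -
      have "C ?y - b *\<^sub>R ?y = (C ?y - \<beta> (f n) *\<^sub>R ?y) + (\<beta> (f n) - b) *\<^sub>R ?y"
        by (simp add: scaleR_left_diff_distrib)
      then have "norm (C ?y - b *\<^sub>R ?y) \<le> norm (C ?y - \<beta> (f n) *\<^sub>R ?y) + norm ((\<beta> (f n) - b) *\<^sub>R ?y)"
        by (metis norm_triangle_ineq)
      also have "\<dots> \<le> d / 2 * norm ?y + d / 2 * norm ?y"
      proof (rule add_mono)
        show "norm (C ?y - \<beta> (f n) *\<^sub>R ?y) \<le> d / 2 * norm ?y"
          using yb(5)[of "f n"] mult_right_mono[OF less_imp_le[OF n(1)], of "norm ?y"] by simp
        show "norm ((\<beta> (f n) - b) *\<^sub>R ?y) \<le> d / 2 * norm ?y"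
          unfolding norm_scaleR using n(2) by (intro mult_right_mono) auto
      qed
      finally show ?thesis by simp
    qed
    ultimately show "\<exists>y\<in>M. y \<noteq> 0 \<and> (\<forall>S\<in>insert (\<lambda>x. C x - b *\<^sub>R x) SS. norm (S y) \<le> d * norm y)"
      using yb(2,3) by blast
  qed
  then show ?thesis using bf(1) by blast
qed

lemma self_adjoint_on_shift:
  assumes "csubspace M" "self_adjoint_on M C"
  shows "self_adjoint_on M (\<lambda>x. C x + c *\<^sub>R x)"
  using assms unfolding self_adjoint_on_def
  by (auto simp: cinner_simps csubspaceD simp flip: scaleC_of_real intro!: csubspaceD(2))

text \<open>The vectors produced by the power method are \<open>D\<^sup>k y\<close>, where \<open>D\<close> commutes with the operators in \<open>SS\<close>, so
an approximate kernel vector \<open>y\<close> of \<open>SS\<close> stays one.\<close>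

lemma joint_approx_kernel_insert_self_adjoint:
  fixes C :: "'a::complex_inner \<Rightarrow> 'a"
  assumes M: "csubspace M" and C: "bop C" "self_adjoint_on M C"
    and approx: "joint_approx_kernel M SS"
    and SS: "\<And>S. S \<in> SS \<Longrightarrow> bop S" "\<And>S x. S \<in> SS \<Longrightarrow> x \<in> M \<Longrightarrow> S (C x) = C (S x)"
       "\<And>S x. S \<in> SS \<Longrightarrow> x \<in> M \<Longrightarrow> S x \<in> M"
  shows "\<exists>\<beta>. joint_approx_kernel M (insert (\<lambda>x. C x - \<beta> *\<^sub>R x) SS)"
proof -
  obtain R where R: "R > 0" "\<And>x. norm (C x) \<le> R * norm x" using bop_bound[OF C(1)] by blast
  \<comment> \<open>The shift makes the operator at least 1.\<close>
  define D where "D = (\<lambda>x. C x + (R + 1) *\<^sub>R x)"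
  have bD: "bop D" using bop_add[OF C(1) bop_scaleC[OF bop_id, of "of_real (R + 1)"]]
    by (simp only: D_def scaleC_of_real)
  have saD: "self_adjoint_on M D" unfolding D_def by (rule self_adjoint_on_shift[OF M C(2)])
  have low: "(norm x)\<^sup>2 \<le> Re (cinner (D x) x)" for x
  proof -
    have "\<bar>Re (cinner (C x) x)\<bar> \<le> R * norm x * norm x"
      using abs_Re_le_cmod[of "cinner (C x) x"] norm_cinner_le[of "C x" x]
        mult_right_mono[OF R(2)[of x], of "norm x"] by simp
    moreover have "Re (cinner (D x) x) = Re (cinner (C x) x) + (R + 1) * (norm x)\<^sup>2"
      by (simp add: D_def cinner_add_left cinner_scaleC_left cinner_self flip: scaleC_of_real)
    ultimately show ?thesis by (simp add: power2_eq_square algebra_simps abs_le_iff)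
  qed
  have up: "norm (D x) \<le> (2 * R + 1) * norm x" for x
  proof -
    have "norm (D x) \<le> norm (C x) + norm ((R + 1) *\<^sub>R x)" unfolding D_def by (rule norm_triangle_ineq)
    moreover have "norm ((R + 1) *\<^sub>R x) = R * norm x + norm x"
      using R(1) by (simp add: distrib_right del: scaleR_left_distrib)
    ultimately show ?thesis using R(2)[of x] by (simp add: algebra_simps)
  qed
  have "\<exists>\<beta>\<in>{- R - 1..R}. joint_approx_kernel M (insert (\<lambda>x. C x - \<beta> *\<^sub>R x) SS)"
  proof (rule joint_approx_kernel_insertI)
    fix d :: real assume d: "d > 0"
    obtain K where K: "\<And>y. \<lbrakk>y \<in> M; y \<noteq> 0\<rbrakk> \<Longrightarrow> \<exists>k\<le>K. \<exists>\<rho>. (D ^^ k) y \<in> M \<and> (D ^^ k) y \<noteq> 0 \<and>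
      norm (D y) / norm y \<le> \<rho> \<and> \<rho> \<le> 2 * R + 1 \<and> norm (D ((D ^^ k) y) - \<rho> *\<^sub>R (D ^^ k) y) \<le> d * norm ((D ^^ k) y)"
      using power_method[OF M bD saD low up d] by metis
    \<comment> \<open>At most \<open>K\<close> steps are needed, whatever the starting vector is: it can be taken so deep in the
      approximate kernel of \<open>SS\<close> that these steps cannot spoil it.\<close>
    define d' where "d' = d / (2 * R + 1) ^ K"
    have "d' > 0" using d R(1) by (simp add: d'_def)
    then obtain y where y: "y \<in> M" "y \<noteq> 0" "\<And>S. S \<in> SS \<Longrightarrow> norm (S y) \<le> d' * norm y"
      using approx unfolding joint_approx_kernel_def by blast
    obtain k \<rho> where k: "k \<le> K" "(D ^^ k) y \<in> M" "(D ^^ k) y \<noteq> 0" "norm (D y) / norm y \<le> \<rho>" "\<rho> \<le> 2 * R + 1"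
      "norm (D ((D ^^ k) y) - \<rho> *\<^sub>R (D ^^ k) y) \<le> d * norm ((D ^^ k) y)"
      using K[OF y(1,2)] by blast
    have DM: "(D ^^ j) x \<in> M" if "x \<in> M" for x j
      by (induction j) (use saD that in \<open>auto simp: self_adjoint_on_def\<close>)
    have grow: "norm y \<le> norm ((D ^^ j) y)" for j
    proof (induction j)
      case (Suc j)
      let ?x = "(D ^^ j) y"
      have "norm ?x \<le> norm (D ?x)"
      proof (cases "?x = 0")
        case False
        have "norm ?x * norm ?x \<le> norm (D ?x) * norm ?x"
          using low[of ?x] complex_Re_le_cmod[of "cinner (D ?x) ?x"] norm_cinner_le[of "D ?x" ?x]
          by (simp add: power2_eq_square)
        then show ?thesis using False by simp
      qed simp
      then show ?case using Suc by simp
    qed simp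
    have "norm (S ((D ^^ k) y)) \<le> d * norm ((D ^^ k) y)" if S: "S \<in> SS" for S
    proof -
      have SD: "S (D x) = D (S x)" if "x \<in> M" for x
        using SS(2)[OF S that] by (simp add: D_def bopD[OF SS(1)[OF S]])
      have "S ((D ^^ j) y) = (D ^^ j) (S y)" for j
        by (induction j) (simp_all add: SD DM y(1))
      moreover have "norm ((D ^^ j) x) \<le> (2 * R + 1) ^ j * norm x" for j x
      proof (induction j)
        case (Suc j)
        have "norm ((D ^^ Suc j) x) \<le> (2 * R + 1) * norm ((D ^^ j) x)" using up by simp
        also have "\<dots> \<le> (2 * R + 1) * ((2 * R + 1) ^ j * norm x)" using Suc R(1) by (intro mult_left_mono) auto
        finally show ?case by simp
      qed simp
      ultimately have "norm (S ((D ^^ k) y)) \<le> (2 * R + 1) ^ k * norm (S y)" by simp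
      also have "\<dots> \<le> (2 * R + 1) ^ K * (d' * norm y)"
        using R(1) k(1) y(3)[OF S] by (intro mult_mono power_increasing) auto
      also have "\<dots> = d * norm y" using R(1) by (simp add: d'_def)
      also have "\<dots> \<le> d * norm ((D ^^ k) y)" using grow d by (intro mult_left_mono) auto
      finally show ?thesis .
    qed
    moreover have "norm (C ((D ^^ k) y) - (\<rho> - (R + 1)) *\<^sub>R (D ^^ k) y) \<le> d * norm ((D ^^ k) y)"
      using k(6) by (simp add: D_def scaleR_left_diff_distrib scaleR_left_distrib algebra_simps)
    moreover have "0 \<le> \<rho>" using k(4) by (meson divide_nonneg_nonneg norm_ge_zero order_trans)
    ultimately show "\<exists>\<beta>\<in>{- R - 1..R}. \<exists>y\<in>M. y \<noteq> 0 \<and> (\<forall>S\<in>SS. norm (S y) \<le> d * norm y) \<and> norm (C y - \<beta> *\<^sub>R y) \<le> d * norm y"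
      using k by (intro bexI[of _ "\<rho> - (R + 1)"] bexI[of _ "(D ^^ k) y"]) auto
  qed
  then show ?thesis by blast
qed

lemma joint_approx_kernel_self_adjoint_below:
  fixes N :: "'a::complex_inner \<Rightarrow> 'a"
  assumes M: "csubspace M" and N: "bop N" "self_adjoint_on M N" and y: "y \<in> M" "y \<noteq> 0"
    and small: "Re (cinner (N y) y) \<le> c * (norm y)\<^sup>2"
  shows "\<exists>\<nu>\<le>c. joint_approx_kernel M {\<lambda>x. N x - \<nu> *\<^sub>R x}"
proof -
  obtain R where R: "R > 0" "\<And>x. norm (N x) \<le> R * norm x" using bop_bound[OF N(1)] by blast
  \<comment> \<open>The power method finds large eigenvalues, so it is applied to \<open>R + 1 - N\<close>.\<close>
  define D where "D = (\<lambda>x. - N x + (R + 1) *\<^sub>R x)"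
  have bN': "bop (\<lambda>x. - N x)" using bop_scaleC[OF N(1), of "-1"] by (simp add: scaleC_minus_one)
  have bD: "bop D" using bop_add[OF bN' bop_scaleC[OF bop_id, of "of_real (R + 1)"]]
    by (simp only: D_def scaleC_of_real)
  have "self_adjoint_on M (\<lambda>x. - N x)"
    using N(2) M by (auto simp: self_adjoint_on_def cinner_simps image_subset_iff csubspaceD)
  then have saD: "self_adjoint_on M D" unfolding D_def by (rule self_adjoint_on_shift[OF M])
  have form: "Re (cinner (D x) x) = (R + 1) * (norm x)\<^sup>2 - Re (cinner (N x) x)" for x
    by (simp add: D_def cinner_simps cinner_self flip: scaleC_of_real)
  have low: "(norm x)\<^sup>2 \<le> Re (cinner (D x) x)" for x
  proof -
    have "\<bar>Re (cinner (N x) x)\<bar> \<le> R * norm x * norm x"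
      using abs_Re_le_cmod[of "cinner (N x) x"] norm_cinner_le[of "N x" x]
        mult_right_mono[OF R(2)[of x], of "norm x"] by simp
    then show ?thesis unfolding form by (simp add: power2_eq_square algebra_simps abs_le_iff)
  qed
  have up: "norm (D x) \<le> (2 * R + 1) * norm x" for x
  proof -
    have "norm (D x) \<le> norm (- N x) + norm ((R + 1) *\<^sub>R x)" unfolding D_def by (rule norm_triangle_ineq)
    moreover have "norm ((R + 1) *\<^sub>R x) = R * norm x + norm x"
      using R(1) by (simp add: distrib_right del: scaleR_left_distrib)
    ultimately show ?thesis using R(2)[of x] by (simp add: algebra_simps)
  qed
  have start: "R + 1 - c \<le> norm (D y) / norm y"
  proof -
    have "(R + 1 - c) * (norm y * norm y) \<le> Re (cinner (D y) y)"
      using small unfolding form by (simp add: power2_eq_square algebra_simps)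
    also have "\<dots> \<le> norm (D y) * norm y" using complex_Re_le_cmod norm_cinner_le order_trans by blast
    finally have "((R + 1 - c) * norm y) * norm y \<le> norm (D y) * norm y" by (simp add: mult_ac)
    then show ?thesis using y(2) by (simp add: le_divide_eq)
  qed
  have "\<exists>\<nu>\<in>{- R..c}. joint_approx_kernel M (insert (\<lambda>x. N x - \<nu> *\<^sub>R x) {})"
  proof (rule joint_approx_kernel_insertI)
    fix d :: real assume d: "d > 0"
    obtain k \<rho> where k: "(D ^^ k) y \<in> M" "(D ^^ k) y \<noteq> 0" "norm (D y) / norm y \<le> \<rho>" "\<rho> \<le> 2 * R + 1"
      "norm (D ((D ^^ k) y) - \<rho> *\<^sub>R (D ^^ k) y) \<le> d * norm ((D ^^ k) y)"
      using power_method[OF M bD saD low up d] y by metis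
    let ?z = "(D ^^ k) y"
    have "N ?z - (R + 1 - \<rho>) *\<^sub>R ?z = - (D ?z - \<rho> *\<^sub>R ?z)" by (simp add: D_def algebra_simps)
    then have "norm (N ?z - (R + 1 - \<rho>) *\<^sub>R ?z) \<le> d * norm ?z" using k(5) by (simp only: norm_minus_cancel)
    then show "\<exists>\<beta>\<in>{- R..c}. \<exists>y\<in>M. y \<noteq> 0 \<and> (\<forall>S\<in>{}. norm (S y) \<le> d * norm y) \<and> norm (N y - \<beta> *\<^sub>R y) \<le> d * norm y"
      using k start by (intro bexI[of _ "R + 1 - \<rho>"] bexI[of _ ?z]) auto
  qed
  then show ?thesis by auto
qed

lemma joint_approx_kernel_mono:
  assumes "joint_approx_kernel M SS" "SS' \<subseteq> SS"
  shows "joint_approx_kernel M SS'"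
  using assms unfolding joint_approx_kernel_def by blast

lemma joint_approx_kernel_scaled:
  assumes "joint_approx_kernel M SS" "C > 0"
    and "\<And>S y d. S \<in> SS' \<Longrightarrow> y \<in> M \<Longrightarrow> d > 0 \<Longrightarrow> (\<And>S. S \<in> SS \<Longrightarrow> norm (S y) \<le> d * norm y) \<Longrightarrow> norm (S y) \<le> C * d * norm y"
  shows "joint_approx_kernel M SS'"
  unfolding joint_approx_kernel_def
proof (intro allI impI)
  fix d :: real assume d: "d > 0"
  then have dC: "d / C > 0" using assms(2) by simp
  then obtain y where y: "y \<in> M" "y \<noteq> 0" "\<And>S. S \<in> SS \<Longrightarrow> norm (S y) \<le> d / C * norm y"
    using assms(1) unfolding joint_approx_kernel_def by blast
  have "norm (S y) \<le> d * norm y" if "S \<in> SS'" for S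
    using assms(3)[of S, OF that y(1) dC] y(3) assms(2) by simp
  then show "\<exists>y\<in>M. y \<noteq> 0 \<and> (\<forall>S\<in>SS'. norm (S y) \<le> d * norm y)"
    using y(1,2) by blast
qed

text \<open>The real and the imaginary part of \<open>T\<close> are commuting self-adjoint operators.\<close>

lemma joint_approx_kernel_insert_normal:
  fixes T Q :: "'a::complex_inner \<Rightarrow> 'a"
  assumes M: "csubspace M" "\<And>x. x \<in> M \<Longrightarrow> T x \<in> M" "\<And>x. x \<in> M \<Longrightarrow> Q x \<in> M"
    and T: "bop T" "adjoint_pair T Q" "\<And>x. x \<in> M \<Longrightarrow> T (Q x) = Q (T x)"
    and approx: "joint_approx_kernel M SS"
    and SS: "\<And>S. S \<in> SS \<Longrightarrow> bop S" "\<And>S x. S \<in> SS \<Longrightarrow> x \<in> M \<Longrightarrow> S (T x) = T (S x)"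
       "\<And>S x. S \<in> SS \<Longrightarrow> x \<in> M \<Longrightarrow> S (Q x) = Q (S x)"
       "\<And>S x. S \<in> SS \<Longrightarrow> x \<in> M \<Longrightarrow> S x \<in> M"
  shows "\<exists>\<mu>. joint_approx_kernel M ({\<lambda>x. T x - \<mu> *\<^sub>C x, \<lambda>x. Q x - cnj \<mu> *\<^sub>C x} \<union> SS)"
proof -
  note Q = adjoint_pairD[OF T(2)]
  define A where "A = (\<lambda>x. (1 / 2) *\<^sub>C (T x + Q x))"
  define B where "B = (\<lambda>x. (- \<i> / 2) *\<^sub>C (T x - Q x))"
  have bA: "bop A" and bB: "bop B" unfolding A_def B_def by (intro bop_scaleC bop_add bop_diff T(1) Q(1))+
  have AM: "A x \<in> M" and BM: "B x \<in> M" if "x \<in> M" for x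
    unfolding A_def B_def by (intro csubspaceD[OF M(1)] M that)+
  have saA: "self_adjoint_on M A" and saB: "self_adjoint_on M B"
    using AM BM by (auto simp: self_adjoint_on_def A_def B_def cinner_simps Q(2,3) algebra_simps)
  have TAB: "T x = A x + \<i> *\<^sub>C B x" and QAB: "Q x = A x - \<i> *\<^sub>C B x" for x
  proof -
    have h: "(1 / 2) *\<^sub>C x + (1 / 2) *\<^sub>C x = x" for x :: 'a
      using scaleC_add_left[of "1/2" "1/2" x] by simp
    show "T x = A x + \<i> *\<^sub>C B x"
      using h[of "T x"] by (simp add: A_def B_def scaleC_scaleC scaleC_add_right scaleC_diff_right)
    show "Q x = A x - \<i> *\<^sub>C B x"
      using h[of "Q x"] by (simp add: A_def B_def scaleC_scaleC scaleC_add_right scaleC_diff_right algebra_simps)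
  qed
  have "S (A x) = A (S x)" "S (B x) = B (S x)" if "S \<in> SS" "x \<in> M" for S x
    using SS(2,3)[OF that] by (simp_all add: A_def B_def bopD[OF SS(1)[OF that(1)]])
  note SSAB = this
  have AB: "A (B x) = B (A x)" if "x \<in> M" for x
    using T(3)[OF that]
    by (simp add: A_def B_def bopD[OF T(1)] bopD[OF Q(1)] scaleC_scaleC scaleC_add_right scaleC_diff_right
        mult.commute)
  have "\<exists>\<alpha>. joint_approx_kernel M (insert (\<lambda>x. A x - \<alpha> *\<^sub>R x) SS)"
    by (rule joint_approx_kernel_insert_self_adjoint[OF M(1) bA saA approx])
      (simp_all add: SS(1,4) SSAB(1))
  then obtain \<alpha> where \<alpha>: "joint_approx_kernel M (insert (\<lambda>x. A x - \<alpha> *\<^sub>R x) SS)" by blast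
  let ?SS = "insert (\<lambda>x. A x - \<alpha> *\<^sub>R x) SS"
  have bA': "bop (\<lambda>x. A x - \<alpha> *\<^sub>R x)"
    using bop_diff[OF bA bop_scaleC[OF bop_id, of "of_real \<alpha>"]] by (simp only: scaleC_of_real)
  have "\<exists>\<beta>. joint_approx_kernel M (insert (\<lambda>x. B x - \<beta> *\<^sub>R x) ?SS)"
    by (rule joint_approx_kernel_insert_self_adjoint[OF M(1) bB saB \<alpha>])
      (auto simp: SS(1,4) SSAB(2) AB bA' bopD[OF bB] intro!: csubspaceD(5,6)[OF M(1)] AM)
  then obtain \<beta> where \<beta>: "joint_approx_kernel M (insert (\<lambda>x. B x - \<beta> *\<^sub>R x) ?SS)" by blast
  define \<mu> where "\<mu> = Complex \<alpha> \<beta>"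
  have \<mu>: "\<mu> *\<^sub>C x = \<alpha> *\<^sub>R x + \<i> *\<^sub>C (\<beta> *\<^sub>R x)" "cnj \<mu> *\<^sub>C x = \<alpha> *\<^sub>R x - \<i> *\<^sub>C (\<beta> *\<^sub>R x)" for x :: 'a
  proof -
    have "\<mu> = of_real \<alpha> + \<i> * of_real \<beta>" "cnj \<mu> = of_real \<alpha> - \<i> * of_real \<beta>"
      by (simp_all add: \<mu>_def complex_eq_iff)
    then show "\<mu> *\<^sub>C x = \<alpha> *\<^sub>R x + \<i> *\<^sub>C (\<beta> *\<^sub>R x)" "cnj \<mu> *\<^sub>C x = \<alpha> *\<^sub>R x - \<i> *\<^sub>C (\<beta> *\<^sub>R x)"
      by (simp_all only: scaleC_add_left scaleC_diff_left scaleC_of_real flip: scaleC_scaleC)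
  qed
  have "joint_approx_kernel M ({\<lambda>x. T x - \<mu> *\<^sub>C x, \<lambda>x. Q x - cnj \<mu> *\<^sub>C x} \<union> SS)"
  proof (rule joint_approx_kernel_scaled[OF \<beta>, of 2])
    fix S y and d :: real
    assume S: "S \<in> {\<lambda>x. T x - \<mu> *\<^sub>C x, \<lambda>x. Q x - cnj \<mu> *\<^sub>C x} \<union> SS" and d: "d > 0"
      and small: "\<And>S. S \<in> insert (\<lambda>x. B x - \<beta> *\<^sub>R x) ?SS \<Longrightarrow> norm (S y) \<le> d * norm y"
    have a: "norm (A y - \<alpha> *\<^sub>R y) \<le> d * norm y" and b: "norm (\<i> *\<^sub>C (B y - \<beta> *\<^sub>R y)) \<le> d * norm y"
      using small by (auto simp: norm_scaleC)
    have 1: "T y - \<mu> *\<^sub>C y = (A y - \<alpha> *\<^sub>R y) + \<i> *\<^sub>C (B y - \<beta> *\<^sub>R y)"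
      and 2: "Q y - cnj \<mu> *\<^sub>C y = (A y - \<alpha> *\<^sub>R y) - \<i> *\<^sub>C (B y - \<beta> *\<^sub>R y)"
      unfolding TAB QAB \<mu> by (simp_all add: scaleC_diff_right algebra_simps)
    have "norm (T y - \<mu> *\<^sub>C y) \<le> 2 * d * norm y"
      unfolding 1 using norm_triangle_le[OF add_mono[OF a b]] by (simp add: algebra_simps)
    moreover have "norm (Q y - cnj \<mu> *\<^sub>C y) \<le> 2 * d * norm y"
      unfolding 2 using norm_triangle_le_diff[OF add_mono[OF a b]] by (simp add: algebra_simps)
    moreover have "norm (S y) \<le> 2 * d * norm y" if "S \<in> SS"
      using small[of S] that mult_nonneg_nonneg[OF less_imp_le[OF d] norm_ge_zero[of y]] by auto
    ultimately show "norm (S y) \<le> 2 * d * norm y" using S by auto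
  qed simp
  then show ?thesis by blast
qed

section \<open>Normal tuples\<close>

text \<open>The operators live on the whole space and have global adjoints \<open>Q i\<close>; commutation is a condition on
the invariant subspace \<open>M\<close>. In this way the same operators can be used on
all reducing subspaces and on their span.\<close>

locale normal_tuple =
  fixes M :: "'a::chilbert_space set" and T Q :: "'n::{finite,linorder} \<Rightarrow> 'a \<Rightarrow> 'a"
  assumes csub: "csubspace M" and closed: "closed M"
    and bop_T: "bop (T i)" and adj: "adjoint_pair (T i) (Q i)"
    and T_in: "x \<in> M \<Longrightarrow> T i x \<in> M" and Q_in: "x \<in> M \<Longrightarrow> Q i x \<in> M"
    and TT: "x \<in> M \<Longrightarrow> T i (T j x) = T j (T i x)"
    and TQ: "x \<in> M \<Longrightarrow> T i (Q j x) = Q j (T i x)"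
begin

lemma bop_Q: "bop (Q i)"
  by (rule adjoint_pairD(1)[OF adj])

lemmas T_adj = adjoint_pairD(2)[OF adj] and Q_adj = adjoint_pairD(3)[OF adj]

lemma QQ:
  assumes x: "x \<in> M"
  shows "Q i (Q j x) = Q j (Q i x)"
proof -
  define u where "u = Q i (Q j x) - Q j (Q i x)"
  have u: "u \<in> M" unfolding u_def by (intro csubspaceD[OF csub] Q_in x)
  have "cinner u v = cinner x (T j (T i v) - T i (T j v))" for v
    by (simp add: u_def cinner_diff_right cinner_diff_left Q_adj)
  from this[of u] have "u = 0" using TT[OF u, of i j] by (simp add: cinner_self)
  then show ?thesis by (simp add: u_def)
qed

lemma normal_tuple_shift:
  "normal_tuple M (\<lambda>i x. T i x - l i *\<^sub>C x) (\<lambda>i x. Q i x - cnj (l i) *\<^sub>C x)"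
proof
  fix i j
  show "bop (\<lambda>x. T i x - l i *\<^sub>C x)" by (intro bop_diff bop_T bop_scaleC bop_id)
  show "adjoint_pair (\<lambda>x. T i x - l i *\<^sub>C x) (\<lambda>x. Q i x - cnj (l i) *\<^sub>C x)"
    unfolding is_adjoint_on_def
    by (auto simp: cinner_simps T_adj intro!: bop_diff bop_Q bop_scaleC bop_id)
  fix x assume x: "x \<in> M"
  show "T i x - l i *\<^sub>C x \<in> M" "Q i x - cnj (l i) *\<^sub>C x \<in> M"
    by (intro csubspaceD[OF csub] T_in Q_in x)+
  show "T i (T j x - l j *\<^sub>C x) - l i *\<^sub>C (T j x - l j *\<^sub>C x) =
      T j (T i x - l i *\<^sub>C x) - l j *\<^sub>C (T i x - l i *\<^sub>C x)"
    using TT[OF x, of i j]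
    by (simp add: bopD[OF bop_T] scaleC_diff_right scaleC_scaleC mult.commute algebra_simps)
  show "T i (Q j x - cnj (l j) *\<^sub>C x) - l i *\<^sub>C (Q j x - cnj (l j) *\<^sub>C x) =
      Q j (T i x - l i *\<^sub>C x) - cnj (l j) *\<^sub>C (T i x - l i *\<^sub>C x)"
    using TQ[OF x, of i j]
    by (simp add: bopD[OF bop_T] bopD[OF bop_Q] scaleC_diff_right scaleC_scaleC mult.commute algebra_simps)
qed (rule csub closed)+

definition gram :: "'a \<Rightarrow> 'a" where "gram x = (\<Sum>i\<in>UNIV. Q i (T i x))"

lemma bop_gram: "bop gram"
  unfolding gram_def[abs_def] by (rule bop_sum) (rule bop_compose[OF bop_Q bop_T])

lemma gram_self_adjoint: "cinner (gram x) y = cinner x (gram y)"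
  by (simp add: gram_def cinner_sum_left cinner_sum_right Q_adj T_adj)

lemma gram_in: "x \<in> M \<Longrightarrow> gram x \<in> M"
  unfolding gram_def by (intro csubspace_sum[OF csub] Q_in T_in)

lemma Re_cinner_gram: "Re (cinner (gram x) x) = (\<Sum>i\<in>UNIV. (norm (T i x))\<^sup>2)"
  by (simp add: gram_def cinner_sum_left Q_adj norm_sq_eq_Re_cinner)

lemma gram_T:
  assumes "x \<in> M"
  shows "gram (T i x) = T i (gram x)"
  unfolding gram_def bopD(7)[OF bop_T]
proof (rule sum.cong[OF refl])
  fix k
  show "Q k (T k (T i x)) = T i (Q k (T k x))"
    using TT[OF assms, of k i] TQ[OF T_in[OF assms], of i k k] by simp
qed

lemma gram_Q:
  assumes "x \<in> M"
  shows "gram (Q i x) = Q i (gram x)"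
  unfolding gram_def bopD(7)[OF bop_Q]
proof (rule sum.cong[OF refl])
  fix k
  show "Q k (T k (Q i x)) = Q i (Q k (T k x))"
    using TQ[OF assms, of k i] QQ[OF T_in[OF assms], of k i k] by simp
qed

lemma joint_approx_eigenvalue:
  assumes approx: "joint_approx_kernel M SS"
    and SS: "\<And>S. S \<in> SS \<Longrightarrow> bop S" "\<And>S x i. S \<in> SS \<Longrightarrow> x \<in> M \<Longrightarrow> S (T i x) = T i (S x)"
       "\<And>S x i. S \<in> SS \<Longrightarrow> x \<in> M \<Longrightarrow> S (Q i x) = Q i (S x)"
       "\<And>S x. S \<in> SS \<Longrightarrow> x \<in> M \<Longrightarrow> S x \<in> M"
  shows "\<exists>\<mu>. joint_approx_kernel M
     (SS \<union> (\<Union>i. {\<lambda>x. T i x - \<mu> i *\<^sub>C x, \<lambda>x. Q i x - cnj (\<mu> i) *\<^sub>C x}))"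
proof -
  define E where "E \<mu> i = {\<lambda>x. T i x - \<mu> i *\<^sub>C x, \<lambda>x. Q i x - cnj (\<mu> i) *\<^sub>C x}" for \<mu> i
  have "\<exists>\<mu>. joint_approx_kernel M (SS \<union> (\<Union>i\<in>I. E \<mu> i))" if "finite I" for I
    using that
  proof (induction I)
    case empty
    then show ?case using approx by simp
  next
    case (insert k I)
    then obtain \<mu> where \<mu>: "joint_approx_kernel M (SS \<union> (\<Union>i\<in>I. E \<mu> i))" by blast
    note sh = normal_tuple_shift[of \<mu>]
    have "\<exists>m. joint_approx_kernel M ({\<lambda>x. T k x - m *\<^sub>C x, \<lambda>x. Q k x - cnj m *\<^sub>C x} \<union> (SS \<union> (\<Union>i\<in>I. E \<mu> i)))"
    proof (rule joint_approx_kernel_insert_normal[where T = "T k" and Q = "Q k"])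
      show "csubspace M" by (rule csub)
      show "joint_approx_kernel M (SS \<union> (\<Union>i\<in>I. E \<mu> i))" by fact+
      show "bop (T k)" "adjoint_pair (T k) (Q k)" by (rule bop_T adj)+
      show "T k x \<in> M" "Q k x \<in> M" "T k (Q k x) = Q k (T k x)" if "x \<in> M" for x
        using that by (rule T_in Q_in TQ)+
      fix S assume S: "S \<in> SS \<union> (\<Union>i\<in>I. E \<mu> i)"
      then consider "S \<in> SS" | i where "S = (\<lambda>x. T i x - \<mu> i *\<^sub>C x)" | i where "S = (\<lambda>x. Q i x - cnj (\<mu> i) *\<^sub>C x)"
        by (auto simp: E_def)
      note cases = this
      show "bop S" using cases
        by cases (simp_all add: SS(1) normal_tuple.bop_T[OF sh] normal_tuple.bop_Q[OF sh])
      fix x assume x: "x \<in> M"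
      show "S (T k x) = T k (S x)"
        using cases by cases (simp_all add: SS(2) x bopD[OF bop_T] TT[OF x, of k] TQ)
      show "S (Q k x) = Q k (S x)"
        using cases by cases (simp_all add: SS(3) x bopD[OF bop_Q] QQ[OF x, of k] TQ)
      show "S x \<in> M"
        using cases by cases (simp_all add: SS(4) x normal_tuple.T_in[OF sh] normal_tuple.Q_in[OF sh])
    qed
    then obtain m where m: "joint_approx_kernel M
      ({\<lambda>x. T k x - m *\<^sub>C x, \<lambda>x. Q k x - cnj m *\<^sub>C x} \<union> (SS \<union> (\<Union>i\<in>I. E \<mu> i)))" by (rule exE)
    have "E (\<mu>(k := m)) k = {\<lambda>x. T k x - m *\<^sub>C x, \<lambda>x. Q k x - cnj m *\<^sub>C x}" by (simp add: E_def)
    moreover have "(\<Union>i\<in>I. E (\<mu>(k := m)) i) = (\<Union>i\<in>I. E \<mu> i)"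
      using insert.hyps(2) by (intro SUP_cong) (auto simp: E_def)
    ultimately have "joint_approx_kernel M (SS \<union> (\<Union>i\<in>insert k I. E (\<mu>(k := m)) i))"
      using m by (simp only: UN_insert Un_left_commute)
    then show ?case by blast
  qed
  from this[OF finite] show ?thesis unfolding E_def .
qed

end

section \<open>Exactness of the Koszul complex bounds the operators below\<close>

text \<open>This is the uniform boundedness principle for inner products with unit vectors, in a quantitative form.\<close>

lemma gliding_hump:
  fixes z :: "nat \<Rightarrow> 'a::chilbert_space"
  assumes M: "csubspace M" "closed M" and z: "\<And>n. z n \<in> M" "\<And>n. norm (z n) = 1"
  obtains x where "x \<in> M" "\<And>n. (1 / 3) ^ n / 2 \<le> cmod (cinner x (z n))"
proof -
  \<comment> \<open>Adding or subtracting a multiple of \<open>z n\<close> makes the inner product with \<open>z n\<close> large; all later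
    corrections together amount to at most half of it.\<close>
  define X where "X = rec_nat 0 (\<lambda>n v. if (1 / 3) ^ n \<le> cmod (cinner v (z n) + of_real ((1 / 3) ^ n))
      then v + (1 / 3) ^ n *\<^sub>R z n else v - (1 / 3) ^ n *\<^sub>R z n)"
  have X0: "X 0 = 0" and XS: "X (Suc n) = (if (1 / 3) ^ n \<le> cmod (cinner (X n) (z n) + of_real ((1 / 3) ^ n))
      then X n + (1 / 3) ^ n *\<^sub>R z n else X n - (1 / 3) ^ n *\<^sub>R z n)" for n
    by (simp_all add: X_def)
  have XM: "X n \<in> M" for n
    by (induction n) (auto simp: X0 XS intro!: csubspaceD[OF M(1)] z)
  have step: "norm (X (Suc n) - X n) = (1 / 3) ^ n" for n
    by (simp add: XS z(2))
  have hump: "(1 / 3) ^ n \<le> cmod (cinner (X (Suc n)) (z n))" for n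
  proof -
    define h where "h = ((1 / 3) ^ n :: real)"
    have ip: "cinner (h *\<^sub>R z n) (z n) = of_real h"
      by (simp add: cinner_scaleC_left cinner_self z(2) flip: scaleC_of_real)
    have h: "h > 0" by (simp add: h_def)
    have "of_real h + of_real h = (cinner (X n) (z n) + of_real h) - (cinner (X n) (z n) - of_real h)" by simp
    then have "cmod (of_real h + of_real h) \<le> cmod (cinner (X n) (z n) + of_real h) + cmod (cinner (X n) (z n) - of_real h)"
      by (metis norm_triangle_ineq4)
    then have "2 * h \<le> cmod (cinner (X n) (z n) + of_real h) + cmod (cinner (X n) (z n) - of_real h)"
      using h by (simp flip: of_real_add)
    then show ?thesis
      unfolding XS h_def[symmetric] using ip by (auto simp: cinner_add_left cinner_diff_left)
  qed
  have tail: "norm (X (Suc n + k) - X (Suc n)) \<le> (1 / 3) ^ n * (1 - (1 / 3) ^ k) / 2" for n k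
  proof (induction k)
    case (Suc k)
    have "norm (X (Suc n + Suc k) - X (Suc n)) \<le> norm (X (Suc (Suc n + k)) - X (Suc n + k)) + norm (X (Suc n + k) - X (Suc n))"
      using norm_triangle_ineq[of "X (Suc (Suc n + k)) - X (Suc n + k)" "X (Suc n + k) - X (Suc n)"] by simp
    also have "\<dots> \<le> (1 / 3) ^ (Suc n + k) + (1 / 3) ^ n * (1 - (1 / 3) ^ k) / 2"
      using step[of "Suc n + k"] Suc by linarith
    also have "\<dots> = (1 / 3) ^ n * (1 - (1 / 3) ^ Suc k) / 2" by (simp add: power_add field_simps)
    finally show ?case .
  qed simp
  have tail': "norm (X m - X (Suc n)) \<le> (1 / 3) ^ n / 2" if "m \<ge> Suc n" for m n
  proof -
    obtain k where k: "m = Suc n + k" using le_Suc_ex[OF \<open>Suc n \<le> m\<close>] by blast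
    have "(1 / 3) ^ n * (1 - (1 / 3) ^ k) \<le> (1 / 3) ^ n * (1 :: real)"
      by (rule mult_left_mono) simp_all
    then show ?thesis using tail[of n k] unfolding k by linarith
  qed
  have "Cauchy X"
  proof (rule metric_CauchyI)
    fix e :: real assume e: "e > 0"
    obtain n where n: "(1 / 3) ^ n < e" using real_arch_pow_inv[OF e, of "1 / 3"] by auto
    have "dist (X i) (X j) < e" if "i \<ge> Suc n" "j \<ge> Suc n" for i j
      using dist_triangle2[of "X i" "X j" "X (Suc n)"] tail'[OF that(1)] tail'[OF that(2)] n
      by (simp add: dist_norm)
    then show "\<exists>N. \<forall>i\<ge>N. \<forall>j\<ge>N. dist (X i) (X j) < e" by blast
  qed
  then obtain x where x: "X \<longlonglongrightarrow> x" using Cauchy_convergent convergent_def by blast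
  show ?thesis
  proof (rule that)
    show "x \<in> M" by (rule closed_sequentially[OF M(2) XM x])
    fix n
    have "(\<lambda>m. norm (X m - X (Suc n))) \<longlonglongrightarrow> norm (x - X (Suc n))" by (intro tendsto_intros x)
    moreover have "\<forall>\<^sub>F m in sequentially. norm (X m - X (Suc n)) \<le> (1 / 3) ^ n / 2"
      by (rule eventually_mono[OF eventually_ge_at_top tail'])
    ultimately have "norm (x - X (Suc n)) \<le> (1 / 3) ^ n / 2"
      by (rule tendsto_upperbound) (rule sequentially_bot)
    then have "cmod (cinner (x - X (Suc n)) (z n)) \<le> (1 / 3) ^ n / 2"
      using norm_cinner_le[of "x - X (Suc n)" "z n"] z(2)[of n] by simp
    moreover have "cmod (cinner (X (Suc n)) (z n)) \<le> cmod (cinner x (z n)) + cmod (cinner (x - X (Suc n)) (z n))"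
      using norm_triangle_ineq4[of "cinner x (z n)" "cinner (x - X (Suc n)) (z n)"]
      by (simp add: cinner_diff_left)
    ultimately show "(1 / 3) ^ n / 2 \<le> cmod (cinner x (z n))" using hump[of n] by linarith
  qed
qed

text \<open>Exactness in the highest degree: there every element is closed, and the differential into this degree
is, up to signs, \<open>(y\<^sub>i) \<mapsto> \<Sum>\<^sub>i S\<^sub>i y\<^sub>i\<close>.\<close>

lemma koszul_exact_imp_surjective:
  fixes S :: "'n::{finite,linorder} \<Rightarrow> 'a \<Rightarrow> 'a::complex_inner"
  assumes ex: "koszul_exact M S" and S: "\<And>i. bop (S i)" and M: "csubspace M" and x: "x \<in> M"
  obtains y where "\<And>i. y i \<in> M" "x = (\<Sum>i\<in>UNIV. S i (y i))"
proof -
  obtain p where p: "CARD('n) = Suc p" using card_gt_0_iff[of "UNIV :: 'n set"] gr0_conv_Suc by auto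
  define \<xi> where "\<xi> = (\<lambda>J :: 'n set. if J = UNIV then x else 0)"
  have "\<xi> \<in> koszul_space M (Suc p)"
    using x M p by (auto simp: \<xi>_def koszul_space_def csubspaceD)
  moreover have "koszul_d S \<xi> = (\<lambda>_. 0)"
  proof
    fix J
    have "\<xi> (J - {i}) = 0" if "i \<in> J" for i unfolding \<xi>_def by auto
    then show "koszul_d S \<xi> J = 0" unfolding koszul_d_def by (intro sum.neutral ballI) (simp add: bopD[OF S])
  qed
  ultimately have "\<xi> \<in> koszul_d S ` koszul_space M p" using ex unfolding koszul_exact_def by blast
  then obtain \<eta> where \<eta>: "\<eta> \<in> koszul_space M p" "\<xi> = koszul_d S \<eta>" by blast
  define y where "y i = (-1) ^ card {j :: 'n. j < i} *\<^sub>R \<eta> (UNIV - {i})" for i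
  have "y i \<in> M" for i
    using \<eta>(1) csubspaceD(6)[OF M] by (auto simp: y_def koszul_space_def)
  moreover have "x = (\<Sum>i\<in>UNIV. S i (y i))"
    using fun_cong[OF \<eta>(2), of UNIV] by (simp add: \<xi>_def koszul_d_def y_def bopD[OF S])
  ultimately show ?thesis using that by blast
qed

context normal_tuple
begin

text \<open>Otherwise pick unit vectors \<open>z n\<close> almost annihilated by all \<open>Q i\<close>, and a vector \<open>x = \<Sum>\<^sub>i T\<^sub>i v\<^sub>i\<close> whose inner products
with the \<open>z n\<close> do not decay as fast as \<open>\<langle>x, z n\<rangle> = \<Sum>\<^sub>i \<langle>v\<^sub>i, Q\<^sub>i (z n)\<rangle>\<close> requires.\<close>

lemma koszul_exact_imp_not_approx:
  assumes ex: "koszul_exact M T"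
  shows "\<not> joint_approx_kernel M (range Q)"
proof
  assume ap: "joint_approx_kernel M (range Q)"
  \<comment> \<open>\<open>1 / 9\<close> beats the rate \<open>1 / 3\<close> of the gliding hump.\<close>
  have "\<exists>y\<in>M. y \<noteq> 0 \<and> (\<forall>S\<in>range Q. norm (S y) \<le> (1 / 9) ^ n * norm y)" for n
    using ap unfolding joint_approx_kernel_def by simp
  then obtain y where y: "\<And>n. y n \<in> M" "\<And>n. y n \<noteq> 0" "\<And>n i. norm (Q i (y n)) \<le> (1 / 9) ^ n * norm (y n)"
    by (metis rangeI)
  define z where "z n = (1 / norm (y n)) *\<^sub>R y n" for n
  have zM: "z n \<in> M" for n unfolding z_def by (rule csubspaceD(6)[OF csub y(1)])
  have z1: "norm (z n) = 1" for n using y(2) by (simp add: z_def)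
  have zQ: "norm (Q i (z n)) \<le> (1 / 9) ^ n" for n i
    using y(2)[of n] y(3)[of i n] by (simp add: z_def bopD[OF bop_Q] divide_le_eq)
  obtain x where x: "x \<in> M" "\<And>n. (1 / 3) ^ n / 2 \<le> cmod (cinner x (z n))"
    using gliding_hump[where z = z, OF csub closed zM z1] by blast
  obtain v where v: "x = (\<Sum>i\<in>UNIV. T i (v i))"
    using koszul_exact_imp_surjective[OF ex bop_T csub x(1)] by metis
  define C where "C = (\<Sum>i\<in>UNIV. norm (v i))"
  have "3 ^ n \<le> 2 * C" for n
  proof -
    have "cmod (cinner x (z n)) \<le> (\<Sum>i\<in>UNIV. cmod (cinner (v i) (Q i (z n))))"
      unfolding v cinner_sum_left T_adj by (rule norm_sum)
    also have "\<dots> \<le> (\<Sum>i\<in>UNIV. norm (v i) * (1 / 9) ^ n)"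
    proof (rule sum_mono)
      fix i
      have "cmod (cinner (v i) (Q i (z n))) \<le> norm (v i) * norm (Q i (z n))" by (rule norm_cinner_le)
      also have "\<dots> \<le> norm (v i) * (1 / 9) ^ n" by (intro mult_left_mono zQ) simp
      finally show "cmod (cinner (v i) (Q i (z n))) \<le> norm (v i) * (1 / 9) ^ n" .
    qed
    also have "\<dots> = C * (1 / 9) ^ n" by (simp add: C_def sum_distrib_right)
    finally have "(1 / 3) ^ n \<le> 2 * C * (1 / 9) ^ n" using x(2)[of n] by simp
    moreover have "(9 :: real) ^ n = 3 ^ n * 3 ^ n" by (simp flip: power_mult_distrib)
    ultimately show ?thesis by (simp add: power_divide field_simps)
  qed
  moreover obtain n where "2 * C < 3 ^ n" using real_arch_pow[of 3 "2 * C"] by auto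
  ultimately show False by (metis not_le)
qed

text \<open>If the bound fails, there is an approximate eigenvalue \<open>\<nu> \<le> c\<^sup>2\<close> of \<^term>\<open>gram\<close>, where \<open>c = d / (2 n)\<close> for \<open>n\<close>
operators. It is
refined to a joint approximate eigenvalue \<open>\<mu>\<close> of the \<open>T i\<close>, which satisfies \<open>|\<mu>\<^sub>i| < 2 c\<close> and therefore
\<open>norm \<mu> < d\<close>, contradicting exactness at \<open>\<mu>\<close>. The factor 2 leaves room for the errors in the estimates.\<close>

lemma gram_bounded_below:
  assumes d: "d > 0"
    and ex: "\<And>\<mu> :: complex ^ 'n::{finite,linorder}. norm \<mu> < d \<Longrightarrow> koszul_exact M (\<lambda>i x. T i x - \<mu> $ i *\<^sub>C x)"
    and x: "x \<in> M"
  shows "(d / (2 * CARD('n)))\<^sup>2 * (norm x)\<^sup>2 \<le> Re (cinner (gram x) x)"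
proof (rule ccontr)
  assume neg: "\<not> ?thesis"
  define c where "c = d / (2 * CARD('n))"
  have c: "c > 0" using d by (simp add: c_def)
  have "x \<noteq> 0" using neg by (auto simp: bopD[OF bop_gram])
  moreover have "self_adjoint_on M gram"
    by (auto simp: self_adjoint_on_def gram_in gram_self_adjoint)
  ultimately obtain \<nu> where \<nu>: "\<nu> \<le> c\<^sup>2" "joint_approx_kernel M {\<lambda>x. gram x - \<nu> *\<^sub>R x}"
    using joint_approx_kernel_self_adjoint_below[OF csub bop_gram _ x, of "c\<^sup>2"] neg
    by (auto simp: c_def)
  have "\<exists>\<mu>. joint_approx_kernel M ({\<lambda>x. gram x - \<nu> *\<^sub>R x} \<union>
      (\<Union>i. {\<lambda>x. T i x - \<mu> i *\<^sub>C x, \<lambda>x. Q i x - cnj (\<mu> i) *\<^sub>C x}))"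
  proof (rule joint_approx_eigenvalue[OF \<nu>(2)])
    fix S :: "'a \<Rightarrow> 'a" assume S: "S \<in> {\<lambda>x. gram x - \<nu> *\<^sub>R x}"
    show "bop S" using S bop_diff[OF bop_gram bop_scaleC[OF bop_id, of "of_real \<nu>"]]
      by (simp add: scaleC_of_real)
    fix x i assume "x \<in> M"
    then show "S (T i x) = T i (S x)" "S (Q i x) = Q i (S x)" "S x \<in> M"
      using S csubspaceD[OF csub] by (simp_all add: bopD[OF bop_T] bopD[OF bop_Q] gram_T gram_Q gram_in)
  qed
  then obtain \<mu> where \<mu>: "joint_approx_kernel M ({\<lambda>x. gram x - \<nu> *\<^sub>R x} \<union>
      (\<Union>i. {\<lambda>x. T i x - \<mu> i *\<^sub>C x, \<lambda>x. Q i x - cnj (\<mu> i) *\<^sub>C x}))" ..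
  have small: "cmod (\<mu> i) < 2 * c" for i
  proof (rule ccontr)
    assume big: "\<not> cmod (\<mu> i) < 2 * c"
    define \<delta> where "\<delta> = min (c / 4) (c\<^sup>2 / 4)"
    have \<delta>: "\<delta> > 0" "\<delta> \<le> c / 4" "\<delta> \<le> c\<^sup>2 / 4" using c by (auto simp: \<delta>_def)
    obtain y where y: "y \<in> M" "y \<noteq> 0" "norm (gram y - \<nu> *\<^sub>R y) \<le> \<delta> * norm y" "norm (T i y - \<mu> i *\<^sub>C y) \<le> \<delta> * norm y"
      using \<mu>[unfolded joint_approx_kernel_def, rule_format, OF \<delta>(1)] by auto
    have "(norm (T i y))\<^sup>2 \<le> Re (cinner (gram y) y)"
      unfolding Re_cinner_gram by (rule member_le_sum) auto
    also have "\<dots> = Re (cinner (gram y - \<nu> *\<^sub>R y) y) + \<nu> * (norm y)\<^sup>2"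
      by (simp add: cinner_simps cinner_self flip: scaleC_of_real)
    also have "Re (cinner (gram y - \<nu> *\<^sub>R y) y) \<le> \<delta> * norm y * norm y"
      using complex_Re_le_cmod[of "cinner (gram y - \<nu> *\<^sub>R y) y"] norm_cinner_le[of "gram y - \<nu> *\<^sub>R y" y]
        mult_right_mono[OF y(3), of "norm y"] by simp
    also have "\<delta> * norm y * norm y + \<nu> * (norm y)\<^sup>2 = (\<delta> + \<nu>) * (norm y)\<^sup>2"
      by (simp add: power2_eq_square algebra_simps)
    also have "\<dots> \<le> (5 / 4 * c\<^sup>2) * (norm y)\<^sup>2" using \<delta>(3) \<nu>(1) by (intro mult_right_mono) auto
    finally have up: "(norm (T i y))\<^sup>2 \<le> 5 / 4 * c\<^sup>2 * (norm y)\<^sup>2" by simp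
    have "cmod (\<mu> i) * norm y \<le> norm (T i y) + norm (T i y - \<mu> i *\<^sub>C y)"
      using norm_triangle_ineq4[of "T i y" "T i y - \<mu> i *\<^sub>C y"] by (simp add: norm_scaleC)
    moreover have "2 * c * norm y \<le> cmod (\<mu> i) * norm y" using big by (intro mult_right_mono) auto
    moreover have "\<delta> * norm y \<le> c / 4 * norm y" using \<delta>(2) by (intro mult_right_mono) auto
    ultimately have "7 / 4 * c * norm y \<le> norm (T i y)" using y(4) by simp
    then have "(7 / 4 * c * norm y)\<^sup>2 \<le> (norm (T i y))\<^sup>2" using c by (intro power_mono) auto
    then have "(49 / 16) * (c\<^sup>2 * (norm y)\<^sup>2) \<le> (5 / 4) * (c\<^sup>2 * (norm y)\<^sup>2)"
      using up by (simp add: power_mult_distrib power_divide)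
    moreover have "c\<^sup>2 * (norm y)\<^sup>2 > 0" using c y(2) by simp
    ultimately show False by linarith
  qed
  define m where "m = (\<chi> i. \<mu> i)"
  have "norm m \<le> (\<Sum>i\<in>UNIV. cmod (m $ i))" by (rule norm_vec_le_sum)
  also have "\<dots> < (\<Sum>i\<in>(UNIV :: 'n set). 2 * c)" using small by (intro sum_strict_mono) (auto simp: m_def)
  also have "\<dots> = d" by (simp add: c_def)
  finally have ko: "koszul_exact M (\<lambda>i x. T i x - \<mu> i *\<^sub>C x)" using ex[of m] by (simp add: m_def)
  have "joint_approx_kernel M (range (\<lambda>i x. Q i x - cnj (\<mu> i) *\<^sub>C x))"
    by (rule joint_approx_kernel_mono[OF \<mu>]) auto
  then show False using normal_tuple.koszul_exact_imp_not_approx[OF normal_tuple_shift ko] by contradiction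
qed

end

section \<open>Operators bounded below have an exact Koszul complex\<close>

definition koszul_sign :: "'n::linorder \<Rightarrow> 'n set \<Rightarrow> real" where
  "koszul_sign i J = (-1) ^ card {j \<in> J. j < i}"

lemma koszul_d_eq: "koszul_d S \<xi> J = (\<Sum>i\<in>J. koszul_sign i J *\<^sub>R S i (\<xi> (J - {i})))"
  by (simp add: koszul_d_def koszul_sign_def)

lemma koszul_sign_insert:
  fixes i k :: "'n::{finite,linorder}"
  assumes "k \<notin> J"
  shows "koszul_sign i (insert k J) = (if k < i then - koszul_sign i J else koszul_sign i J)"
proof (cases "k < i")
  case True
  then have "{j \<in> insert k J. j < i} = insert k {j \<in> J. j < i}" by auto
  moreover have "card (insert k {j \<in> J. j < i}) = Suc (card {j \<in> J. j < i})"
    using assms by (subst card_insert_disjoint) auto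
  ultimately show ?thesis using True by (simp add: koszul_sign_def)
next
  case False
  then have "{j \<in> insert k J. j < i} = {j \<in> J. j < i}" by auto
  then show ?thesis using False by (simp add: koszul_sign_def)
qed

lemma koszul_sign_remove:
  fixes i k :: "'n::{finite,linorder}"
  assumes "k \<in> J"
  shows "koszul_sign i (J - {k}) = (if k < i then - koszul_sign i J else koszul_sign i J)"
  using koszul_sign_insert[of k "J - {k}" i] assms by (auto simp: insert_absorb split: if_splits)

lemma koszul_sign_square: "koszul_sign i J * koszul_sign i J = 1"
  by (simp add: koszul_sign_def flip: power_mult_distrib)

text \<open>With \<open>Q i\<close> the adjoint of \<open>S i\<close>, this is the Hilbert space adjoint of the Koszul differential of \<open>S\<close>.\<close>

definition koszul_h :: "('n::{finite,linorder} \<Rightarrow> 'a \<Rightarrow> 'a::complex_inner) \<Rightarrow> ('n set \<Rightarrow> 'a) \<Rightarrow> 'n set \<Rightarrow> 'a" where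
  "koszul_h Q \<xi> = (\<lambda>J. \<Sum>k\<in>- J. koszul_sign k J *\<^sub>R Q k (\<xi> (insert k J)))"

lemma koszul_d_in_koszul_space:
  fixes S :: "'n::{finite,linorder} \<Rightarrow> 'a \<Rightarrow> 'a::complex_inner"
  assumes M: "csubspace M" and S: "\<And>i. bop (S i)" "\<And>i x. x \<in> M \<Longrightarrow> S i x \<in> M"
    and \<xi>: "\<xi> \<in> koszul_space M p"
  shows "koszul_d S \<xi> \<in> koszul_space M (Suc p)"
  unfolding koszul_space_def
proof (intro CollectI allI conjI impI)
  fix J :: "'n set"
  show "koszul_d S \<xi> J \<in> M"
    unfolding koszul_d_eq using \<xi> by (intro csubspace_sum[OF M] csubspaceD(6)[OF M] S) (auto simp: koszul_space_def)
  assume J: "card J \<noteq> Suc p"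
  have "\<xi> (J - {i}) = 0" if "i \<in> J" for i
    using \<xi> J card_Suc_Diff1[OF _ that] by (auto simp: koszul_space_def)
  then show "koszul_d S \<xi> J = 0" unfolding koszul_d_eq by (intro sum.neutral ballI) (simp add: bopD[OF S(1)])
qed

lemma koszul_h_in_koszul_space:
  fixes Q :: "'n::{finite,linorder} \<Rightarrow> 'a \<Rightarrow> 'a::complex_inner"
  assumes M: "csubspace M" and Q: "\<And>i. bop (Q i)" "\<And>i x. x \<in> M \<Longrightarrow> Q i x \<in> M"
    and \<xi>: "\<xi> \<in> koszul_space M (Suc p)"
  shows "koszul_h Q \<xi> \<in> koszul_space M p"
  unfolding koszul_space_def
proof (intro CollectI allI conjI impI)
  fix J :: "'n set"
  show "koszul_h Q \<xi> J \<in> M"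
    unfolding koszul_h_def using \<xi> by (intro csubspace_sum[OF M] csubspaceD(6)[OF M] Q) (auto simp: koszul_space_def)
  assume J: "card J \<noteq> p"
  have "\<xi> (insert k J) = 0" if "k \<in> - J" for k
    using \<xi> J that by (auto simp: koszul_space_def)
  then show "koszul_h Q \<xi> J = 0" unfolding koszul_h_def by (intro sum.neutral ballI) (simp add: bopD[OF Q(1)])
qed

context normal_tuple
begin

lemma koszul_d_d:
  assumes \<xi>: "\<And>J. \<xi> J \<in> M"
  shows "koszul_d T (koszul_d T \<xi>) J = 0"
proof -
  define F where "F i k = (if i = k then 0 else
     (koszul_sign i J * koszul_sign k (J - {i})) *\<^sub>R T i (T k (\<xi> (J - {i} - {k}))))" for i k
  have "koszul_d T (koszul_d T \<xi>) J = (\<Sum>i\<in>J. \<Sum>k\<in>J - {i}. F i k)"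
    unfolding koszul_d_eq bopD(7)[OF bop_T] bopD(6)[OF bop_T] scaleR_sum_right scaleR_scaleR
    by (intro sum.cong refl) (auto simp: F_def)
  also have "\<dots> = (\<Sum>i\<in>J. \<Sum>k\<in>J. F i k)"
    by (intro sum.cong refl sum.mono_neutral_left) (auto simp: F_def)
  finally have 1: "koszul_d T (koszul_d T \<xi>) J = (\<Sum>i\<in>J. \<Sum>k\<in>J. F i k)" .
  have anti: "F k i = - F i k" if "i \<in> J" "k \<in> J" for i k
  proof (cases "i = k")
    case False
    have "J - {k} - {i} = J - {i} - {k}" by auto
    moreover have "koszul_sign k J * koszul_sign i (J - {k}) = - (koszul_sign i J * koszul_sign k (J - {i}))"
      using False by (auto simp: koszul_sign_remove[OF that(1)] koszul_sign_remove[OF that(2)])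
    ultimately show ?thesis using False TT[OF \<xi>[of "J - {i} - {k}"], of k i] by (simp add: F_def)
  qed (simp add: F_def)
  have "(\<Sum>i\<in>J. \<Sum>k\<in>J. F i k) = (\<Sum>i\<in>J. \<Sum>k\<in>J. - F k i)"
    by (intro sum.cong refl anti)
  also have "\<dots> = - (\<Sum>i\<in>J. \<Sum>k\<in>J. F i k)" by (subst sum.swap) (simp add: sum_negf)
  finally have "2 *\<^sub>R (\<Sum>i\<in>J. \<Sum>k\<in>J. F i k) = 0" by (simp add: scaleR_2 eq_neg_iff_add_eq_0)
  then show ?thesis using 1 by simp
qed

text \<open>The Koszul Laplacian is diagonal: the mixed terms \<open>T i (Q k _)\<close> with \<open>i \<noteq> k\<close> cancel in pairs, because \<open>T i\<close>
and \<open>Q k\<close> commute while the signs are opposite.\<close>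

lemma koszul_homotopy:
  assumes \<xi>: "\<And>J. \<xi> J \<in> M"
  shows "koszul_d T (koszul_h Q \<xi>) J + koszul_h Q (koszul_d T \<xi>) J = gram (\<xi> J)"
proof -
  define E where "E i k = (koszul_sign i J * koszul_sign k (J - {i})) *\<^sub>R T i (Q k (\<xi> (insert k (J - {i}))))" for i k
  define E' where "E' k i = (koszul_sign k J * koszul_sign i (insert k J)) *\<^sub>R Q k (T i (\<xi> (insert k J - {i})))" for k i
  have "koszul_d T (koszul_h Q \<xi>) J = (\<Sum>i\<in>J. \<Sum>k\<in>- (J - {i}). E i k)"
    unfolding koszul_d_eq koszul_h_def bopD(7)[OF bop_T] bopD(6)[OF bop_T] scaleR_sum_right
      scaleR_scaleR E_def ..
  also have "\<dots> = (\<Sum>i\<in>J. Q i (T i (\<xi> J)) + (\<Sum>k\<in>- J. E i k))"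
  proof (intro sum.cong refl)
    fix i assume i: "i \<in> J"
    have "- (J - {i}) = insert i (- J)" by auto
    moreover have "E i i = Q i (T i (\<xi> J))"
      using i by (simp add: E_def koszul_sign_remove koszul_sign_square insert_absorb TQ \<xi>)
    ultimately show "(\<Sum>k\<in>- (J - {i}). E i k) = Q i (T i (\<xi> J)) + (\<Sum>k\<in>- J. E i k)" using i by simp
  qed
  finally have dh: "koszul_d T (koszul_h Q \<xi>) J = (\<Sum>i\<in>J. Q i (T i (\<xi> J))) + (\<Sum>i\<in>J. \<Sum>k\<in>- J. E i k)"
    by (simp add: sum.distrib)
  have "koszul_h Q (koszul_d T \<xi>) J = (\<Sum>k\<in>- J. \<Sum>i\<in>insert k J. E' k i)"
    unfolding koszul_d_eq koszul_h_def bopD(7)[OF bop_Q] bopD(6)[OF bop_Q] scaleR_sum_right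
      scaleR_scaleR E'_def ..
  also have "\<dots> = (\<Sum>k\<in>- J. Q k (T k (\<xi> J)) + (\<Sum>i\<in>J. E' k i))"
  proof (intro sum.cong refl)
    fix k assume k: "k \<in> - J"
    then have "E' k k = Q k (T k (\<xi> J))" by (simp add: E'_def koszul_sign_insert koszul_sign_square)
    then show "(\<Sum>i\<in>insert k J. E' k i) = Q k (T k (\<xi> J)) + (\<Sum>i\<in>J. E' k i)" using k by simp
  qed
  also have "\<dots> = (\<Sum>k\<in>- J. Q k (T k (\<xi> J))) + (\<Sum>k\<in>- J. \<Sum>i\<in>J. E' k i)" by (simp add: sum.distrib)
  also have "(\<Sum>k\<in>- J. \<Sum>i\<in>J. E' k i) = (\<Sum>i\<in>J. \<Sum>k\<in>- J. - E i k)"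
  proof (subst sum.swap, intro sum.cong refl)
    fix i k assume ik: "i \<in> J" "k \<in> - J"
    then have "i \<noteq> k" by auto
    then have "insert k J - {i} = insert k (J - {i})" by auto
    moreover have "koszul_sign k J * koszul_sign i (insert k J) = - (koszul_sign i J * koszul_sign k (J - {i}))"
      using ik \<open>i \<noteq> k\<close> by (auto simp: koszul_sign_remove koszul_sign_insert)
    ultimately show "E' k i = - E i k" by (simp add: E_def E'_def TQ \<xi>)
  qed
  also have "\<dots> = - (\<Sum>i\<in>J. \<Sum>k\<in>- J. E i k)" by (simp add: sum_negf)
  finally have hd: "koszul_h Q (koszul_d T \<xi>) J = (\<Sum>k\<in>- J. Q k (T k (\<xi> J))) - (\<Sum>i\<in>J. \<Sum>k\<in>- J. E i k)" by simp
  have "gram (\<xi> J) = (\<Sum>i\<in>J. Q i (T i (\<xi> J))) + (\<Sum>i\<in>- J. Q i (T i (\<xi> J)))"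
    unfolding gram_def by (subst sum.union_disjoint[symmetric]) (auto intro: sum.cong)
  then show ?thesis using dh hd by simp
qed

text \<open>The lower bound of \<^term>\<open>gram\<close> is turned into an upper bound of \<open>r - gram\<close> because upper bounds can be
  iterated and, being strictly below \<open>r\<close>, give invertibility by a fixed point argument.\<close>

lemma gram_lower_bound_imp_contraction:
  assumes "c > 0"
  obtains r q where "0 < q" "q < r"
    "\<And>x. c * (norm x)\<^sup>2 \<le> Re (cinner (gram x) x) \<Longrightarrow> norm (r *\<^sub>R x - gram x) \<le> q * norm x"
proof -
  obtain K where K: "K > 0" "\<And>x. norm (gram x) \<le> K * norm x" using bop_bound[OF bop_gram] by blast
  \<comment> \<open>\<open>norm ((r - gram) x)\<^sup>2 \<le> (r\<^sup>2 - 2 r c + K\<^sup>2) norm x\<^sup>2\<close>, and this choice makes the factor at most \<open>r (r - c)\<close>.\<close>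
  define r where "r = K\<^sup>2 / c + c"
  have rc: "r - c = K\<^sup>2 / c" "r > 0" using assms by (simp_all add: r_def add_nonneg_pos)
  have rc': "c * (r - c) = K\<^sup>2" using assms rc(1) by simp
  define q where "q = sqrt (r * (r - c))"
  have rrc: "r * (r - c) > 0" using K(1) assms rc by simp
  have "r * (r - c) < r * r" using rc(2) assms by (simp add: mult_strict_left_mono)
  then have "q < sqrt (r * r)" unfolding q_def by (rule real_sqrt_less_mono)
  then have "q < r" using rc(2) by simp
  moreover have "q > 0" using rrc by (simp add: q_def)
  moreover have "norm (r *\<^sub>R x - gram x) \<le> q * norm x" if low: "c * (norm x)\<^sup>2 \<le> Re (cinner (gram x) x)" for x
  proof (rule power2_le_imp_le)
    have "Re (cinner (r *\<^sub>R x) (gram x)) = r * Re (cinner (gram x) x)"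
      by (simp add: cinner_scaleC_left Re_cinner_commute[of x] flip: scaleC_of_real)
    then have "(norm (r *\<^sub>R x - gram x))\<^sup>2 = r\<^sup>2 * (norm x)\<^sup>2 - 2 * (r * Re (cinner (gram x) x)) + (norm (gram x))\<^sup>2"
      by (simp add: norm_diff_sq power_mult_distrib)
    also have "\<dots> \<le> r\<^sup>2 * (norm x)\<^sup>2 - 2 * (r * (c * (norm x)\<^sup>2)) + (K * norm x)\<^sup>2"
      using low rc(2) by (intro add_mono diff_mono mult_left_mono power_mono K) auto
    also have "\<dots> = (r\<^sup>2 - 2 * r * c + c * (r - c)) * (norm x)\<^sup>2"
      unfolding rc' by (simp add: power_mult_distrib algebra_simps)
    also have "\<dots> \<le> (r * (r - c)) * (norm x)\<^sup>2"
      using assms by (intro mult_right_mono) (auto simp: power2_eq_square algebra_simps)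
    also have "\<dots> = (q * norm x)\<^sup>2" using rrc by (simp add: q_def power_mult_distrib)
    finally show "(norm (r *\<^sub>R x - gram x))\<^sup>2 \<le> (q * norm x)\<^sup>2" .
    show "0 \<le> q * norm x" using rrc by (simp add: q_def)
  qed
  ultimately show ?thesis using that by blast
qed

text \<open>\<^term>\<open>gram\<close> is invertible on \<open>M\<close>. Thus a closed \<open>\<xi>\<close> is \<open>gram \<zeta>\<close> for a closed \<open>\<zeta>\<close>, and the homotopy formula
exhibits \<open>\<xi>\<close> as the differential of \<open>koszul_h Q \<zeta>\<close>.\<close>

lemma koszul_exact_if_contraction:
  assumes qr: "0 < q" "q < r" and con: "\<And>x. x \<in> M \<Longrightarrow> norm (r *\<^sub>R x - gram x) \<le> q * norm x"
  shows "koszul_exact M T"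
proof -
  have r: "r > 0" using qr by simp
  have inj: "x = 0" if "x \<in> M" "gram x = 0" for x
  proof (rule ccontr)
    assume "x \<noteq> 0"
    then show False using con[OF that(1)] that(2) qr by (simp add: mult_le_cancel_right)
  qed
  have surj: "\<exists>x\<in>M. gram x = y" if y: "y \<in> M" for y
  proof -
    \<comment> \<open>\<open>gram x = y\<close> as a fixed point equation for a contraction\<close>
    define f where "f x = (1 / r) *\<^sub>R (y + (r *\<^sub>R x - gram x))" for x
    have "\<exists>!x\<in>M. f x = x"
    proof (rule Banach_fix)
      show "complete M" using closed by (simp add: complete_eq_closed)
      show "M \<noteq> {}" using y by blast
      show "0 \<le> q / r" "q / r < 1" using qr by auto
      show "f ` M \<subseteq> M"
        by (auto simp: f_def intro!: csubspaceD[OF csub] y gram_in)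
      fix u v assume uv: "u \<in> M" "v \<in> M"
      have "f u - f v = (1 / r) *\<^sub>R (r *\<^sub>R (u - v) - gram (u - v))"
        by (simp add: f_def bopD[OF bop_gram] scaleR_right_diff_distrib scaleR_right_distrib)
      then have "dist (f u) (f v) = (1 / r) * norm (r *\<^sub>R (u - v) - gram (u - v))"
        using r by (simp add: dist_norm)
      also have "\<dots> \<le> (1 / r) * (q * norm (u - v))"
        using r by (intro mult_left_mono con csubspaceD[OF csub] uv) auto
      finally show "dist (f u) (f v) \<le> q / r * dist u v" by (simp add: dist_norm)
    qed
    then obtain x where x: "x \<in> M" "f x = x" by blast
    have "r *\<^sub>R f x = y + (r *\<^sub>R x - gram x)" using r by (simp add: f_def)
    then have "gram x = y" using x(2) by simp
    then show ?thesis using x(1) by blast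
  qed
  have gram_d: "gram (koszul_d T \<zeta> J) = koszul_d T (\<lambda>J. gram (\<zeta> J)) J" if "\<And>J. \<zeta> J \<in> M" for \<zeta> J
    by (simp add: koszul_d_eq bopD[OF bop_gram] gram_T that)
  have d_in: "koszul_d T \<zeta> J \<in> M" if "\<And>J. \<zeta> J \<in> M" for \<zeta> J
    unfolding koszul_d_eq by (intro csubspace_sum[OF csub] csubspaceD(6)[OF csub] T_in that)
  have lift: "\<exists>\<zeta>. \<zeta> \<in> koszul_space M p \<and> (\<forall>J. gram (\<zeta> J) = \<xi> J) \<and> koszul_d T \<zeta> = (\<lambda>_. 0)"
    if \<xi>: "\<xi> \<in> koszul_space M p" "koszul_d T \<xi> = (\<lambda>_. 0)" for \<xi> p
  proof -
    have "\<forall>J. \<exists>x\<in>M. gram x = \<xi> J" using surj \<xi>(1) by (auto simp: koszul_space_def)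
    then obtain \<zeta> where \<zeta>: "\<And>J. \<zeta> J \<in> M" "\<And>J. gram (\<zeta> J) = \<xi> J" by metis
    have "\<zeta> \<in> koszul_space M p" using \<zeta> \<xi>(1) inj by (auto simp: koszul_space_def)
    moreover have "koszul_d T \<zeta> = (\<lambda>_. 0)"
    proof
      fix J
      have "gram (koszul_d T \<zeta> J) = 0" using \<xi>(2) by (simp add: gram_d \<zeta>)
      then show "koszul_d T \<zeta> J = 0" using inj d_in \<zeta>(1) by blast
    qed
    ultimately show ?thesis using \<zeta>(2) by blast
  qed
  show ?thesis
    unfolding koszul_exact_def
  proof (intro conjI allI)
    show "{\<xi> \<in> koszul_space M 0. koszul_d T \<xi> = (\<lambda>_. 0)} = {\<lambda>_. 0}"
    proof (intro equalityI subsetI)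
      fix \<xi> :: "'n set \<Rightarrow> 'a" assume "\<xi> \<in> {\<xi> \<in> koszul_space M 0. koszul_d T \<xi> = (\<lambda>_. 0)}"
      then have \<xi>: "\<xi> \<in> koszul_space M 0" "koszul_d T \<xi> = (\<lambda>_. 0)" by auto
      have \<xi>M: "\<xi> J \<in> M" for J using \<xi>(1) by (auto simp: koszul_space_def)
      have "koszul_h Q \<xi> = (\<lambda>_. 0)"
      proof
        fix J
        have "\<xi> (insert k J) = 0" for k using \<xi>(1) by (auto simp: koszul_space_def)
        then show "koszul_h Q \<xi> J = 0" by (simp add: koszul_h_def bopD[OF bop_Q])
      qed
      then have "gram (\<xi> J) = 0" for J
        using koszul_homotopy[of \<xi> J, OF \<xi>M] \<xi>(2)
        by (simp add: koszul_d_eq koszul_h_def bopD[OF bop_Q] bopD[OF bop_T])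
      then show "\<xi> \<in> {\<lambda>_. 0}" using inj \<xi>M by blast
    next
      fix \<xi> :: "'n set \<Rightarrow> 'a" assume "\<xi> \<in> {\<lambda>_. 0}"
      then show "\<xi> \<in> {\<xi> \<in> koszul_space M 0. koszul_d T \<xi> = (\<lambda>_. 0)}"
        using csubspaceD(1)[OF csub] by (auto simp: koszul_space_def koszul_d_eq bopD[OF bop_T])
    qed
    fix p
    show "{\<xi> \<in> koszul_space M (Suc p). koszul_d T \<xi> = (\<lambda>_. 0)} = koszul_d T ` koszul_space M p"
    proof (intro equalityI subsetI)
      fix \<xi> assume "\<xi> \<in> {\<xi> \<in> koszul_space M (Suc p). koszul_d T \<xi> = (\<lambda>_. 0)}"
      then have \<xi>: "\<xi> \<in> koszul_space M (Suc p)" "koszul_d T \<xi> = (\<lambda>_. 0)" by auto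
      obtain \<zeta> where \<zeta>: "\<zeta> \<in> koszul_space M (Suc p)" "\<And>J. gram (\<zeta> J) = \<xi> J" "koszul_d T \<zeta> = (\<lambda>_. 0)"
        using lift[OF \<xi>] by blast
      have \<zeta>M: "\<zeta> J \<in> M" for J using \<zeta>(1) by (auto simp: koszul_space_def)
      have "\<xi> = koszul_d T (koszul_h Q \<zeta>)"
      proof
        fix J
        show "\<xi> J = koszul_d T (koszul_h Q \<zeta>) J"
          using koszul_homotopy[of \<zeta> J, OF \<zeta>M] \<zeta>(2,3) by (simp add: koszul_h_def bopD[OF bop_Q])
      qed
      then show "\<xi> \<in> koszul_d T ` koszul_space M p"
        using koszul_h_in_koszul_space[of M Q, OF csub bop_Q Q_in \<zeta>(1)] by blast
    next
      fix \<xi> assume "\<xi> \<in> koszul_d T ` koszul_space M p"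
      then obtain \<eta> where \<eta>: "\<eta> \<in> koszul_space M p" "\<xi> = koszul_d T \<eta>" by blast
      then have "\<eta> J \<in> M" for J by (auto simp: koszul_space_def)
      then show "\<xi> \<in> {\<xi> \<in> koszul_space M (Suc p). koszul_d T \<xi> = (\<lambda>_. 0)}"
        using koszul_d_in_koszul_space[of M T, OF csub bop_T T_in \<eta>(1)] koszul_d_d[of \<eta>]
        by (auto simp: \<eta>(2))
    qed
  qed
qed

end

text \<open>For a positive self-adjoint operator this is the spectral subspace of the interval from 0 to \<open>q\<close>,
described without a spectral measure.\<close>

lemma power_bounded_subspace:
  fixes W :: "'a::complex_inner \<Rightarrow> 'a"
  assumes W: "bop W" "\<And>x y. cinner (W x) y = cinner x (W y)" and q: "q > 0"
  defines "Z \<equiv> {x. \<forall>n. norm ((W ^^ n) x) \<le> q ^ n * norm x}"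
  shows "csubspace Z" "closed Z"
proof -
  have Zn: "x \<in> Z \<longleftrightarrow> (\<forall>n. norm ((W ^^ n) x) \<le> q ^ n * norm x)" for x by (simp add: Z_def)
  have Wn: "bop (W ^^ n)" for n by (rule bop_power[OF W(1)])
  \<comment> \<open>By logarithmic convexity, a bound with any constant is a bound with the constant \<open>norm x\<close>.\<close>
  have ZI: "x \<in> Z" if C: "\<And>n. norm ((W ^^ n) x) \<le> C * q ^ n" for x C
  proof (rule ccontr)
    assume "x \<notin> Z"
    define a where "a n = norm ((W ^^ n) x) / q ^ n" for n
    have a0: "a n \<ge> 0" for n using q by (simp add: a_def)
    have conv: "(a (Suc n))\<^sup>2 \<le> a n * a (Suc (Suc n))" for n
    proof -
      have "(norm ((W ^^ Suc n) x))\<^sup>2 = Re (cinner ((W ^^ n) x) ((W ^^ Suc (Suc n)) x))"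
        by (simp add: norm_sq_eq_Re_cinner W(2))
      also have "\<dots> \<le> norm ((W ^^ n) x) * norm ((W ^^ Suc (Suc n)) x)"
        using complex_Re_le_cmod norm_cinner_le order_trans by blast
      finally have "(norm ((W ^^ Suc n) x))\<^sup>2 / (q ^ Suc n)\<^sup>2 \<le>
          norm ((W ^^ n) x) * norm ((W ^^ Suc (Suc n)) x) / (q ^ Suc n)\<^sup>2"
        by (intro divide_right_mono) auto
      moreover have "(q ^ Suc n)\<^sup>2 = q ^ n * q ^ Suc (Suc n)" by (simp add: power2_eq_square)
      ultimately show ?thesis by (simp only: a_def power_divide times_divide_times_eq)
    qed
    obtain n where n: "a n < a (Suc n)"
    proof -
      have "\<exists>n. a n < a (Suc n)"
      proof (rule ccontr)
        assume "\<nexists>n. a n < a (Suc n)"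
        then have "a (Suc n) \<le> a n" for n by (simp add: not_less)
        then have "a n \<le> a 0" for n by (rule lift_Suc_antimono_le) simp
        then have "x \<in> Z" using q by (simp add: Zn a_def divide_le_eq mult.commute)
        then show False using \<open>x \<notin> Z\<close> by contradiction
      qed
      then show ?thesis using that by blast
    qed
    have pos: "a (n + k) > 0 \<and> a (Suc (n + k)) \<ge> (a (Suc n) / a n) * a (n + k)" if "a n > 0" for k
    proof (induction k)
      case (Suc k)
      have p: "a (n + k) > 0" "a (Suc (n + k)) \<ge> (a (Suc n) / a n) * a (n + k)" using Suc by auto
      have p': "a (Suc (n + k)) > 0" 
      proof (rule less_le_trans[OF _ p(2)])
        show "0 < a (Suc n) / a n * a (n + k)" using p(1) n that by simp
      qed
      have "(a (Suc n) / a n) * a (n + k) * a (Suc (n + k)) \<le> a (Suc (n + k)) * a (Suc (n + k))"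
        using p(2) p' by (intro mult_right_mono) auto
      also have "\<dots> \<le> a (n + k) * a (Suc (Suc (n + k)))" using conv[of "n + k"] by (simp add: power2_eq_square)
      finally have "a (n + k) * ((a (Suc n) / a n) * a (Suc (n + k))) \<le> a (n + k) * a (Suc (Suc (n + k)))"
        by (simp only: mult_ac)
      then have "a (Suc n) / a n * a (Suc (n + k)) \<le> a (Suc (Suc (n + k)))"
        using p(1) by (rule mult_left_le_imp_le)
      then show ?case using p' by simp
    qed (use that in simp)
    have an: "a n > 0"
    proof (rule ccontr)
      assume "\<not> a n > 0"
      then have "(W ^^ n) x = 0" using q by (simp add: a_def zero_less_divide_iff)
      then have "a (Suc n) = 0" by (simp add: a_def bopD[OF W(1)])
      then show False using n a0[of n] by simp
    qed
    define \<rho> where "\<rho> = a (Suc n) / a n"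
    have \<rho>: "\<rho> > 1" using n an by (simp add: \<rho>_def)
    have grow: "\<rho> ^ k * a n \<le> a (n + k)" for k
    proof (induction k)
      case (Suc k)
      have "\<rho> ^ Suc k * a n \<le> \<rho> * a (n + k)" using Suc \<rho> by (simp add: mult.assoc)
      also have "\<dots> \<le> a (n + Suc k)" using pos[OF an, of k] by (simp add: \<rho>_def)
      finally show ?case .
    qed simp
    have "a m \<le> C" for m using C[of m] q by (simp add: a_def divide_le_eq)
    then have "\<rho> ^ k \<le> C / a n" for k using grow[of k] an by (simp add: le_divide_eq order_trans)
    moreover obtain k where "C / a n < \<rho> ^ k" using real_arch_pow[OF \<rho>] by blast
    ultimately show False by (metis not_le)
  qed
  show "csubspace Z"
    unfolding csubspace_def
  proof (intro conjI ballI allI)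
    show "0 \<in> Z" by (simp add: Zn bopD[OF Wn])
    fix x assume x: "x \<in> Z"
    show "c *\<^sub>C x \<in> Z" for c
      using x mult_left_mono[of "norm ((W ^^ n) x)" "q ^ n * norm x" "cmod c" for n]
      by (simp add: Zn bopD[OF Wn] norm_scaleC mult_ac)
    fix y assume y: "y \<in> Z"
    show "x + y \<in> Z"
    proof (rule ZI[where C = "norm x + norm y"])
      fix n
      have "norm ((W ^^ n) (x + y)) \<le> norm ((W ^^ n) x) + norm ((W ^^ n) y)"
        unfolding bopD[OF Wn] by (rule norm_triangle_ineq)
      also have "\<dots> \<le> q ^ n * norm x + q ^ n * norm y" using x y by (intro add_mono) (auto simp: Zn)
      finally show "norm ((W ^^ n) (x + y)) \<le> (norm x + norm y) * q ^ n" by (simp add: algebra_simps)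
    qed
  qed
  have "Z = (\<Inter>n. {x. norm ((W ^^ n) x) \<le> q ^ n * norm x})" by (auto simp: Z_def)
  moreover have "closed {x. norm ((W ^^ n) x) \<le> q ^ n * norm x}" for n
    by (intro closed_Collect_le continuous_intros bopD(9)[OF Wn])
  ultimately show "closed Z" by (simp add: closed_INT)
qed

section \<open>Reducing subspaces on which the tuple is normal\<close>

text \<open>\<open>K\<close> takes the place of the distinguished boundary: the passage to closed spans works for every closed
set \<open>K\<close>.\<close>

definition normal_with_spectrum_in ::
    "(complex ^ 'n::{finite,linorder}) set \<Rightarrow> 'a::complex_inner set \<Rightarrow> ('n \<Rightarrow> 'a \<Rightarrow> 'a) \<Rightarrow> bool" where
  "normal_with_spectrum_in K M T \<longleftrightarrow>
     commuting_tuple_on M T \<and> (\<forall>i. normal_on M (T i)) \<and> taylor_spectrum_on M T \<subseteq> K"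

lemma hexa_unitary_on_iff:
  "hexa_unitary_on M T \<longleftrightarrow> normal_with_spectrum_in (distinguished_boundary hexablock) M T"
  by (simp add: hexa_unitary_on_def normal_with_spectrum_in_def)

lemma joint_reducingD:
  assumes "joint_reducing M L T"
  shows "csubspace L" "closed L" "L \<subseteq> M" "\<And>i x. x \<in> L \<Longrightarrow> T i x \<in> L"
    "\<And>i x. x \<in> orthogonal_in M L \<Longrightarrow> T i x \<in> orthogonal_in M L"
  using assms unfolding joint_reducing_def by blast+

lemma bounded_op_on_subspace:
  assumes "bop S" "S ` M \<subseteq> M"
  shows "bounded_op_on M S"
proof -
  obtain K where "\<And>x. norm (S x) \<le> K * norm x" using bop_bound[OF assms(1)] by blast
  then show ?thesis using assms(2) by (auto simp: bounded_op_on_def bopD[OF assms(1)])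
qed

lemma commuting_tuple_on_subspace:
  assumes "commuting_tuple_on UNIV T" "csubspace M" "closed M" "\<And>i. T i ` M \<subseteq> M"
  shows "commuting_tuple_on M T"
  using assms(1-3) bounded_op_on_subspace[OF _ assms(4)] unfolding commuting_tuple_on_def by blast

lemma joint_reducing_adjoint:
  fixes L :: "'a::chilbert_space set"
  assumes L: "joint_reducing UNIV L T" and adj: "adjoint_pair (T i) (Q i)" and x: "x \<in> L"
  shows "Q i x \<in> L"
proof (rule orthogonal_orthogonal)
  show "csubspace L" "closed L" by (rule joint_reducingD[OF L])+
  fix y assume "y \<in> orthogonal_in UNIV L"
  then have "T i y \<in> orthogonal_in UNIV L" by (rule joint_reducingD(5)[OF L])
  then have "cinner (T i y) x = 0" using x by (simp add: orthogonal_in_def)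
  then show "cinner (Q i x) y = 0"
    using cinner_commute[of x "T i y"] by (simp add: adjoint_pairD(3)[OF adj])
qed

text \<open>The adjoint of \<open>T i\<close> relative to the reducing subspace \<open>L\<close> is the restriction of the global adjoint, so
normality on \<open>L\<close> is a statement about \<open>Q i\<close>, and Fuglede's theorem applies.\<close>

lemma normal_tuple_reducing:
  fixes L :: "'a::chilbert_space set" and T Q :: "'n::{finite,linorder} \<Rightarrow> 'a \<Rightarrow> 'a"
  assumes T: "commuting_tuple_on UNIV T" and adj: "\<And>i. adjoint_pair (T i) (Q i)"
    and L: "joint_reducing UNIV L T" and normal: "\<And>i. normal_on L (T i)"
  shows "normal_tuple L T Q"
proof -
  have bT: "bop (T i)" and TT: "T i (T j x) = T j (T i x)" for i j x
    using T by (auto simp: commuting_tuple_on_def)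
  have bQ: "bop (Q i)" for i by (rule adjoint_pairD(1)[OF adj])
  note sub = joint_reducingD(1,2)[OF L] and T_in = joint_reducingD(4)[OF L]
  have Q_in: "Q i x \<in> L" if "x \<in> L" for x i by (rule joint_reducing_adjoint[OF L adj that])
  have TQ1: "T i (Q i x) = Q i (T i x)" if x: "x \<in> L" for i x
  proof -
    obtain R where R: "is_adjoint_on L (T i) R" "\<And>x. x \<in> L \<Longrightarrow> T i (R x) = R (T i x)"
      using normal[of i] by (auto simp: normal_on_def)
    have RL: "R y \<in> L" if "y \<in> L" for y
      using R(1) that by (auto simp: is_adjoint_on_def bounded_op_on_def)
    have Radj: "cinner (T i z) y = cinner z (R y)" if "y \<in> L" "z \<in> L" for y z
      using R(1) that by (auto simp: is_adjoint_on_def)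
    have RQ: "R y = Q i y" if y: "y \<in> L" for y
    proof -
      define u where "u = R y - Q i y"
      have u: "u \<in> L" unfolding u_def by (intro csubspaceD[OF sub(1)] RL Q_in y)
      have "cinner u u = cinner u (R y) - cinner u (Q i y)" by (simp add: u_def cinner_diff_right)
      also have "\<dots> = 0" by (simp add: Radj[OF y u, symmetric] adjoint_pairD(2)[OF adj])
      finally show ?thesis by (simp add: cinner_self_eq_zero u_def)
    qed
    show ?thesis using R(2)[OF x] by (simp add: RQ x T_in)
  qed
  show ?thesis
  proof
    fix i j x assume x: "x \<in> L"
    show "T i (Q j x) = Q j (T i x)"
    proof (rule sym, rule fuglede[of "Q j" "T j" "T i" L x])
      show "bop (Q j)" "bop (T j)" "bop (T i)" by (rule bQ bT)+
      show "csubspace L" "x \<in> L" by (rule sub x)+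
      show "cinner (T j u) v = cinner u (Q j v)" for u v by (rule adjoint_pairD(2)[OF adj])
      show "T j u \<in> L" "Q j u \<in> L" "T i u \<in> L" "T j (Q j u) = Q j (T j u)" "T j (T i u) = T i (T j u)"
        if "u \<in> L" for u
        using that by (simp_all add: T_in Q_in TQ1 TT[of j i])
    qed
  qed (use sub bT adj T_in Q_in TT in auto)
qed

text \<open>Each property is transferred by showing that the vectors having it form a closed subspace
that contains all members of \<open>F\<close>.\<close>

theorem normal_with_spectrum_in_closed_span:
  fixes T :: "'n::{finite,linorder} \<Rightarrow> 'a::chilbert_space \<Rightarrow> 'a"
  assumes K: "closed K" and T: "commuting_tuple_on UNIV T"
    and F: "\<And>L. L \<in> F \<Longrightarrow> joint_reducing UNIV L T \<and> normal_with_spectrum_in K L T"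
  defines "H \<equiv> \<Inter>{S. csubspace S \<and> closed S \<and> \<Union>F \<subseteq> S}"
  shows "joint_reducing UNIV H T" "normal_with_spectrum_in K H T"
proof -
  have bT: "bop (T i)" and TT: "T i (T j x) = T j (T i x)" for i j x
    using T by (auto simp: commuting_tuple_on_def)
  have "\<exists>R. adjoint_pair (T i) R" for i using adjoint_exists[OF bT] by blast
  then obtain Q where adj: "\<And>i. adjoint_pair (T i) (Q i)" by metis
  have bQ: "bop (Q i)" for i by (rule adjoint_pairD(1)[OF adj])
  have H: "csubspace H" "closed H"
    unfolding H_def by (auto intro!: csubspace_Inter closed_Inter)
  have FH: "x \<in> H" if "L \<in> F" "x \<in> L" for L x using that unfolding H_def by blast
  have H_induct: "x \<in> S" if "csubspace S" "closed S" "\<And>L y. L \<in> F \<Longrightarrow> y \<in> L \<Longrightarrow> y \<in> S" "x \<in> H" for S x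
    using that unfolding H_def by blast
  have nt: "normal_tuple L T Q" if "L \<in> F" for L
    using F[OF that] by (intro normal_tuple_reducing[OF T adj]) (auto simp: normal_with_spectrum_in_def)
  have inv: "S x \<in> H" if S: "bop S" "\<And>L y. L \<in> F \<Longrightarrow> y \<in> L \<Longrightarrow> S y \<in> L" and x: "x \<in> H" for S x
  proof -
    have "csubspace {x. S x \<in> H}"
      using csubspaceD[OF H(1)] by (auto simp: csubspace_def bopD[OF S(1)])
    moreover have "closed {x. S x \<in> H}"
      using closed_vimage[OF H(2) bopD(9)[OF S(1)]] by (simp add: vimage_def)
    ultimately have "x \<in> {x. S x \<in> H}" by (rule H_induct) (use S(2) FH x in auto)
    then show ?thesis by simp
  qed
  have T_in: "T i x \<in> H" if "x \<in> H" for i x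
    using inv[OF bT _ that] normal_tuple.T_in[OF nt] by blast
  have Q_in: "Q i x \<in> H" if "x \<in> H" for i x
    using inv[OF bQ _ that] normal_tuple.Q_in[OF nt] by blast
  have TQ: "T i (Q j x) = Q j (T i x)" if x: "x \<in> H" for i j x
  proof -
    have b: "bop (\<lambda>x. T i (Q j x))" "bop (\<lambda>x. Q j (T i x))"
      by (rule bop_compose[OF bT bQ]) (rule bop_compose[OF bQ bT])
    have "csubspace {x. T i (Q j x) = Q j (T i x)}"
      by (auto simp: csubspace_def bopD[OF bT] bopD[OF bQ])
    moreover have "closed {x. T i (Q j x) = Q j (T i x)}"
      by (intro closed_Collect_eq bopD(9)[OF b(1)] bopD(9)[OF b(2)])
    ultimately have "x \<in> {x. T i (Q j x) = Q j (T i x)}"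
      by (rule H_induct) (use normal_tuple.TQ[OF nt] x in auto)
    then show ?thesis by simp
  qed
  show red: "joint_reducing UNIV H T"
    unfolding joint_reducing_def
  proof (intro conjI allI H subset_UNIV image_subsetI)
    fix i x
    show "T i x \<in> H" if "x \<in> H" using T_in[OF that] .
    assume x: "x \<in> orthogonal_in UNIV H"
    show "T i x \<in> orthogonal_in UNIV H"
      using x Q_in by (auto simp: orthogonal_in_def adjoint_pairD(2)[OF adj])
  qed
  interpret HH: normal_tuple H T Q
    by standard (use H bT adj T_in Q_in TT TQ in auto)
  have comm: "commuting_tuple_on H T"
    by (rule commuting_tuple_on_subspace[OF T H]) (use T_in in blast)
  have normal: "normal_on H (T i)" for i
    unfolding normal_on_def is_adjoint_on_def
    using Q_in TQ adjoint_pairD(2)[OF adj]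
    by (intro exI[of _ "Q i"]) (auto intro!: bounded_op_on_subspace[OF bQ])
  have "taylor_spectrum_on H T \<subseteq> K"
  proof
    fix l :: "complex ^ 'n::{finite,linorder}" assume l: "l \<in> taylor_spectrum_on H T"
    show "l \<in> K"
    proof (rule ccontr)
      assume "l \<notin> K"
      then obtain d where d: "d > 0" "ball l d \<inter> K = {}"
        using K by (metis closed_def open_contains_ball ComplI disjoint_eq_subset_Compl)
      define TL where "TL = (\<lambda>i x. T i x - l $ i *\<^sub>C x)"
      define QL where "QL = (\<lambda>i x. Q i x - cnj (l $ i) *\<^sub>C x)"
      have HL: "normal_tuple H TL QL"
        unfolding TL_def QL_def by (rule HH.normal_tuple_shift)
      have FL: "normal_tuple L TL QL" if "L \<in> F" for L
        unfolding TL_def QL_def by (rule normal_tuple.normal_tuple_shift[OF nt[OF that]])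
      define G where "G x = (\<Sum>i\<in>UNIV. QL i (TL i x))" for x
      have G: "normal_tuple.gram TL QL = G" if "normal_tuple L TL QL" for L
        unfolding G_def using normal_tuple.gram_def[OF that] by blast
      define c where "c = (d / (2 * CARD('n)))\<^sup>2"
      have c: "c > 0" using d(1) by (simp add: c_def)
      have low: "c * (norm x)\<^sup>2 \<le> Re (cinner (G x) x)" if L: "L \<in> F" and x: "x \<in> L" for L x
        unfolding c_def G[OF FL[OF L], symmetric]
      proof (rule normal_tuple.gram_bounded_below[OF FL[OF L] d(1) _ x])
        fix \<mu> :: "complex ^ 'n::{finite,linorder}" assume "norm \<mu> < d"
        then have "l + \<mu> \<in> ball l d" by (simp add: dist_norm)
        then have "l + \<mu> \<notin> taylor_spectrum_on L T"
          using d(2) F[OF L] by (auto simp: normal_with_spectrum_in_def)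
        then show "koszul_exact L (\<lambda>i x. TL i x - \<mu> $ i *\<^sub>C x)"
          by (simp add: taylor_spectrum_on_def TL_def scaleC_add_left diff_diff_eq)
      qed
      obtain r q where rq: "0 < q" "q < r"
        and con: "\<And>x. c * (norm x)\<^sup>2 \<le> Re (cinner (G x) x) \<Longrightarrow> norm (r *\<^sub>R x - G x) \<le> q * norm x"
        using normal_tuple.gram_lower_bound_imp_contraction[OF HL c] unfolding G[OF HL] by blast
      define W where "W = (\<lambda>x. r *\<^sub>R x - G x)"
      have bG: "bop G" using normal_tuple.bop_gram[OF HL] unfolding G[OF HL] .
      have Gsa: "cinner (G x) y = cinner x (G y)" for x y
        using normal_tuple.gram_self_adjoint[OF HL] unfolding G[OF HL] .
      have bW: "bop W" using bop_diff[OF bop_scaleC[OF bop_id, of "of_real r"] bG]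
        by (simp only: W_def scaleC_of_real)
      have Wsa: "cinner (W x) y = cinner x (W y)" for x y
        by (simp add: W_def cinner_simps Gsa flip: scaleC_of_real)
      define Z where "Z = {x. \<forall>n. norm ((W ^^ n) x) \<le> q ^ n * norm x}"
      have Z: "csubspace Z" "closed Z" unfolding Z_def by (rule power_bounded_subspace[OF bW Wsa rq(1)])+
      have "H \<subseteq> Z"
      proof
        fix x assume "x \<in> H"
        show "x \<in> Z"
        proof (rule H_induct[OF Z _ \<open>x \<in> H\<close>])
          fix L y assume L: "L \<in> F" and y: "y \<in> L"
          have W_in: "W z \<in> L" if z: "z \<in> L" for z
            unfolding W_def using normal_tuple.gram_in[OF FL[OF L] z] z
              csubspaceD(5,6)[OF normal_tuple.csub[OF FL[OF L]]]
            by (simp add: G[OF FL[OF L]])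
          have Wn: "(W ^^ n) y \<in> L" for n by (induction n) (auto simp: y W_in)
          have "norm ((W ^^ n) y) \<le> q ^ n * norm y" for n
          proof (induction n)
            case (Suc n)
            have "norm ((W ^^ Suc n) y) \<le> q * norm ((W ^^ n) y)"
              using con[OF low[OF L Wn[of n]]] by (simp add: W_def)
            also have "\<dots> \<le> q * (q ^ n * norm y)" using Suc rq(1) by (intro mult_left_mono) auto
            finally show ?case by simp
          qed simp
          then show "y \<in> Z" by (simp add: Z_def)
        qed
      qed
      then have "norm (W x) \<le> q * norm x" if "x \<in> H" for x
        using that by (auto simp: Z_def dest!: subsetD spec[of _ "1::nat"])
      then have "koszul_exact H TL"
        using normal_tuple.koszul_exact_if_contraction[OF HL rq] unfolding G[OF HL] W_def by blast
      then show False using l by (simp add: taylor_spectrum_on_def TL_def)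
    qed
  qed
  then show "normal_with_spectrum_in K H T"
    using comm normal by (simp add: normal_with_spectrum_in_def)
qed

section \<open>The canonical decomposition\<close>

lemma bop_op_poly4:
  assumes "\<And>i. bop (T i)"
  shows "bop (op_poly4 p T)"
proof -
  have monomial: "bop (\<lambda>x. (T 0 ^^ a) ((T 1 ^^ b) ((T 2 ^^ c) ((T 3 ^^ d) x))))" for a b c d
    using bop_compose[of "T 0 ^^ a" "\<lambda>x. (T 1 ^^ b) ((T 2 ^^ c) ((T 3 ^^ d) x))"]
      bop_compose[of "T 1 ^^ b" "\<lambda>x. (T 2 ^^ c) ((T 3 ^^ d) x)"]
      bop_compose[of "T 2 ^^ c" "T 3 ^^ d"] bop_power[OF assms] by blast
  show ?thesis
    unfolding op_poly4_def[abs_def] by (rule bop_sum, rule bop_scaleC, rule monomial)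
qed

lemma hexa_contraction_on_subspace:
  assumes T: "hexa_contraction_on UNIV T" and M: "csubspace M" "closed M" "\<And>i. T i ` M \<subseteq> M"
  shows "hexa_contraction_on M T"
proof -
  have comm: "commuting_tuple_on UNIV T"
    and le: "onorm_on UNIV (op_poly4 p T) \<le> (SUP w\<in>closure hexablock. cmod (eval_poly4 p w))" for p
    using T by (auto simp: hexa_contraction_on_def)
  then have bT: "bop (T i)" for i by (auto simp: commuting_tuple_on_def)
  have "commuting_tuple_on M T"
    by (rule commuting_tuple_on_subspace[OF comm M])
  moreover have "onorm_on M (op_poly4 p T) \<le> onorm_on UNIV (op_poly4 p T)" for p
    unfolding onorm_on_def
  proof (rule cSUP_subset_mono)
    show "M \<noteq> {}" using csubspaceD(1)[OF M(1)] by auto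
    obtain K where "K > 0" "\<And>x. norm (op_poly4 p T x) \<le> K * norm x"
      using bop_bound[OF bop_op_poly4[of T p, OF bT]] by blast
    then have "norm (op_poly4 p T x) / norm x \<le> K" for x
      by (cases "x = 0") (auto simp: divide_le_eq)
    then show "bdd_above ((\<lambda>x. norm (op_poly4 p T x) / norm x) ` UNIV)" by (intro bdd_aboveI[of _ K]) auto
  qed auto
  ultimately show ?thesis using le order_trans unfolding hexa_contraction_on_def by blast
qed

text \<open>A vector orthogonal to \<open>L\<close> splits into a part in \<open>H\<close> and a part in the complement of \<open>H\<close> that is again
orthogonal to \<open>L\<close>; both parts keep these properties under \<open>T\<close>.\<close>

lemma joint_reducing_trans:
  fixes H L :: "'a::chilbert_space set"
  assumes H: "joint_reducing UNIV H T" and T: "\<And>i. bop (T i)"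
    and L: "joint_reducing (orthogonal_in UNIV H) L T"
  shows "joint_reducing UNIV L T"
proof -
  let ?C = "orthogonal_in UNIV H"
  have Hs: "csubspace H" "closed H" and Ls: "csubspace L" "closed L" "L \<subseteq> ?C"
    and TH: "\<And>i. T i ` H \<subseteq> H" and TL: "\<And>i. T i ` L \<subseteq> L" "\<And>i. T i ` orthogonal_in ?C L \<subseteq> orthogonal_in ?C L"
    using joint_reducingD[OF H] joint_reducingD[OF L] by blast+
  have HL: "cinner h y = 0" if "h \<in> H" "y \<in> L" for h y
    using that Ls(3) cinner_commute[of h y] by (auto simp: orthogonal_in_def)
  have "T i x \<in> orthogonal_in UNIV L" if x: "x \<in> orthogonal_in UNIV L" for i x
  proof -
    obtain h where h: "h \<in> H" "x - h \<in> ?C" using orthogonal_projection_exists[OF Hs] by blast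
    have "x - h \<in> orthogonal_in ?C L"
      using h x HL by (auto simp: orthogonal_in_def cinner_simps)
    then have "T i (x - h) \<in> orthogonal_in ?C L" using TL(2) by blast
    moreover have "T i h \<in> H" using TH h(1) by blast
    moreover have "T i x = T i h + T i (x - h)" by (simp add: bopD[OF T])
    ultimately show ?thesis using HL by (simp add: orthogonal_in_def cinner_add_left)
  qed
  then show ?thesis using Ls TL(1) by (auto simp: joint_reducing_def)
qed

lemma joint_reducing_orthogonal:
  fixes H :: "'a::chilbert_space set"
  assumes "joint_reducing UNIV H T"
  shows "joint_reducing UNIV (orthogonal_in UNIV H) T"
proof -
  have Hs: "csubspace H" "closed H" and TH: "\<And>i. T i ` H \<subseteq> H"
      "\<And>i. T i ` orthogonal_in UNIV H \<subseteq> orthogonal_in UNIV H"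
    using joint_reducingD[OF assms] by blast+
  have sym: "cinner x y = 0" if "y \<in> orthogonal_in UNIV H" "x \<in> H" for x y
    using that cinner_commute[of x y] by (auto simp: orthogonal_in_def)
  have "orthogonal_in UNIV (orthogonal_in UNIV H) = H"
  proof (intro equalityI subsetI)
    fix x assume "x \<in> orthogonal_in UNIV (orthogonal_in UNIV H)"
    then show "x \<in> H" by (intro orthogonal_orthogonal[OF Hs]) (auto simp: orthogonal_in_def)
  next
    fix x assume "x \<in> H"
    then show "x \<in> orthogonal_in UNIV (orthogonal_in UNIV H)"
      using sym by (auto simp: orthogonal_in_def[of UNIV "orthogonal_in UNIV H"])
  qed
  moreover have "csubspace (UNIV :: 'a set)" by (simp add: csubspace_def)
  ultimately show ?thesis
    unfolding joint_reducing_def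
    by (simp add: TH csubspace_orthogonal closed_orthogonal)
qed

theorem theorem6p4:
  fixes A X1 X2 X3 :: "'a::chilbert_space \<Rightarrow> 'a"
  assumes "hexa_contraction_on UNIV (quadruple A X1 X2 X3)"
  shows "\<exists>Hu Hc.
    joint_reducing UNIV Hu (quadruple A X1 X2 X3) \<and>
    joint_reducing UNIV Hc (quadruple A X1 X2 X3) \<and>
    (\<forall>x\<in>Hu. \<forall>y\<in>Hc. cinner x y = 0) \<and> (\<forall>z. \<exists>x\<in>Hu. \<exists>y\<in>Hc. z = x + y) \<and>
    hexa_unitary_on Hu (quadruple A X1 X2 X3) \<and>
    hexa_cnu_on Hc (quadruple A X1 X2 X3) \<and>
    (\<forall>L. joint_reducing UNIV L (quadruple A X1 X2 X3) \<and>
         hexa_unitary_on L (quadruple A X1 X2 X3) \<longrightarrow> L \<subseteq> Hu)"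
proof -
  define T where "T = quadruple A X1 X2 X3"
  have contr: "hexa_contraction_on UNIV T" using assms by (simp add: T_def)
  then have comm: "commuting_tuple_on UNIV T" by (simp add: hexa_contraction_on_def)
  then have bT: "bop (T i)" for i by (simp add: commuting_tuple_on_def)
  define F where "F = {L. joint_reducing UNIV L T \<and> hexa_unitary_on L T}"
  define Hu where "Hu = \<Inter>{S. csubspace S \<and> closed S \<and> \<Union>F \<subseteq> S}"
  define Hc where "Hc = orthogonal_in UNIV Hu"
  have red: "joint_reducing UNIV Hu T" and uni: "hexa_unitary_on Hu T"
    using normal_with_spectrum_in_closed_span[OF closed_distinguished_boundary_hexablock comm, of F]
    unfolding Hu_def hexa_unitary_on_iff by (auto simp: F_def hexa_unitary_on_iff)
  have max: "L \<subseteq> Hu" if "joint_reducing UNIV L T" "hexa_unitary_on L T" for L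
    using that unfolding Hu_def F_def by blast
  note Hu = joint_reducingD(1,2)[OF red]
  have redc: "joint_reducing UNIV Hc T" unfolding Hc_def by (rule joint_reducing_orthogonal[OF red])
  have perp: "cinner x y = 0" if "x \<in> Hu" "y \<in> Hc" for x y
    using that cinner_commute[of x y] by (auto simp: Hc_def orthogonal_in_def)
  have split: "\<exists>x\<in>Hu. \<exists>y\<in>Hc. z = x + y" for z
  proof -
    obtain m where "m \<in> Hu" "z - m \<in> Hc" using orthogonal_projection_exists[OF Hu] unfolding Hc_def by blast
    then show ?thesis by (intro bexI[of _ m] bexI[of _ "z - m"]) auto
  qed
  have "hexa_contraction_on Hc T"
    using joint_reducingD[OF redc] by (intro hexa_contraction_on_subspace[OF contr]) auto
  moreover have "L = {0}" if L: "joint_reducing Hc L T" "hexa_unitary_on L T" for L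
  proof -
    have "joint_reducing UNIV L T" using L(1) unfolding Hc_def by (rule joint_reducing_trans[OF red bT])
    then have "L \<subseteq> Hu" using L(2) by (rule max)
    moreover have "L \<subseteq> Hc" "0 \<in> L"
      by (rule joint_reducingD(3)[OF L(1)] csubspaceD(1)[OF joint_reducingD(1)[OF L(1)]])+
    ultimately show ?thesis using perp cinner_self_eq_zero by blast
  qed
  ultimately have "hexa_cnu_on Hc T" unfolding hexa_cnu_on_def by blast
  then show ?thesis
    unfolding T_def[symmetric]
    by (intro exI[of _ Hu] exI[of _ Hc] conjI allI ballI impI)
      (use red redc perp split uni max in \<open>simp_all\<close>)
qed

end
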